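(* Let $X$ be a set, and let $\Lambda=\Lambda(X)$, $\mathcal S'$, $\mathfrak T'$ and $R$ be as defined in the context. Then $(\Lambda,\mathcal S',\mathfrak T',R)$ is a generalized presentation of the symmetric group $\Sigma(X)$.
   Context: **Big free groups.** For a set $\Lambda$ with a fixed-point-free involution $\lambda\mapsto\lambda^{-1}$, let $\mathcal T(\Lambda)$ be the set of all maps $f:S\to\Lambda$ with $S$ totally ordered and $f^{-1}(\lambda)$ finite for every $\lambda\in\Lambda$; $f:S\to\Lambda$ and $f':S'\to\Lambda$ are identified if $f=f'\circ\varphi$ for an order-preserving bijection $\varphi:S\to S'$. Write $f\searrow g$ ("$g$ is obtained from $f:S\to\Lambda$ by cancellation") if there are $T\subseteq S$ with $g=f|_{S\setminus T}$ and an involution $*$ on $T$ such that for all $t\in T$: $f(t^* )=f(t)^{-1}$, $[t,t^*]\subseteq T$, and $([t,t^*])^*=[t,t^*]$, where $[s,s']=\{x\in S\mid s\le x\le s'\}$. Let $\approx$ be the equivalence relation generated by $\searrow$; $\mathrm{BF}(\Lambda)=\mathcal T(\Lambda)/\!\approx$ is a group under concatenation, with class of $f$ denoted $[f]$. For $f:S\to\Lambda$ let $\bar f:\bar S\to\Lambda$, $\bar f(s)=f(s)^{-1}$, where $\bar S$ is $S$ with reversed order. A subset $\mathcal S\subseteq\mathcal T(\Lambda)$ is admissible if it is closed under concatenation, under $f\mapsto\bar f$, and under $f\searrow g$; then $\mathrm{BF}(\Lambda;\mathcal S)=\mathcal S/\!\approx$ is a subgroup of $\mathrm{BF}(\Lambda)$.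 $\Lambda$ is regarded as a subset of $\mathrm{BF}(\Lambda)$ via one-letter maps, and $\mathcal F(\Lambda)$ is the subgroup generated by $\Lambda$ (a free group). **Topologies.** For $A=A^{-1}\subseteq\Lambda$, restriction of $f$ to $f^{-1}(A)$ induces a homomorphism $\varphi_A:\mathrm{BF}(\Lambda)\to\mathrm{BF}(A)$. The natural topology on $\mathrm{BF}(\Lambda)$ and its subgroups has the subgroups $\ker\varphi_A$, $A$ finite, (intersected with the subgroup) as a basis of neighborhoods of $1$. If $\Lambda\subseteq\mathcal S$, a topology on $\mathrm{BF}(\Lambda;\mathcal S)$ is admissible if it makes it a topological group, is finer than (or equal to) the natural topology, and $\mathcal F(\Lambda)$ is dense. **Generalized presentations.** A generalized presentation of a group $G$ is a tuple $(\Lambda,\mathcal S,\mathfrak T,R)$ where $\Lambda$ is a set with a free involution, $\mathcal S\subseteq\mathcal T(\Lambda)$ is admissible with $\Lambda\subseteq\mathcal S$, $\mathfrak T$ is an admissible topology on $\mathrm{BF}(\Lambda;\mathcal S)$, $R\subseteq\mathrm{BF}(\Lambda;\mathcal S)$, and there is an epimorphism $p:\mathrm{BF}(\Lambda;\mathcal S)\to G$ such that $\ker p$ is the smallest $\mathfrak T$-closed normal subgroup containing $R$. **The data for $\Sigma(X)$.** $\Sigma(X)$ is the group of all bijections of $X$. Let $\Lambda=\Lambda(X)=\{T_{x,y}\mid x,y\in X,\ x\ne y\}$ (formal symbols) with involution $T_{x,y}^{-1}=T_{y,x}$. For $f:S\to\Lambda$ write $f(s)=T_{f_1(s),f_2(s)}$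 and $U(z,f)=\{s\in S\mid z\in\{f_1(s),f_2(s)\}\}$. Let $\mathcal S_0=\{f\mid |U(x,f)|<\infty\ \forall x\in X\}$. For $f\in\mathcal S_0$ and $x\in X$ define sequences as follows: $x_0^+=x$; if $U(x,f)=\emptyset$ put $n^+(x)=0$; otherwise $s_1^+(x)=\min U(x,f)$. Given $x_{n-1}^+$ and $s_n^+(x)$, define $x_n^+$ by $\{x_{n-1}^+,x_n^+\}=\{f_1(s_n^+(x)),f_2(s_n^+(x))\}$, and let $s_{n+1}^+(x)$ be the smallest element of $U(x_n^+,f)$ bigger than $s_n^+(x)$, if it exists; if not, put $n^+(x)=n$. If this never stops, $n^+(x)=\infty$. Define $x_n^-$, $s_n^-(x)$, $n^-(x)$ symmetrically (with max instead of min, moving downwards in $S$). Let $\mathcal S=\{f\in\mathcal S_0\mid n^+(x)<\infty,\ n^-(x)<\infty\ \forall x\in X\}$ (an admissible set). For $f\in\mathcal S$ let $x_\infty(f)$ be the last element of the finite sequence $x_0^+,x_1^+,\dots$; it depends only on $[f]$ and $x$. For finite $C\subseteq X$ let $\psi_C$ be the restriction of $\varphi_{\Lambda(C)}$ to $\mathrm{BF}(\Lambda;\mathcal S)$, $V_C=\{[\gamma]\in\mathrm{BF}(\Lambda;\mathcal S)\mid x_\infty(\gamma)=x\ \forall x\in C\}$. The topology $\mathfrak T$ on $\mathrm{BF}(\Lambda;\mathcal S)$ has the subgroups $W_C=\ker\psi_C\cap V_C$ ($C\subseteq X$ finite) as a basis of neighborhoods of $1$. $\mathcal S'$ is the set of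 all $f:S\to\Lambda$ in $\mathcal T(\Lambda)$ such that $f|_I\in\mathcal S$ for every interval $I$ of $S$ (a subset $I$ is an interval if $s<s''<s'$ with $s,s'\in I$ implies $s''\in I$). $\mathfrak T'$ is the subspace topology on $\mathrm{BF}(\Lambda;\mathcal S')\subseteq\mathrm{BF}(\Lambda;\mathcal S)$ induced by $\mathfrak T$. $R$ consists of the elements $T_{x,y}^2$ ($x\neq y$); $[T_{x,y},T_{z,w}]$ for $|\{x,y,z,w\}|=4$; and $T_{x,y}T_{x,z}T_{x,y}^{-1}T_{y,z}^{-1}$ for $|\{x,y,z\}|=3$. *)

theory Defs
  imports
    "HOL-Algebra.Bij"
    "HOL-Algebra.Generated_Groups"
    "HOL-Analysis.Analysis"
    "HOL-Library.Extended_Nat"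
begin

section \<open>Transfinite words\<close>

text \<open>
  A map \<open>f : S \<rightarrow> \<Lambda>\<close> on a totally ordered set \<open>S\<close>: \<open>wpos\<close> is \<open>S\<close>, \<open>wle\<close> its (reflexive) order,
  \<open>wlab\<close> the map; the values of \<open>wlab\<close> outside \<open>S\<close> carry no information.
\<close>

record ('s, 'l) tword =
  wpos :: "'s set"
  wle :: "'s rel"
  wlab :: "'s \<Rightarrow> 'l"

definition word_over :: "'l set \<Rightarrow> ('s, 'l) tword \<Rightarrow> bool" where
  "word_over L f \<longleftrightarrow> linear_order_on (wpos f) (wle f) \<and> wlab f ` wpos f \<subseteq> L \<and>
     (\<forall>l\<in>L. finite {s \<in> wpos f. wlab f s = l})"

definition word_iso :: "('s, 'l) tword \<Rightarrow> ('t, 'l) tword \<Rightarrow> bool" where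
  "word_iso f g \<longleftrightarrow> (\<exists>\<phi>. bij_betw \<phi> (wpos f) (wpos g) \<and>
     (\<forall>s\<in>wpos f. \<forall>t\<in>wpos f. (s, t) \<in> wle f \<longleftrightarrow> (\<phi> s, \<phi> t) \<in> wle g) \<and>
     (\<forall>s\<in>wpos f. wlab f s = wlab g (\<phi> s)))"

definition word_restrict :: "('s, 'l) tword \<Rightarrow> 's set \<Rightarrow> ('s, 'l) tword" where
  "word_restrict f I = \<lparr>wpos = wpos f \<inter> I, wle = wle f \<inter> (I \<times> I), wlab = wlab f\<rparr>"

definition word_rev :: "('s, 'l) tword \<Rightarrow> ('s, 'l) tword" where
  "word_rev f = f\<lparr>wle := (wle f)\<inverse>\<rparr>"

definition word_bar :: "('l \<Rightarrow> 'l) \<Rightarrow> ('s, 'l) tword \<Rightarrow> ('s, 'l) tword" where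
  "word_bar \<iota> f = (word_rev f)\<lparr>wlab := \<iota> \<circ> wlab f\<rparr>"

definition word_sum :: "('s, 'l) tword \<Rightarrow> ('t, 'l) tword \<Rightarrow> ('s + 't, 'l) tword" where
  "word_sum f g =
     \<lparr>wpos = wpos f <+> wpos g,
      wle = map_prod Inl Inl ` wle f \<union> map_prod Inr Inr ` wle g \<union> (Inl ` wpos f) \<times> (Inr ` wpos g),
      wlab = case_sum (wlab f) (wlab g)\<rparr>"

text \<open>
  Fibres of a word being finite, it is determined up to isomorphism by a word whose positions are
  pairs (letter, number of earlier occurrences of that letter). Hence positions of type
  \<open>'l \<times> nat\<close> suffice to represent every isomorphism class, see \<open>word_encode_iso\<close>.
\<close>

type_synonym 'l bword = "('l \<times> nat, 'l) tword"

definition word_index :: "('s, 'l) tword \<Rightarrow> 's \<Rightarrow> 'l \<times> nat" where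
  "word_index f s =
     (wlab f s, card {t \<in> wpos f. (t, s) \<in> wle f \<and> t \<noteq> s \<and> wlab f t = wlab f s})"

definition word_encode :: "('s, 'l) tword \<Rightarrow> 'l bword" where
  "word_encode f =
     \<lparr>wpos = word_index f ` wpos f,
      wle = map_prod (word_index f) (word_index f) ` wle f,
      wlab = fst\<rparr>"

lemma word_encode_iso:
  assumes "word_over L f"
  shows "word_iso f (word_encode f)"
proof -
  from assms have sub: "wle f \<subseteq> wpos f \<times> wpos f" and tr: "trans (wle f)"
    and as: "antisym (wle f)" and tot: "total_on (wpos f) (wle f)"
    and lab: "wlab f ` wpos f \<subseteq> L" and fin: "\<And>l. l \<in> L \<Longrightarrow> finite {s \<in> wpos f. wlab f s = l}"
    by (auto simp: word_over_def order_on_defs)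
  have less: "word_index f s \<noteq> word_index f t"
    if st: "s \<in> wpos f" "t \<in> wpos f" "s \<noteq> t" "(s, t) \<in> wle f" for s t
  proof (cases "wlab f s = wlab f t")
    case True
    let ?P = "\<lambda>t. {r \<in> wpos f. (r, t) \<in> wle f \<and> r \<noteq> t \<and> wlab f r = wlab f t}"
    have "finite (?P t)"
      by (rule finite_subset [OF _ fin [of "wlab f t"]]) (use lab st in auto)
    moreover have "?P s \<subseteq> ?P t"
      using True st tr as by (auto dest: transD antisymD)
    moreover have "s \<in> ?P t" "s \<notin> ?P s" using True st by auto
    ultimately have "card (?P s) < card (?P t)" by (metis (no_types, lifting) psubset_card_mono psubsetI)
    then show ?thesis by (simp add: word_index_def)
  qed (simp add: word_index_def)
  have inj: "inj_on (word_index f) (wpos f)"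
  proof (rule inj_onI, rule ccontr)
    fix s t
    assume st: "s \<in> wpos f" "t \<in> wpos f" "word_index f s = word_index f t" "s \<noteq> t"
    then consider "(s, t) \<in> wle f" | "(t, s) \<in> wle f" using tot by (auto simp: total_on_def)
    then show False using less [of s t] less [of t s] st by cases auto
  qed
  have "(s, t) \<in> wle f \<longleftrightarrow> (word_index f s, word_index f t) \<in> wle (word_encode f)"
    if "s \<in> wpos f" "t \<in> wpos f" for s t
  proof
    assume "(word_index f s, word_index f t) \<in> wle (word_encode f)"
    then obtain a b where ab: "(a, b) \<in> wle f" "word_index f a = word_index f s"
      "word_index f b = word_index f t"
      by (auto simp: word_encode_def)
    then have "a = s" "b = t" using that inj sub by (blast dest: inj_onD)+
    then show "(s, t) \<in> wle f" using ab by simp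
  qed (force simp: word_encode_def)
  moreover have "bij_betw (word_index f) (wpos f) (wpos (word_encode f))"
    using inj by (simp add: word_encode_def bij_betw_def)
  moreover have "wlab f s = wlab (word_encode f) (word_index f s)" for s
    by (simp add: word_encode_def word_index_def)
  ultimately show ?thesis
    unfolding word_iso_def by (intro exI [of _ "word_index f"]) blast
qed

definition word_cat :: "'l bword \<Rightarrow> 'l bword \<Rightarrow> 'l bword" where
  "word_cat f g = word_encode (word_sum f g)"

definition empty_word :: "'l bword" where
  "empty_word = \<lparr>wpos = {}, wle = {}, wlab = fst\<rparr>"

definition letter_word :: "'l \<Rightarrow> 'l bword" where
  "letter_word l = \<lparr>wpos = {(l, 0)}, wle = {((l, 0), (l, 0))}, wlab = fst\<rparr>"

text \<open>
  \<open>words L\<close> is not quotiented by isomorphism; instead, cancellation is taken up to isomorphism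
  (and contains isomorphism as the case \<open>T = {}\<close>), so that all notions below are isomorphism
  invariant.
\<close>

definition words :: "'l set \<Rightarrow> 'l bword set" where
  "words L = {f. word_over L f}"


section \<open>Big free groups\<close>

definition free_involution :: "'l set \<Rightarrow> ('l \<Rightarrow> 'l) \<Rightarrow> bool" where
  "free_involution L \<iota> \<longleftrightarrow> (\<forall>l\<in>L. \<iota> l \<in> L \<and> \<iota> l \<noteq> l \<and> \<iota> (\<iota> l) = l)"

definition seg :: "('s, 'l) tword \<Rightarrow> 's \<Rightarrow> 's \<Rightarrow> 's set" where
  "seg f s t = {x \<in> wpos f. (s, x) \<in> wle f \<and> (x, t) \<in> wle f}"

definition cancels :: "('l \<Rightarrow> 'l) \<Rightarrow> ('s, 'l) tword \<Rightarrow> ('t, 'l) tword \<Rightarrow> bool" where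
  "cancels \<iota> f g \<longleftrightarrow> (\<exists>T star. T \<subseteq> wpos f \<and>
     (\<forall>t\<in>T. star t \<in> T \<and> star (star t) = t \<and> wlab f (star t) = \<iota> (wlab f t) \<and>
       seg f t (star t) \<subseteq> T \<and> star ` seg f t (star t) = seg f t (star t)) \<and>
     word_iso (word_restrict f (wpos f - T)) g)"

definition word_equiv :: "'l set \<Rightarrow> ('l \<Rightarrow> 'l) \<Rightarrow> 'l bword \<Rightarrow> 'l bword \<Rightarrow> bool" where
  "word_equiv L \<iota> = equivclp (\<lambda>f g. f \<in> words L \<and> g \<in> words L \<and> cancels \<iota> f g)"

definition bf_class :: "'l set \<Rightarrow> ('l \<Rightarrow> 'l) \<Rightarrow> 'l bword \<Rightarrow> 'l bword set" where
  "bf_class L \<iota> f = {g \<in> words L. word_equiv L \<iota> f g}"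

text \<open>
  The elements of \<open>BF L \<iota> \<S>\<close> are the full equivalence classes in \<open>words L\<close> of the members of \<open>\<S>\<close>,
  so that it is literally a subset of the big free group \<open>BF L \<iota> (words L)\<close>.
\<close>

definition BF :: "'l set \<Rightarrow> ('l \<Rightarrow> 'l) \<Rightarrow> 'l bword set \<Rightarrow> 'l bword set monoid" where
  "BF L \<iota> \<S> =
     \<lparr>carrier = bf_class L \<iota> ` \<S>,
      monoid.mult = (\<lambda>a b. \<Union>f\<in>a. \<Union>g\<in>b. bf_class L \<iota> (word_cat f g)),
      one = bf_class L \<iota> empty_word\<rparr>"

definition admissible_words :: "'l set \<Rightarrow> ('l \<Rightarrow> 'l) \<Rightarrow> 'l bword set \<Rightarrow> bool" where
  "admissible_words L \<iota> \<S> \<longleftrightarrow> \<S> \<subseteq> words L \<and>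
     (\<forall>f\<in>\<S>. \<forall>g\<in>\<S>. word_cat f g \<in> \<S>) \<and>
     (\<forall>f\<in>\<S>. word_bar \<iota> f \<in> \<S>) \<and>
     (\<forall>f\<in>\<S>. \<forall>g\<in>words L. cancels \<iota> f g \<longrightarrow> g \<in> \<S>)"

definition bf_letter :: "'l set \<Rightarrow> ('l \<Rightarrow> 'l) \<Rightarrow> 'l \<Rightarrow> 'l bword set" where
  "bf_letter L \<iota> l = bf_class L \<iota> (letter_word l)"

definition finite_words_subgroup ::
  "'l set \<Rightarrow> ('l \<Rightarrow> 'l) \<Rightarrow> 'l bword set \<Rightarrow> 'l bword set set" where
  "finite_words_subgroup L \<iota> \<S> = generate (BF L \<iota> \<S>) (bf_letter L \<iota> ` L)"

text \<open>The homomorphism \<open>\<phi>\<^sub>A\<close>, lifted to classes (the union is over equal classes).\<close>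

definition bf_proj :: "('l \<Rightarrow> 'l) \<Rightarrow> 'l set \<Rightarrow> 'l bword set \<Rightarrow> 'l bword set" where
  "bf_proj \<iota> A c = (\<Union>f\<in>c. bf_class A \<iota> (word_restrict f (wlab f -` A)))"

definition bf_proj_kernel ::
  "'l set \<Rightarrow> ('l \<Rightarrow> 'l) \<Rightarrow> 'l bword set \<Rightarrow> 'l set \<Rightarrow> 'l bword set set" where
  "bf_proj_kernel L \<iota> \<S> A = kernel (BF L \<iota> \<S>) (BF A \<iota> (words A)) (bf_proj \<iota> A)"


section \<open>Topologies and generalized presentations\<close>

definition topological_group :: "('a, 'b) monoid_scheme \<Rightarrow> 'a topology \<Rightarrow> bool" where
  "topological_group G \<T> \<longleftrightarrow> group G \<and> topspace \<T> = carrier G \<and>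
     continuous_map (prod_topology \<T> \<T>) \<T> (\<lambda>(x, y). x \<otimes>\<^bsub>G\<^esub> y) \<and>
     continuous_map \<T> \<T> (\<lambda>x. inv\<^bsub>G\<^esub> x)"

text \<open>
  The translation invariant topology having the set \<open>\<B>\<close> of subgroups as a basis of neighbourhoods
  of \<open>\<one>\<close>; this presupposes that \<open>\<B>\<close> is a filter base.
\<close>

definition subgroup_topology :: "('a, 'b) monoid_scheme \<Rightarrow> 'a set set \<Rightarrow> 'a topology" where
  "subgroup_topology G \<B> =
     topology (\<lambda>U. U \<subseteq> carrier G \<and> (\<forall>u\<in>U. \<exists>H\<in>\<B>. u <#\<^bsub>G\<^esub> H \<subseteq> U))"

definition natural_topology ::
  "'l set \<Rightarrow> ('l \<Rightarrow> 'l) \<Rightarrow> 'l bword set \<Rightarrow> 'l bword set topology" where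
  "natural_topology L \<iota> \<S> = subgroup_topology (BF L \<iota> \<S>)
     (bf_proj_kernel L \<iota> \<S> ` {A. A \<subseteq> L \<and> finite A \<and> \<iota> ` A = A})"

definition admissible_topology ::
  "'l set \<Rightarrow> ('l \<Rightarrow> 'l) \<Rightarrow> 'l bword set \<Rightarrow> 'l bword set topology \<Rightarrow> bool" where
  "admissible_topology L \<iota> \<S> \<T> \<longleftrightarrow> topological_group (BF L \<iota> \<S>) \<T> \<and>
     (\<forall>U. openin (natural_topology L \<iota> \<S>) U \<longrightarrow> openin \<T> U) \<and>
     \<T> closure_of (finite_words_subgroup L \<iota> \<S>) = topspace \<T>"

definition closed_normal_closure ::
  "('a, 'b) monoid_scheme \<Rightarrow> 'a topology \<Rightarrow> 'a set \<Rightarrow> 'a set" where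
  "closed_normal_closure G \<T> R = \<Inter>{N. N \<lhd> G \<and> closedin \<T> N \<and> R \<subseteq> N}"

definition generalized_presentation ::
  "'l set \<Rightarrow> ('l \<Rightarrow> 'l) \<Rightarrow> 'l bword set \<Rightarrow> 'l bword set topology \<Rightarrow> 'l bword set set \<Rightarrow>
    ('g, 'm) monoid_scheme \<Rightarrow> bool" where
  "generalized_presentation L \<iota> \<S> \<T> R G \<longleftrightarrow>
     free_involution L \<iota> \<and> admissible_words L \<iota> \<S> \<and> letter_word ` L \<subseteq> \<S> \<and>
     admissible_topology L \<iota> \<S> \<T> \<and> R \<subseteq> carrier (BF L \<iota> \<S>) \<and>
     (\<exists>p \<in> epi (BF L \<iota> \<S>) G.
        kernel (BF L \<iota> \<S>) G p = closed_normal_closure (BF L \<iota> \<S>) \<T> R)"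


section \<open>The data for the symmetric group\<close>

text \<open>The letter \<open>T\<^sub>x\<^sub>,\<^sub>y\<close> is the pair \<open>(x, y)\<close>, and the involution is \<open>prod.swap\<close>.\<close>

definition transp_letters :: "'x set \<Rightarrow> ('x \<times> 'x) set" where
  "transp_letters X = {(x, y). x \<in> X \<and> y \<in> X \<and> x \<noteq> y}"

definition touching :: "'x \<Rightarrow> ('s, 'x \<times> 'x) tword \<Rightarrow> 's set" where
  "touching z f = {s \<in> wpos f. z \<in> {fst (wlab f s), snd (wlab f s)}}"

definition words0 :: "'x set \<Rightarrow> ('x \<times> 'x) bword set" where
  "words0 X = {f \<in> words (transp_letters X). \<forall>x\<in>X. finite (touching x f)}"

definition least_pos :: "('s, 'l) tword \<Rightarrow> 's set \<Rightarrow> 's" where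
  "least_pos f A = (THE s. s \<in> A \<and> (\<forall>t\<in>A. (s, t) \<in> wle f))"

text \<open>
  \<open>trail f x n = Some (x\<^sub>n\<^sup>+, s)\<close>, where \<open>s\<close> is \<open>Some (s\<^sub>n\<^sup>+(x))\<close> if \<open>n > 0\<close> and \<open>None\<close> if \<open>n = 0\<close>, as
  long as \<open>n \<le> n\<^sup>+(x)\<close>; afterwards \<open>trail f x n = None\<close>.
\<close>

fun trail :: "('s, 'x \<times> 'x) tword \<Rightarrow> 'x \<Rightarrow> nat \<Rightarrow> ('x \<times> 's option) option" where
  "trail f x 0 = Some (x, None)"
| "trail f x (Suc n) =
     (case trail f x n of
        None \<Rightarrow> None
      | Some (y, s) \<Rightarrow>
         (let A = {t \<in> touching y f.
                     case s of None \<Rightarrow> True | Some s' \<Rightarrow> (s', t) \<in> wle f \<and> s' \<noteq> t};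
              t = least_pos f A
          in if A = {} then None
             else Some (THE z. {y, z} = {fst (wlab f t), snd (wlab f t)}, Some t)))"

definition n_plus :: "('s, 'x \<times> 'x) tword \<Rightarrow> 'x \<Rightarrow> enat" where
  "n_plus f x = (if \<exists>n. trail f x (Suc n) = None
                 then enat (LEAST n. trail f x (Suc n) = None) else \<infinity>)"

definition n_minus :: "('s, 'x \<times> 'x) tword \<Rightarrow> 'x \<Rightarrow> enat" where
  "n_minus f x = n_plus (word_rev f) x"

definition x_infty :: "('s, 'x \<times> 'x) tword \<Rightarrow> 'x \<Rightarrow> 'x" where
  "x_infty f x = fst (the (trail f x (the_enat (n_plus f x))))"

definition wordsS :: "'x set \<Rightarrow> ('x \<times> 'x) bword set" where
  "wordsS X = {f \<in> words0 X. \<forall>x\<in>X. n_plus f x < \<infinity> \<and> n_minus f x < \<infinity>}"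

definition W_subgroup :: "'x set \<Rightarrow> 'x set \<Rightarrow> ('x \<times> 'x) bword set set" where
  "W_subgroup X C =
     bf_proj_kernel (transp_letters X) prod.swap (wordsS X) (transp_letters C) \<inter>
     {bf_class (transp_letters X) prod.swap f | f. f \<in> wordsS X \<and> (\<forall>x\<in>C. x_infty f x = x)}"

definition topS :: "'x set \<Rightarrow> ('x \<times> 'x) bword set topology" where
  "topS X = subgroup_topology (BF (transp_letters X) prod.swap (wordsS X))
     (W_subgroup X ` {C. C \<subseteq> X \<and> finite C})"

definition word_interval :: "('s, 'l) tword \<Rightarrow> 's set \<Rightarrow> bool" where
  "word_interval f I \<longleftrightarrow> I \<subseteq> wpos f \<and> (\<forall>s\<in>I. \<forall>t\<in>I. seg f s t \<subseteq> I)"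

definition wordsS' :: "'x set \<Rightarrow> ('x \<times> 'x) bword set" where
  "wordsS' X = {f \<in> words (transp_letters X).
     \<forall>I. word_interval f I \<longrightarrow> word_restrict f I \<in> wordsS X}"

definition topS' :: "'x set \<Rightarrow> ('x \<times> 'x) bword set topology" where
  "topS' X = subtopology (topS X) (carrier (BF (transp_letters X) prod.swap (wordsS' X)))"

definition transp_relators :: "'x set \<Rightarrow> ('x \<times> 'x) bword set set" where
  "transp_relators X =
    (let G = BF (transp_letters X) prod.swap (wordsS' X);
         T = (\<lambda>x y. bf_letter (transp_letters X) prod.swap (x, y))
     in {T x y [^]\<^bsub>G\<^esub> (2::nat) | x y. x \<in> X \<and> y \<in> X \<and> x \<noteq> y} \<union>
        {T x y \<otimes>\<^bsub>G\<^esub> T z w \<otimes>\<^bsub>G\<^esub> inv\<^bsub>G\<^esub> (T x y) \<otimes>\<^bsub>G\<^esub> inv\<^bsub>G\<^esub> (T z w) | x y z w.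
           {x, y, z, w} \<subseteq> X \<and> card {x, y, z, w} = 4} \<union>
        {T x y \<otimes>\<^bsub>G\<^esub> T x z \<otimes>\<^bsub>G\<^esub> inv\<^bsub>G\<^esub> (T x y) \<otimes>\<^bsub>G\<^esub> inv\<^bsub>G\<^esub> (T y z) | x y z.
           {x, y, z} \<subseteq> X \<and> card {x, y, z} = 3})"

end

theory Submission
  imports Defs
begin

text \<open>
  Running a point through a word of \<open>wordsS\<close> meets only finitely many letters. Hence the end point
  is computed in the projection to finitely many letters, where all words are finite and
  cancellation amounts to deleting adjacent pairs of inverse letters; so it is invariant under
  cancellation, and the end points define an action of \<open>BFS X\<close> on \<open>X\<close>. Every permutation
  is a product of two involutions, and an involution is represented by a word with one letter for
  each of its 2-cycles, so the action is onto. For the kernel, approximate an element of it modulo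
  \<open>W_subgroup X C\<close> by a finite word. This word fixes \<open>C\<close> pointwise, so the relators turn it into a
  finite word avoiding \<open>C\<close>, which lies in \<open>W_subgroup X C\<close>. Thus the element is a limit of
  elements of the normal closure of the relators.
\<close>

text \<open>An equivalence between two words of \<open>wordsS\<close> is a chain of cancellations
  whose intermediate words are arbitrary members of \<open>words\<close>. Trails need not stop in
  these, so the end point cannot be followed along the chain itself; this obstacle forces the detour
  through a finite alphabet. Two involutions are used because an obvious word for a permutation can
  fall outside \<open>wordsS'\<close>. Let X be the integers and take the letters T(n, n+1) in
  increasing order of n. All trails of the whole word stop, but on the interval n \<ge> 0 the trail
  of 0 runs through 1, 2, 3, ... forever. In a word for an involution no two letters share a point,
  so trails have at most one step, on every interval and in both directions. Words are read from
  left to right and so act on the right, while permutations compose as functions; the epimorphism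
  therefore sends a class to the action of its inverse. For the same reason, and because fixing
  \<open>C\<close> pointwise is not a normal condition, sets of points have to be enlarged by images
  under an element or its inverse whenever that element is moved across such a condition.\<close>

section \<open>Linear orders on sets of positions\<close>

definition lin_on :: "'s set \<Rightarrow> 's rel \<Rightarrow> bool" where
  "lin_on P r \<longleftrightarrow> (\<forall>a\<in>P. (a, a) \<in> r) \<and>
     (\<forall>a\<in>P. \<forall>b\<in>P. (a, b) \<in> r \<or> (b, a) \<in> r) \<and>
     (\<forall>a\<in>P. \<forall>b\<in>P. (a, b) \<in> r \<longrightarrow> (b, a) \<in> r \<longrightarrow> a = b) \<and>
     (\<forall>a\<in>P. \<forall>b\<in>P. \<forall>c\<in>P. (a, b) \<in> r \<longrightarrow> (b, c) \<in> r \<longrightarrow> (a, c) \<in> r)"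

lemma lin_on_refl: "lin_on P r \<Longrightarrow> a \<in> P \<Longrightarrow> (a, a) \<in> r"
  unfolding lin_on_def by metis

lemma lin_on_total: "lin_on P r \<Longrightarrow> a \<in> P \<Longrightarrow> b \<in> P \<Longrightarrow> (a, b) \<in> r \<or> (b, a) \<in> r"
  unfolding lin_on_def by metis

lemma lin_on_antisym:
  "lin_on P r \<Longrightarrow> a \<in> P \<Longrightarrow> b \<in> P \<Longrightarrow> (a, b) \<in> r \<Longrightarrow> (b, a) \<in> r \<Longrightarrow> a = b"
  unfolding lin_on_def by metis

lemma lin_on_trans:
  "lin_on P r \<Longrightarrow> a \<in> P \<Longrightarrow> b \<in> P \<Longrightarrow> c \<in> P \<Longrightarrow> (a, b) \<in> r \<Longrightarrow> (b, c) \<in> r \<Longrightarrow> (a, c) \<in> r"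
  unfolding lin_on_def by metis

lemma lin_onI:
  assumes "\<And>a. a \<in> P \<Longrightarrow> (a, a) \<in> r"
    "\<And>a b. a \<in> P \<Longrightarrow> b \<in> P \<Longrightarrow> (a, b) \<in> r \<or> (b, a) \<in> r"
    "\<And>a b. a \<in> P \<Longrightarrow> b \<in> P \<Longrightarrow> (a, b) \<in> r \<Longrightarrow> (b, a) \<in> r \<Longrightarrow> a = b"
    "\<And>a b c. a \<in> P \<Longrightarrow> b \<in> P \<Longrightarrow> c \<in> P \<Longrightarrow> (a, b) \<in> r \<Longrightarrow> (b, c) \<in> r \<Longrightarrow> (a, c) \<in> r"
  shows "lin_on P r"
  unfolding lin_on_def
  by (intro conjI ballI impI) (fact assms(1), fact assms(2), fact assms(3), fact assms(4))

lemma lin_on_subset: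
  assumes lin: "lin_on P r" and "Q \<subseteq> P"
  shows "lin_on Q r"
proof (rule lin_onI)
  note in_P = subsetD [OF assms(2)]
  show "(a, a) \<in> r" if "a \<in> Q" for a
    using lin_on_refl [OF lin in_P [OF that]] .
  show "(a, b) \<in> r \<or> (b, a) \<in> r" if "a \<in> Q" "b \<in> Q" for a b
    using lin_on_total [OF lin in_P [OF that(1)] in_P [OF that(2)]] .
  show "a = b" if "a \<in> Q" "b \<in> Q" "(a, b) \<in> r" "(b, a) \<in> r" for a b
    using lin_on_antisym [OF lin in_P [OF that(1)] in_P [OF that(2)] that(3,4)] .
  show "(a, c) \<in> r" if "a \<in> Q" "b \<in> Q" "c \<in> Q" "(a, b) \<in> r" "(b, c) \<in> r" for a b c
    using lin_on_trans [OF lin in_P [OF that(1)] in_P [OF that(2)] in_P [OF that(3)] that(4,5)] .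
qed

lemma lin_on_converse: "lin_on P r \<Longrightarrow> lin_on P (r\<inverse>)"
  unfolding lin_on_def converse_iff by meson

text \<open>The clause \<open>r \<subseteq> P \<times> P\<close> is split off because it is not
  inherited by subsets of \<open>P\<close>. What remains passes to every set of positions with the
  relation \<open>r\<close> unchanged, so tails and intervals of a word need no restricted
  order.\<close>

lemma linear_order_on_iff: "linear_order_on P r \<longleftrightarrow> r \<subseteq> P \<times> P \<and> lin_on P r"
proof
  assume "linear_order_on P r"
  then have *: "r \<subseteq> P \<times> P" "refl_on P r" "trans r" "antisym r" "total_on P r"
    by (auto simp: order_on_defs)
  have "(a, b) \<in> r \<or> (b, a) \<in> r" if "a \<in> P" "b \<in> P" for a b
    using * that unfolding total_on_def refl_on_def by metis
  then have "lin_on P r"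
    by (intro lin_onI) (blast intro: refl_onD [OF *(2)] transD [OF *(3)] antisymD [OF *(4)])+
  with * show "r \<subseteq> P \<times> P \<and> lin_on P r" by blast
next
  assume "r \<subseteq> P \<times> P \<and> lin_on P r"
  then have s: "r \<subseteq> P \<times> P" and l: "lin_on P r" by auto
  have "trans r" using s lin_on_trans [OF l] by (intro transI) blast
  moreover have "antisym r" using s lin_on_antisym [OF l] by (intro antisymI) blast
  moreover have "total_on P r" using lin_on_total [OF l] by (simp add: total_on_def)
  moreover have "refl_on P r" using lin_on_refl [OF l] by (simp add: refl_on_def)
  ultimately show "linear_order_on P r"
    using s by (simp add: order_on_defs)
qed

lemma finite_least:
  assumes "lin_on P r" "A \<subseteq> P" "finite A" "A \<noteq> {}"
  obtains t where "t \<in> A" "\<And>u. u \<in> A \<Longrightarrow> (t, u) \<in> r"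
proof -
  have "\<exists>t\<in>A. \<forall>u\<in>A. (t, u) \<in> r"
    using assms(3,4,2)
  proof (induction rule: finite_ne_induct)
    case (singleton x)
    then show ?case using lin_on_refl [OF assms(1)] by auto
  next
    case (insert x F)
    then obtain t where t: "t \<in> F" "\<forall>u\<in>F. (t, u) \<in> r" by auto
    show ?case
    proof (cases "(t, x) \<in> r")
      case True
      then show ?thesis using t by auto
    next
      case False
      then have "(x, t) \<in> r" using lin_on_total [OF assms(1)] insert t by blast
      then have "\<forall>u\<in>F. (x, u) \<in> r"
        using t lin_on_trans [OF assms(1)] insert.prems by blast
      then show ?thesis using lin_on_refl [OF assms(1)] insert by auto
    qed
  qed
  then show ?thesis using that by blast
qed

section \<open>Orbits\<close>

definition pts :: "'x \<times> 'x \<Rightarrow> 'x set" where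
  "pts l = {fst l, snd l}"

text \<open>This is the step from one point of a trail to the next; it is meaningful only for
  \<open>y \<in> pts l\<close>, and otherwise returns the first component as a default.\<close>

definition other :: "'x \<Rightarrow> 'x \<times> 'x \<Rightarrow> 'x" where
  "other y l = (if y = fst l then snd l else fst l)"

lemma other_in_pts: "other y l \<in> pts l"
  by (auto simp: other_def pts_def)

lemma other_other: "y \<in> pts l \<Longrightarrow> other (other y l) l = y"
  by (auto simp: other_def pts_def)

text \<open>Only the underlying pair matters, not its orientation: a letter and its inverse move
  points in the same way. This is what makes a cancelling pair act trivially.\<close>

lemma other_cong: "y \<in> pts l \<Longrightarrow> pts l = pts l' \<Longrightarrow> other y l = other y l'"
  by (auto simp: other_def pts_def doubleton_eq_iff)

lemma pts_swap [simp]: "pts (prod.swap l) = pts l"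
  by (auto simp: pts_def)

lemma pts_transp: "l \<in> transp_letters X \<longleftrightarrow> pts l \<subseteq> X \<and> fst l \<noteq> snd l"
  by (cases l) (auto simp: transp_letters_def pts_def)

definition hits :: "('s \<Rightarrow> 'x \<times> 'x) \<Rightarrow> 's set \<Rightarrow> 'x set \<Rightarrow> 's set" where
  "hits lab P V = {u \<in> P. pts (lab u) \<inter> V \<noteq> {}}"

lemma hits_subset: "hits lab P V \<subseteq> P"
  by (auto simp: hits_def)

lemma hits_UN: "hits lab P V = (\<Union>x\<in>V. hits lab P {x})"
  by (auto simp: hits_def)

lemma finite_hits:
  assumes "finite V" "\<And>x. x \<in> V \<Longrightarrow> finite (hits lab P {x})"
  shows "finite (hits lab P V)"
  by (subst hits_UN) (use assms in auto)

text \<open>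
  The relation \<open>orbit r lab P y V w\<close> says that the trail of \<open>y\<close> through the word with positions \<open>P\<close>
  stops, that it visits exactly the points of \<open>V\<close> (including \<open>y\<close>) and that it ends in \<open>w\<close>.
\<close>

inductive orbit :: "'s rel \<Rightarrow> ('s \<Rightarrow> 'x \<times> 'x) \<Rightarrow> 's set \<Rightarrow> 'x \<Rightarrow> 'x set \<Rightarrow> 'x \<Rightarrow> bool"
  for r lab where
  stop: "hits lab P {y} = {} \<Longrightarrow> orbit r lab P y {y} y"
| step: "t \<in> hits lab P {y} \<Longrightarrow> \<forall>u \<in> hits lab P {y}. (t, u) \<in> r \<Longrightarrow>
    orbit r lab {u \<in> P. (t, u) \<in> r \<and> u \<noteq> t} (other y (lab t)) V w \<Longrightarrow>
    orbit r lab P y (insert y V) w"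

lemma orbit_in: "orbit r lab P y V w \<Longrightarrow> finite V \<and> y \<in> V \<and> w \<in> V"
  by (induction rule: orbit.induct) auto

lemma orbit_subset:
  "orbit r lab P y V w \<Longrightarrow> y \<in> X \<Longrightarrow> (\<And>u. u \<in> P \<Longrightarrow> pts (lab u) \<subseteq> X) \<Longrightarrow> V \<subseteq> X"
proof (induction rule: orbit.induct)
  case (step t P y V w)
  have "other y (lab t) \<in> X"
    using step.prems(2) [of t] step.hyps(1) other_in_pts [of y "lab t"] by (auto simp: hits_def)
  then show ?case using step by auto
qed auto

text \<open>The first hit is unique by antisymmetry. Determinism is used to identify a given orbit
  with one assembled from pieces by \<open>orbit_concat\<close>.\<close>

lemma orbit_det:
  "orbit r lab P y V w \<Longrightarrow> lin_on P r \<Longrightarrow> orbit r lab P y V' w' \<Longrightarrow> V' = V \<and> w' = w"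
proof (induction arbitrary: V' w' rule: orbit.induct)
  case (stop P y)
  from stop(3) show ?case
    by cases (use stop in auto)
next
  case (step t P y V w)
  from step.prems(2) show ?case
  proof cases
    case stop
    then show ?thesis using step.hyps by auto
  next
    case (step t' W)
    have "t' = t"
      using step step.hyps lin_on_antisym [OF step.prems(1), of t t'] hits_subset [of lab P "{y}"]
      by blast
    with step have "orbit r lab {u \<in> P. (t, u) \<in> r \<and> u \<noteq> t} (other y (lab t)) W w'"
      by simp
    with step.IH [of W w'] lin_on_subset [OF step.prems(1)] step(1) show ?thesis
      by auto
  qed
qed

text \<open>The reason for recording \<open>V\<close>: an orbit inspects only positions whose
  letters meet a visited point, so all others may be dropped. Together with
  \<open>orbit_extend\<close> this reduces questions about infinite words to the finite set
  \<open>hits lab P V\<close>.\<close>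

lemma orbit_restrict:
  "orbit r lab P y V w \<Longrightarrow> Q \<subseteq> P \<Longrightarrow> hits lab P V \<subseteq> Q \<Longrightarrow> orbit r lab Q y V w"
proof (induction arbitrary: Q rule: orbit.induct)
  case (stop P y)
  then show ?case by (intro orbit.stop) (auto simp: hits_def)
next
  case (step t P y V w)
  have eq: "hits lab Q {y} = hits lab P {y}"
    using step.prems by (auto simp: hits_def)
  show ?case
  proof (rule orbit.step [where t = t])
    show "orbit r lab {u \<in> Q. (t, u) \<in> r \<and> u \<noteq> t} (other y (lab t)) V w"
      by (rule step.IH) (use step.prems in \<open>auto simp: hits_def\<close>)
  qed (use eq step.hyps in auto)
qed

lemma orbit_extend:
  "orbit r lab Q y V w \<Longrightarrow> Q \<subseteq> P \<Longrightarrow> hits lab P V \<subseteq> Q \<Longrightarrow> orbit r lab P y V w"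
proof (induction arbitrary: P rule: orbit.induct)
  case (stop Q y)
  then show ?case by (intro orbit.stop) (auto simp: hits_def)
next
  case (step t Q y V w)
  have eq: "hits lab Q {y} = hits lab P {y}"
    using step.prems by (auto simp: hits_def)
  show ?case
  proof (rule orbit.step [where t = t])
    show "orbit r lab {u \<in> P. (t, u) \<in> r \<and> u \<noteq> t} (other y (lab t)) V w"
      by (rule step.IH) (use step.prems in \<open>auto simp: hits_def\<close>)
  qed (use eq step.hyps in auto)
qed

text \<open>When the orbit through \<open>P\<close> stops at \<open>w\<close>, no remaining position
  of \<open>P\<close> meets \<open>w\<close>, so the next hit is the first hit of \<open>w\<close>
  in \<open>Q\<close>. The induction follows the orbit in \<open>P\<close>; its base case transfers
  the whole orbit in \<open>Q\<close>.\<close>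

lemma orbit_concat:
  assumes "orbit r lab P x V w" "orbit r lab Q w V' w'" "lin_on (P \<union> Q) r"
    "\<And>p q. p \<in> P \<Longrightarrow> q \<in> Q \<Longrightarrow> (p, q) \<in> r \<and> p \<noteq> q"
  shows "orbit r lab (P \<union> Q) x (V \<union> V') w'"
  using assms
proof (induction rule: orbit.induct)
  case (stop P y)
  have eq: "hits lab (P \<union> Q) {y} = hits lab Q {y}"
    using stop(1) by (auto simp: hits_def)
  from stop(2) have "orbit r lab (P \<union> Q) y V' w'"
  proof cases
    case stop
    then show ?thesis using eq by (simp add: orbit.stop)
  next
    case (step t W)
    have tQ: "t \<in> Q" using step(2) by (auto simp: hits_def)
    \<comment> \<open>All of \<open>P\<close> precedes \<open>t \<in> Q\<close>, so the tail behind
      \<open>t\<close> has lost \<open>P\<close> entirely.\<close>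
    have "{u \<in> P \<union> Q. (t, u) \<in> r \<and> u \<noteq> t} = {u \<in> Q. (t, u) \<in> r \<and> u \<noteq> t}"
      using lin_on_antisym [OF stop(3)] stop(4) tQ by blast
    then show ?thesis
      unfolding step(1) using step eq by (intro orbit.step [where t = t]) auto
  qed
  moreover have "y \<in> V'" using orbit_in [OF stop(2)] by simp
  ultimately show ?case by (simp add: insert_absorb)
next
  case (step t P y V w)
  have t: "t \<in> P" "t \<in> hits lab (P \<union> Q) {y}" using step.hyps(1) by (auto simp: hits_def)
  have eq: "{u \<in> P \<union> Q. (t, u) \<in> r \<and> u \<noteq> t} = {u \<in> P. (t, u) \<in> r \<and> u \<noteq> t} \<union> Q"
    using step.prems(3) [OF t(1)] by blast
  have le: "\<forall>u \<in> hits lab (P \<union> Q) {y}. (t, u) \<in> r"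
    using step.hyps(2) step.prems(3) [OF t(1)] by (auto simp: hits_def)
  have "orbit r lab ({u \<in> P. (t, u) \<in> r \<and> u \<noteq> t} \<union> Q) (other y (lab t)) (V \<union> V') w'"
    by (rule step.IH) (use step.prems in \<open>auto intro: lin_on_subset\<close>)
  then show ?case
    using orbit.step [of t lab "P \<union> Q" y r "V \<union> V'" w'] t le eq by simp
qed

text \<open>Each step passes to the tail strictly behind \<open>t\<close>, which has fewer
  positions. No condition ties \<open>y\<close> to the letters.\<close>

lemma finite_orbit_exists:
  assumes "finite P" "lin_on P r"
  shows "\<exists>V w. orbit r lab P y V w"
  using assms
proof (induction "card P" arbitrary: P y rule: less_induct)
  case less
  show ?case
  proof (cases "hits lab P {y} = {}")
    case True
    then show ?thesis using orbit.stop [OF True] by (intro exI)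
  next
    case False
    obtain t where t: "t \<in> hits lab P {y}" "\<And>u. u \<in> hits lab P {y} \<Longrightarrow> (t, u) \<in> r"
      using finite_least [OF less.prems(2) hits_subset _ False] less.prems(1)
      by (metis finite_subset hits_subset)
    let ?Q = "{u \<in> P. (t, u) \<in> r \<and> u \<noteq> t}"
    have "card ?Q < card P"
      using less.prems(1) t(1) by (intro psubset_card_mono) (auto simp: hits_def)
    then obtain V w where "orbit r lab ?Q (other y (lab t)) V w"
      using less.hyps [of ?Q] less.prems lin_on_subset [OF less.prems(2), of ?Q] by fastforce
    then have "orbit r lab P y (insert y V) w" using orbit.step [of t lab P y r V w] t by simp
    then show ?thesis by (intro exI)
  qed
qed

text \<open>Labels are compared only through \<open>pts\<close>, so this covers isomorphisms, the
  embeddings into a sum, and replacing all letters by their inverses.\<close>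

lemma orbit_transport:
  assumes "orbit r lab P y V w" "inj_on \<phi> P"
    "\<And>s t. s \<in> P \<Longrightarrow> t \<in> P \<Longrightarrow> (s, t) \<in> r \<longleftrightarrow> (\<phi> s, \<phi> t) \<in> r'"
    "\<And>s. s \<in> P \<Longrightarrow> pts (lab' (\<phi> s)) = pts (lab s)"
  shows "orbit r' lab' (\<phi> ` P) y V w"
  using assms
proof (induction rule: orbit.induct)
  case (stop P y)
  then show ?case by (intro orbit.stop) (auto simp: hits_def)
next
  case (step t P y V w)
  have eq: "hits lab' (\<phi> ` P) {y} = \<phi> ` hits lab P {y}"
    using step.prems(3) by (auto simp: hits_def)
  have t: "t \<in> P" "y \<in> pts (lab t)" using step.hyps(1) by (auto simp: hits_def)
  have "orbit r' lab' (\<phi> ` {u \<in> P. (t, u) \<in> r \<and> u \<noteq> t}) (other y (lab t)) V w"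
    by (rule step.IH) (use step.prems in \<open>auto simp: inj_on_def\<close>)
  moreover have "\<phi> ` {u \<in> P. (t, u) \<in> r \<and> u \<noteq> t} = {u \<in> \<phi> ` P. (\<phi> t, u) \<in> r' \<and> u \<noteq> \<phi> t}"
    using step.prems(1,2) t(1) by (auto simp: inj_on_def)
  moreover have "other y (lab t) = other y (lab' (\<phi> t))"
    using other_cong [OF t(2)] step.prems(3) [OF t(1)] by metis
  ultimately have "orbit r' lab' {u \<in> \<phi> ` P. (\<phi> t, u) \<in> r' \<and> u \<noteq> \<phi> t} (other y (lab' (\<phi> t))) V w"
    by simp
  then show ?case
  proof (rule orbit.step [rotated 2])
    show "\<phi> t \<in> hits lab' (\<phi> ` P) {y}" using eq step.hyps(1) by blast
    show "\<forall>u \<in> hits lab' (\<phi> ` P) {y}. (\<phi> t, u) \<in> r'"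
      unfolding eq using step.hyps(2) step.prems(2) t(1) by (auto simp: hits_def)
  qed
qed

section \<open>Cancellation structures\<close>

text \<open>The condition that \<open>star\<close> maps each segment onto itself is replaced by
  mapping it into itself, which is equivalent since \<open>star\<close> is an involution on
  \<open>T\<close>. Order, labels and positions are separate arguments so that the structure can be
  cut down to smaller sets of positions.\<close>

definition cancelling ::
  "('l \<Rightarrow> 'l) \<Rightarrow> 's rel \<Rightarrow> ('s \<Rightarrow> 'l) \<Rightarrow> 's set \<Rightarrow> 's set \<Rightarrow> ('s \<Rightarrow> 's) \<Rightarrow> bool" where
  "cancelling \<iota> r lab P T star \<longleftrightarrow> T \<subseteq> P \<and>
     (\<forall>t\<in>T. star t \<in> T \<and> star (star t) = t \<and> lab (star t) = \<iota> (lab t) \<and>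
       (\<forall>u\<in>P. (t, u) \<in> r \<longrightarrow> (u, star t) \<in> r \<longrightarrow> u \<in> T \<and> (t, star u) \<in> r \<and> (star u, star t) \<in> r))"

lemma cancellingD:
  assumes "cancelling \<iota> r lab P T star" "t \<in> T"
  shows "star t \<in> T" "star (star t) = t" "lab (star t) = \<iota> (lab t)" "t \<in> P" "star t \<in> P"
proof -
  have *: "T \<subseteq> P" and **: "star t \<in> T \<and> star (star t) = t \<and> lab (star t) = \<iota> (lab t)"
    using assms unfolding cancelling_def by auto
  show "star t \<in> T" "star (star t) = t" "lab (star t) = \<iota> (lab t)" using ** by auto
  then show "t \<in> P" "star t \<in> P" using * assms(2) by auto
qed

lemma cancelling_seg:
  assumes "cancelling \<iota> r lab P T star" "t \<in> T" "u \<in> P" "(t, u) \<in> r" "(u, star t) \<in> r"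
  shows "u \<in> T" "(t, star u) \<in> r" "(star u, star t) \<in> r" "star u \<in> P"
proof -
  note D = bspec [OF conjunct2 [OF assms(1) [unfolded cancelling_def]] assms(2)]
  have "\<forall>u\<in>P. (t, u) \<in> r \<longrightarrow> (u, star t) \<in> r \<longrightarrow>
      u \<in> T \<and> (t, star u) \<in> r \<and> (star u, star t) \<in> r"
    using D by (elim conjE)
  from this [rule_format, OF assms(3,4,5)]
  show *: "u \<in> T" "(t, star u) \<in> r" "(star u, star t) \<in> r" by blast+
  show "star u \<in> P" by (rule cancellingD(5) [OF assms(1) *(1)])
qed

lemma cancellingI:
  assumes "T \<subseteq> P" "\<And>t. t \<in> T \<Longrightarrow> star t \<in> T" "\<And>t. t \<in> T \<Longrightarrow> star (star t) = t"
    "\<And>t. t \<in> T \<Longrightarrow> lab (star t) = \<iota> (lab t)"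
    "\<And>t u. t \<in> T \<Longrightarrow> u \<in> P \<Longrightarrow> (t, u) \<in> r \<Longrightarrow> (u, star t) \<in> r \<Longrightarrow>
      u \<in> T \<and> (t, star u) \<in> r \<and> (star u, star t) \<in> r"
  shows "cancelling \<iota> r lab P T star"
  unfolding cancelling_def
  by (intro conjI ballI impI)
    (fact assms(1), fact assms(2), fact assms(3), fact assms(4),
      (frule (3) assms(5), elim conjE, assumption)+)

lemma cancels_iff:
  "cancels \<iota> f g \<longleftrightarrow> (\<exists>T star. cancelling \<iota> (wle f) (wlab f) (wpos f) T star \<and>
     word_iso (word_restrict f (wpos f - T)) g)"
proof -
  have eq: "(T \<subseteq> wpos f \<and>
     (\<forall>t\<in>T. star t \<in> T \<and> star (star t) = t \<and> wlab f (star t) = \<iota> (wlab f t) \<and>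
       seg f t (star t) \<subseteq> T \<and> star ` seg f t (star t) = seg f t (star t))) \<longleftrightarrow>
     cancelling \<iota> (wle f) (wlab f) (wpos f) T star" (is "?L \<longleftrightarrow> ?R") for T star
  proof
    assume ?L
    note L = this
    note TP = conjunct1 [OF L] and D = bspec [OF conjunct2 [OF L]]
    have st: "star t \<in> T \<and> star (star t) = t \<and> wlab f (star t) = \<iota> (wlab f t)"
      and sub: "seg f t (star t) \<subseteq> T" and img: "star ` seg f t (star t) = seg f t (star t)"
      if "t \<in> T" for t
      using D [OF that] by simp_all
    show ?R unfolding cancelling_def
    proof (intro conjI ballI impI TP)
      fix t u assume t: "t \<in> T" and "u \<in> wpos f" "(t, u) \<in> wle f" "(u, star t) \<in> wle f"
      then have u: "u \<in> seg f t (star t)" by (simp add: seg_def)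
      then show "u \<in> T" using sub [OF t] by blast
      have "star u \<in> seg f t (star t)" using img [OF t] u by blast
      then show "(t, star u) \<in> wle f" "(star u, star t) \<in> wle f" by (simp_all add: seg_def)
    qed (use st in auto)
  next
    assume R: ?R
    have "star ` seg f t (star t) = seg f t (star t)" if t: "t \<in> T" for t
    proof -
      have *: "star u \<in> seg f t (star t)" "star (star u) = u" if "u \<in> seg f t (star t)" for u
        using cancelling_seg [OF R t, of u] cancellingD(2) [OF R, of u] that by (auto simp: seg_def)
      show ?thesis
      proof
        show "star ` seg f t (star t) \<subseteq> seg f t (star t)" using *(1) by blast
        show "seg f t (star t) \<subseteq> star ` seg f t (star t)" using * by (metis image_eqI subsetI)
      qed
    qed
    moreover have "seg f t (star t) \<subseteq> T" if t: "t \<in> T" for t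
      using cancelling_seg(1) [OF R t] by (auto simp: seg_def)
    ultimately show ?L using R by (simp add: cancelling_def)
  qed
  show ?thesis unfolding cancels_def eq [symmetric] conj_assoc ..
qed

text \<open>A segment computed in \<open>Q\<close> is the part in \<open>Q\<close> of the segment
  computed in \<open>P\<close>, so closure of \<open>Q\<close> under \<open>star\<close> is the only
  thing to check.\<close>

lemma cancelling_subset:
  "cancelling \<iota> r lab P T star \<Longrightarrow> Q \<subseteq> P \<Longrightarrow> (\<And>t. t \<in> T \<Longrightarrow> t \<in> Q \<Longrightarrow> star t \<in> Q) \<Longrightarrow>
     cancelling \<iota> r lab Q (T \<inter> Q) star"
  unfolding cancelling_def by blast

text \<open>In the reversed order the segment of \<open>t\<close> is the old segment of
  \<open>star t\<close>, so the condition at \<open>t\<close> is the old one at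
  \<open>star t\<close>.\<close>

lemma cancelling_converse:
  "cancelling \<iota> r lab P T star \<Longrightarrow> cancelling \<iota> (r\<inverse>) lab P T star"
  unfolding cancelling_def converse_iff by (metis (no_types, opaque_lifting) subsetD)

lemma cancelling_transport:
  assumes c: "cancelling \<iota> r lab P T star" and inj: "inj_on \<phi> P"
    and "\<And>s t. s \<in> P \<Longrightarrow> t \<in> P \<Longrightarrow> (s, t) \<in> r \<longleftrightarrow> (\<phi> s, \<phi> t) \<in> r'"
    and "\<And>s. s \<in> P \<Longrightarrow> lab' (\<phi> s) = lab s"
  shows "cancelling \<iota> r' lab' (\<phi> ` P) (\<phi> ` T) (\<lambda>u. \<phi> (star (inv_into P \<phi> u)))"
proof -
  have TP: "T \<subseteq> P" using c by (simp add: cancelling_def)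
  have inv: "inv_into P \<phi> (\<phi> t) = t" if "t \<in> P" for t using inj that by simp
  show ?thesis
    unfolding cancelling_def ball_simps
  proof (intro conjI ballI)
    show "\<phi> ` T \<subseteq> \<phi> ` P" using TP by blast
    fix t assume t: "t \<in> T"
    note st = cancellingD [OF c t]
    show "\<phi> (star (inv_into P \<phi> (\<phi> t))) \<in> \<phi> ` T" using inv st by simp
    show "\<phi> (star (inv_into P \<phi> (\<phi> (star (inv_into P \<phi> (\<phi> t)))))) = \<phi> t" using inv st by simp
    show "lab' (\<phi> (star (inv_into P \<phi> (\<phi> t)))) = \<iota> (lab' (\<phi> t))" using inv st assms(4) by simp
    fix u assume u: "u \<in> P"
    have "u \<in> T \<and> (t, star u) \<in> r \<and> (star u, star t) \<in> r \<and> star u \<in> P"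
      if "(t, u) \<in> r" "(u, star t) \<in> r"
      using cancelling_seg [OF c t u that] by simp
    then show "(\<phi> t, \<phi> u) \<in> r' \<longrightarrow> (\<phi> u, \<phi> (star (inv_into P \<phi> (\<phi> t)))) \<in> r' \<longrightarrow>
         \<phi> u \<in> \<phi> ` T \<and>
         (\<phi> t, \<phi> (star (inv_into P \<phi> (\<phi> u)))) \<in> r' \<and>
         (\<phi> (star (inv_into P \<phi> (\<phi> u))), \<phi> (star (inv_into P \<phi> (\<phi> t)))) \<in> r'"
      using inv st u assms(3) by (cases "(t, u) \<in> r \<and> (u, star t) \<in> r") auto
  qed
qed

lemma cancelling_remove_pair:
  assumes "cancelling \<iota> r lab P T star" "t \<in> T"
  shows "cancelling \<iota> r lab (P - {t, star t}) (T - {t, star t}) star"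
proof -
  have *: "\<And>u. u \<in> T \<Longrightarrow> star u \<in> T \<and> star (star u) = u" and TP: "T \<subseteq> P"
    using assms(1) by (auto simp: cancelling_def)
  have "T \<inter> (P - {t, star t}) = T - {t, star t}" using TP by auto
  moreover have "star u \<in> P - {t, star t}" if "u \<in> T" "u \<in> P - {t, star t}" for u
    using * that TP assms(2) by (metis DiffD2 DiffI insertCI insertE singletonD subsetD)
  ultimately show ?thesis
    using cancelling_subset [OF assms(1), of "P - {t, star t}"] by auto
qed

text \<open>An innermost pair: take \<open>t\<close> whose segment up to \<open>star t\<close> has
  the fewest positions. A further position \<open>u\<close> inside would, with
  \<open>star u\<close>, span a smaller segment that no longer contains \<open>t\<close>. Freeness
  of \<open>\<iota>\<close> excludes \<open>star t = t\<close>.\<close>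

lemma cancelling_adjacent:
  assumes c: "cancelling \<iota> r lab P T star" and lin: "lin_on P r" and "finite P" "T \<noteq> {}"
    and free: "\<And>t. t \<in> T \<Longrightarrow> \<iota> (lab t) \<noteq> lab t"
  obtains t where "t \<in> T" "(t, star t) \<in> r" "star t \<noteq> t"
    "\<And>u. u \<in> P \<Longrightarrow> (t, u) \<in> r \<Longrightarrow> (u, star t) \<in> r \<Longrightarrow> u = t \<or> u = star t"
proof -
  let ?S = "\<lambda>t. {u \<in> P. (t, u) \<in> r \<and> (u, star t) \<in> r}"
  let ?Q = "\<lambda>t. t \<in> T \<and> (t, star t) \<in> r"
  have TP: "T \<subseteq> P" using c by (simp add: cancelling_def)
  have st: "star t \<in> T" "star (star t) = t" "star t \<noteq> t" if "t \<in> T" for t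
    using c that free [OF that] unfolding cancelling_def by (metis)+
  obtain t0 where "t0 \<in> T" using assms by blast
  then have "?Q t0 \<or> ?Q (star t0)"
    using st [of t0] lin_on_total [OF lin, of t0 "star t0"] TP by (simp add: subset_iff)
  then obtain t1 where "?Q t1" by blast
  then obtain t where t: "?Q t" and least: "\<And>u. ?Q u \<Longrightarrow> card (?S t) \<le> card (?S u)"
    using ex_has_least_nat [of ?Q t1 "\<lambda>t. card (?S t)"] by blast
  have small: False if u: "?Q u" "u \<in> ?S t" "star u \<in> ?S t" "u \<noteq> t" for u
  proof -
    have "?S u \<subseteq> ?S t"
    proof
      fix v assume v: "v \<in> ?S u"
      have in_P: "t \<in> P" "u \<in> P" "star u \<in> P" "star t \<in> P"
        using t u st TP by auto
      show "v \<in> ?S t"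
        using v u lin_on_trans [OF lin in_P(1,2), of v] lin_on_trans [OF lin _ in_P(3,4), of v] by simp
    qed
    moreover have "t \<in> ?S t" using t lin_on_refl [OF lin] TP by blast
    moreover have "t \<notin> ?S u" using u lin_on_antisym [OF lin, of t u] t TP by auto
    ultimately have "card (?S u) < card (?S t)"
      using \<open>finite P\<close> by (intro psubset_card_mono) auto
    then show False using least [OF u(1)] by simp
  qed
  have "u = t \<or> u = star t" if u: "u \<in> ?S t" for u
  proof (rule ccontr)
    assume n: "\<not> (u = t \<or> u = star t)"
    have uT: "u \<in> T" "star u \<in> ?S t"
      using cancelling_seg [OF c, of t u] t u by simp_all
    then have "star u \<noteq> t" using n st t by metis
    have "?Q u \<or> ?Q (star u)"
      using st [OF uT(1)] lin_on_total [OF lin, of u "star u"] uT TP by auto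
    then show False
      using small [of u] small [of "star u"] u uT n \<open>star u \<noteq> t\<close> st [OF uT(1)] by auto
  qed
  then show ?thesis using that [of t] t st by blast
qed

lemma orbit_singleton:
  assumes "lin_on {t} r"
  shows "orbit r lab {t} y (if y \<in> pts (lab t) then {y, other y (lab t)} else {y})
    (if y \<in> pts (lab t) then other y (lab t) else y)"
proof (cases "y \<in> pts (lab t)")
  case True
  have e: "{u \<in> {t}. (t, u) \<in> r \<and> u \<noteq> t} = {}" by auto
  have "orbit r lab {t} y (insert y {other y (lab t)}) (other y (lab t))"
    by (rule orbit.step [where t = t])
      (use True lin_on_refl [OF assms] e in \<open>auto simp: hits_def intro: orbit.stop\<close>)
  then show ?thesis using True by simp
next
  case False
  then show ?thesis by (auto simp: hits_def intro: orbit.stop)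
qed

text \<open>Induction on the number of cancelled positions, removing one innermost pair at a time:
  its two letters carry the point to its partner and straight back. The inclusion
  \<open>V' \<subseteq> V\<close> is part of the claim because \<open>orbit_extend\<close> later
  needs it to return to infinite words.\<close>

lemma orbit_cancelling:
  assumes "finite P" "lin_on P r" "cancelling prod.swap r lab P T star"
    and "\<And>t. t \<in> P \<Longrightarrow> fst (lab t) \<noteq> snd (lab t)" "orbit r lab P x V w"
  shows "\<exists>V' \<subseteq> V. orbit r lab (P - T) x V' w"
  using assms
proof (induction "card T" arbitrary: P T V w rule: less_induct)
  case less
  note fin = less.prems(1) and lin = less.prems(2) and c = less.prems(3)
  have TP: "T \<subseteq> P" using c by (simp add: cancelling_def)
  show ?case
  proof (cases "T = {}")
    case True
    then show ?thesis using less.prems by auto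
  next
    case False
    have free: "prod.swap (lab t) \<noteq> lab t" if "t \<in> T" for t
      using less.prems(4) [of t] that TP by (cases "lab t") auto
    obtain t where t: "t \<in> T" "(t, star t) \<in> r" "star t \<noteq> t"
      and adj: "\<And>u. u \<in> P \<Longrightarrow> (t, u) \<in> r \<Longrightarrow> (u, star t) \<in> r \<Longrightarrow> u = t \<or> u = star t"
      using cancelling_adjacent [OF c lin fin False free] by blast
    let ?s = "star t"
    have ts: "t \<in> P" "?s \<in> P" "?s \<in> T" "pts (lab ?s) = pts (lab t)"
      using c t TP unfolding cancelling_def by auto
    let ?A = "{u \<in> P. (u, t) \<in> r \<and> u \<noteq> t}" and ?B = "{u \<in> P. (?s, u) \<in> r \<and> u \<noteq> ?s}"
    \<comment> \<open>Nothing lies strictly between \<open>t\<close> and \<open>star t\<close>, so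
      the word splits into the part before, the two letters, and the part after.\<close>
    have P: "P = ?A \<union> ({t} \<union> ({?s} \<union> ?B))"
      using adj lin_on_total [OF lin] ts by blast
    have At: "(p, q) \<in> r \<and> p \<noteq> q" if "p \<in> ?A" "q \<in> {t} \<union> ({?s} \<union> ?B)" for p q
    proof -
      have "(t, q) \<in> r" using that t ts lin_on_refl [OF lin] lin_on_trans [OF lin, of t ?s q] by auto
      then show ?thesis
        using that ts lin_on_trans [OF lin, of p t q] lin_on_antisym [OF lin, of p t] by auto
    qed
    have tB: "(p, q) \<in> r \<and> p \<noteq> q" if "p \<in> {t}" "q \<in> {?s} \<union> ?B" for p q
      using that t ts lin_on_trans [OF lin, of t ?s q] lin_on_antisym [OF lin, of t ?s] by auto
    have sB: "(p, q) \<in> r \<and> p \<noteq> q" if "p \<in> {?s}" "q \<in> ?B" for p q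
      using that by auto
    have sub: "?A \<subseteq> P" "?B \<subseteq> P" by auto
    have lins: "lin_on ?A r" "lin_on ?B r" "lin_on {t} r" "lin_on {?s} r"
      "lin_on ({?s} \<union> ?B) r" "lin_on ({t} \<union> ({?s} \<union> ?B)) r" "lin_on (?A \<union> ?B) r"
      "lin_on (?A \<union> ({t} \<union> ({?s} \<union> ?B))) r"
      using lin_on_subset [OF lin] ts by auto
    obtain V1 a where 1: "orbit r lab ?A x V1 a"
      using finite_orbit_exists [OF _ lins(1)] fin by fastforce
    \<comment> \<open>Here \<open>a\<close> is the point arriving at the pair. It is either moved to
      \<open>b\<close> and back to \<open>a\<close>, or untouched with \<open>b = a\<close>; in both
      cases the two letters visit the same points \<open>V2\<close>.\<close>
    obtain V2 b where 2: "orbit r lab {t} a V2 b" "orbit r lab {?s} b V2 a"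
    proof (cases "a \<in> pts (lab t)")
      case True
      define b where "b = other a (lab t)"
      have b: "b \<in> pts (lab ?s)" "other b (lab ?s) = a"
        using True other_in_pts [of a "lab t"] other_other [OF True] ts other_cong
        unfolding b_def by metis+
      show ?thesis
        using that [of "{a, b}" b] orbit_singleton [OF lins(3), of lab a]
          orbit_singleton [OF lins(4), of lab b] b True ts
        by (simp add: b_def [symmetric] insert_commute)
    next
      case False
      then show ?thesis
        using that [of "{a}" a] orbit_singleton [OF lins(3), of lab a]
          orbit_singleton [OF lins(4), of lab a] ts by simp
    qed
    obtain V3 w' where 3: "orbit r lab ?B a V3 w'"
      using finite_orbit_exists [OF _ lins(2)] fin by fastforce
    \<comment> \<open>By determinism the given orbit is the one glued from the four pieces; gluing
      only the outer two gives the same end point and a smaller visited set.\<close>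
    have "orbit r lab P x (V1 \<union> (V2 \<union> (V2 \<union> V3))) w'"
      by (subst P)
        (intro orbit_concat [OF 1] orbit_concat [OF 2(1)] orbit_concat [OF 2(2)] 3 lins At tB sB)
    then have V: "V = V1 \<union> (V2 \<union> (V2 \<union> V3))" "w' = w"
      using orbit_det [OF less.prems(5) lin] by blast+
    have "P - {t, ?s} = ?A \<union> ?B"
    proof -
      have "t \<notin> ?B" using lin_on_antisym [OF lin, of t ?s] t ts by auto
      moreover have "?s \<notin> ?A" using lin_on_antisym [OF lin, of t ?s] t ts by auto
      moreover have "t \<notin> ?A" "?s \<notin> ?B" by simp_all
      ultimately show ?thesis using P by blast
    qed
    moreover have "orbit r lab (?A \<union> ?B) x (V1 \<union> V3) w'"
      by (intro orbit_concat [OF 1 3] lins At) auto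
    ultimately have o: "orbit r lab (P - {t, ?s}) x (V1 \<union> V3) w" using V by simp
    have "card (T - {t, ?s}) < card T"
      using t finite_subset [OF TP fin] by (intro psubset_card_mono) auto
    from less.hyps [OF this _ _ cancelling_remove_pair [OF c t(1)] _ o]
    obtain V' where "V' \<subseteq> V1 \<union> V3" "orbit r lab (P - {t, ?s} - (T - {t, ?s})) x V' w"
      using fin lin_on_subset [OF lin] less.prems(4) by fastforce
    moreover have "P - {t, ?s} - (T - {t, ?s}) = P - T" using t ts by auto
    ultimately show ?thesis using V by auto
  qed
qed

section \<open>Tame words\<close>

text \<open>The condition defining \<open>wordsS\<close>, stated for a bare set of positions; the
  orbit for \<open>r\<inverse>\<close> replaces the downward trail.\<close>

definition tame :: "'x set \<Rightarrow> 's rel \<Rightarrow> ('s \<Rightarrow> 'x \<times> 'x) \<Rightarrow> 's set \<Rightarrow> bool" where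
  "tame X r lab P \<longleftrightarrow> (\<forall>x\<in>X. finite (hits lab P {x}) \<and>
     (\<exists>V w. orbit r lab P x V w) \<and> (\<exists>V w. orbit (r\<inverse>) lab P x V w))"

lemma tame_converse: "tame X r lab P \<Longrightarrow> tame X (r\<inverse>) lab P"
  by (simp add: tame_def)

text \<open>The orbit through the first part ends in \<open>X\<close>, since letters only involve
  points of \<open>X\<close>, so tameness of the second part applies to its end point. Reversing the
  order exchanges the two parts.\<close>

lemma tame_union:
  assumes "tame X r lab P" "tame X r lab Q" "lin_on (P \<union> Q) r"
    and "\<And>p q. p \<in> P \<Longrightarrow> q \<in> Q \<Longrightarrow> (p, q) \<in> r \<and> p \<noteq> q"
    and X: "\<And>u. u \<in> P \<union> Q \<Longrightarrow> pts (lab u) \<subseteq> X"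
  shows "tame X r lab (P \<union> Q)"
  unfolding tame_def
proof (intro ballI conjI)
  fix x assume x: "x \<in> X"
  have "hits lab (P \<union> Q) {x} = hits lab P {x} \<union> hits lab Q {x}" by (auto simp: hits_def)
  then show "finite (hits lab (P \<union> Q) {x})" using assms(1,2) x by (simp add: tame_def)
  obtain V w where 1: "orbit r lab P x V w" using assms(1) x by (auto simp: tame_def)
  have "w \<in> X" using orbit_in [OF 1] orbit_subset [OF 1 x] X by auto
  then obtain V' w' where "orbit r lab Q w V' w'" using assms(2) by (auto simp: tame_def)
  from orbit_concat [OF 1 this assms(3,4)] show "\<exists>V w. orbit r lab (P \<union> Q) x V w" by blast
  obtain V w where 1: "orbit (r\<inverse>) lab Q x V w" using assms(2) x by (auto simp: tame_def)
  have "w \<in> X" using orbit_in [OF 1] orbit_subset [OF 1 x] X by auto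
  then obtain V' w' where "orbit (r\<inverse>) lab P w V' w'" using assms(1) by (auto simp: tame_def)
  from orbit_concat [OF 1 this] lin_on_converse [OF assms(3)] assms(4)
  show "\<exists>V w. orbit (r\<inverse>) lab (P \<union> Q) x V w" by (auto simp: Un_commute)
qed

lemma tame_transport:
  assumes "tame X r lab P" "inj_on \<phi> P"
    "\<And>s t. s \<in> P \<Longrightarrow> t \<in> P \<Longrightarrow> (s, t) \<in> r \<longleftrightarrow> (\<phi> s, \<phi> t) \<in> r'"
    "\<And>s. s \<in> P \<Longrightarrow> pts (lab' (\<phi> s)) = pts (lab s)"
  shows "tame X r' lab' (\<phi> ` P)"
  unfolding tame_def
proof (intro ballI conjI)
  fix x assume x: "x \<in> X"
  have "hits lab' (\<phi> ` P) {x} = \<phi> ` hits lab P {x}"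
    using assms(4) by (auto simp: hits_def)
  then show "finite (hits lab' (\<phi> ` P) {x})" using assms(1) x by (simp add: tame_def)
  show "\<exists>V w. orbit r' lab' (\<phi> ` P) x V w"
    using orbit_transport [of r lab P x _ _ \<phi> r' lab'] assms x unfolding tame_def by blast
  have "\<And>s t. s \<in> P \<Longrightarrow> t \<in> P \<Longrightarrow> (s, t) \<in> r\<inverse> \<longleftrightarrow> (\<phi> s, \<phi> t) \<in> r'\<inverse>"
    using assms(3) by simp
  then show "\<exists>V w. orbit (r'\<inverse>) lab' (\<phi> ` P) x V w"
    using orbit_transport [of "r\<inverse>" lab P x _ _ \<phi> "r'\<inverse>" lab'] assms(1,2,4) x
    unfolding tame_def by blast
qed

text \<open>
  Only the finitely many positions meeting the trail matter, so the finite case applies.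
\<close>

lemma orbit_cancelling_tame:
  assumes fin: "\<And>x. x \<in> X \<Longrightarrow> finite (hits lab P {x})" and o: "orbit r lab P x V w"
    and lin: "lin_on P r" and c: "cancelling prod.swap r lab P T star"
    and X: "\<And>u. u \<in> P \<Longrightarrow> lab u \<in> transp_letters X" and x: "x \<in> X"
  shows "\<exists>V' \<subseteq> V. orbit r lab (P - T) x V' w"
proof -
  have "V \<subseteq> X" using orbit_subset [OF o x] X by (auto simp: pts_transp)
  define F where "F = hits lab P V"
  have "finite V" using orbit_in [OF o] by simp
  then have F: "finite F" "F \<subseteq> P"
    using finite_hits [of V lab P] fin \<open>V \<subseteq> X\<close> hits_subset [of lab P V]
    unfolding F_def by blast+
  \<comment> \<open>The labels of \<open>t\<close> and \<open>star t\<close> are inverse letters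
    with the same two points, so \<open>F\<close> is closed under \<open>star\<close>.\<close>
  have "star t \<in> F" if "t \<in> T" "t \<in> F" for t
    using c that unfolding cancelling_def F_def hits_def
    by (metis (mono_tags, lifting) mem_Collect_eq pts_swap subsetD)
  then have cF: "cancelling prod.swap r lab F (T \<inter> F) star"
    using cancelling_subset [OF c F(2)] by blast
  have "orbit r lab F x V w"
    using orbit_restrict [OF o F(2)] by (simp add: F_def)
  then obtain V' where V': "V' \<subseteq> V" "orbit r lab (F - T \<inter> F) x V' w"
  proof -
    have "fst (lab u) \<noteq> snd (lab u)" if "u \<in> F" for u
      using X [of u] F(2) that by (auto simp: pts_transp)
    then show ?thesis
      using orbit_cancelling [OF F(1) lin_on_subset [OF lin F(2)] cF _ \<open>orbit r lab F x V w\<close>] that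
      by blast
  qed
  \<comment> \<open>Positions outside \<open>F\<close> avoid \<open>V\<close>, hence also
    \<open>V'\<close>, so putting them back does not disturb the orbit.\<close>
  have "orbit r lab (P - T) x V' w"
    by (rule orbit_extend [OF V'(2)]) (use F V'(1) in \<open>auto simp: F_def hits_def\<close>)
  then show ?thesis using V'(1) by blast
qed

lemma tame_cancelling:
  assumes tm: "tame X r lab P" and lin: "lin_on P r" and c: "cancelling prod.swap r lab P T star"
    and X: "\<And>u. u \<in> P \<Longrightarrow> lab u \<in> transp_letters X"
  shows "tame X r lab (P - T)"
  unfolding tame_def
proof (intro ballI conjI)
  fix x assume x: "x \<in> X"
  have "hits lab (P - T) {x} \<subseteq> hits lab P {x}" by (auto simp: hits_def)
  then show "finite (hits lab (P - T) {x})"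
    using tm x by (auto simp: tame_def intro: finite_subset)
  show "\<exists>V w. orbit r lab (P - T) x V w"
    using orbit_cancelling_tame [OF _ _ lin c X x] tm x unfolding tame_def by meson
  show "\<exists>V w. orbit (r\<inverse>) lab (P - T) x V w"
    using orbit_cancelling_tame [OF _ _ lin_on_converse [OF lin] cancelling_converse [OF c] X x] tm x
    unfolding tame_def by meson
qed

lemma tame_finite: "finite P \<Longrightarrow> lin_on P r \<Longrightarrow> tame X r lab P"
  unfolding tame_def
  using finite_orbit_exists lin_on_converse finite_subset hits_subset by metis

section \<open>Operations on words\<close>

lemma word_overD:
  assumes "word_over L f"
  shows "lin_on (wpos f) (wle f)" "wle f \<subseteq> wpos f \<times> wpos f"
    "s \<in> wpos f \<Longrightarrow> wlab f s \<in> L" "l \<in> L \<Longrightarrow> finite {s \<in> wpos f. wlab f s = l}"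
  using assms unfolding word_over_def linear_order_on_iff by auto

lemma word_overI:
  assumes "lin_on (wpos f) (wle f)" "wle f \<subseteq> wpos f \<times> wpos f"
    "\<And>s. s \<in> wpos f \<Longrightarrow> wlab f s \<in> L"
    "\<And>l. l \<in> L \<Longrightarrow> finite {s \<in> wpos f. wlab f s = l}"
  shows "word_over L f"
  using assms unfolding word_over_def linear_order_on_iff by auto

lemma words_iff: "f \<in> words L \<longleftrightarrow> word_over L f"
  by (simp add: words_def)

lemma word_isoI:
  assumes "bij_betw \<phi> (wpos f) (wpos g)"
    "\<And>s t. s \<in> wpos f \<Longrightarrow> t \<in> wpos f \<Longrightarrow> (s, t) \<in> wle f \<longleftrightarrow> (\<phi> s, \<phi> t) \<in> wle g"
    "\<And>s. s \<in> wpos f \<Longrightarrow> wlab f s = wlab g (\<phi> s)"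
  shows "word_iso f g"
  using assms unfolding word_iso_def by blast

lemma word_isoE:
  assumes "word_iso f g"
  obtains \<phi> where "bij_betw \<phi> (wpos f) (wpos g)" "inj_on \<phi> (wpos f)" "\<phi> ` wpos f = wpos g"
    "\<And>s t. s \<in> wpos f \<Longrightarrow> t \<in> wpos f \<Longrightarrow> (s, t) \<in> wle f \<longleftrightarrow> (\<phi> s, \<phi> t) \<in> wle g"
    "\<And>s. s \<in> wpos f \<Longrightarrow> wlab g (\<phi> s) = wlab f s"
proof -
  obtain \<phi> where \<phi>: "bij_betw \<phi> (wpos f) (wpos g)"
    "\<forall>s\<in>wpos f. \<forall>t\<in>wpos f. (s, t) \<in> wle f \<longleftrightarrow> (\<phi> s, \<phi> t) \<in> wle g"
    "\<forall>s\<in>wpos f. wlab f s = wlab g (\<phi> s)"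
    using assms unfolding word_iso_def by blast
  show ?thesis
    by (rule that [of \<phi>]) (use \<phi> in \<open>auto simp: bij_betw_def\<close>)
qed

lemma word_iso_refl [simp]: "word_iso f f"
  by (rule word_isoI [of id]) auto

lemma word_iso_sym:
  assumes "word_iso f g"
  shows "word_iso g f"
proof -
  obtain \<phi> where \<phi>: "bij_betw \<phi> (wpos f) (wpos g)" "inj_on \<phi> (wpos f)" "\<phi> ` wpos f = wpos g"
    "\<And>s t. s \<in> wpos f \<Longrightarrow> t \<in> wpos f \<Longrightarrow> (s, t) \<in> wle f \<longleftrightarrow> (\<phi> s, \<phi> t) \<in> wle g"
    "\<And>s. s \<in> wpos f \<Longrightarrow> wlab g (\<phi> s) = wlab f s"
    by (fact word_isoE [OF assms])
  let ?\<psi> = "inv_into (wpos f) \<phi>"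
  have in_f: "?\<psi> s \<in> wpos f" "\<phi> (?\<psi> s) = s" if "s \<in> wpos g" for s
    using that \<phi>(3) by (auto simp: inv_into_into f_inv_into_f)
  show ?thesis
  proof (rule word_isoI [of ?\<psi>])
    show "bij_betw ?\<psi> (wpos g) (wpos f)" by (rule bij_betw_inv_into [OF \<phi>(1)])
    show "(s, t) \<in> wle g \<longleftrightarrow> (?\<psi> s, ?\<psi> t) \<in> wle f" if "s \<in> wpos g" "t \<in> wpos g" for s t
      using \<phi>(4) [of "?\<psi> s" "?\<psi> t"] in_f that by simp
    show "wlab g s = wlab f (?\<psi> s)" if "s \<in> wpos g" for s
      using \<phi>(5) [of "?\<psi> s"] in_f that by simp
  qed
qed

lemma word_iso_trans [trans]:
  assumes "word_iso f g" "word_iso g h"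
  shows "word_iso f h"
proof -
  obtain \<phi> where \<phi>: "bij_betw \<phi> (wpos f) (wpos g)" "inj_on \<phi> (wpos f)" "\<phi> ` wpos f = wpos g"
    "\<And>s t. s \<in> wpos f \<Longrightarrow> t \<in> wpos f \<Longrightarrow> (s, t) \<in> wle f \<longleftrightarrow> (\<phi> s, \<phi> t) \<in> wle g"
    "\<And>s. s \<in> wpos f \<Longrightarrow> wlab g (\<phi> s) = wlab f s"
    by (fact word_isoE [OF assms(1)])
  obtain \<psi> where \<psi>: "bij_betw \<psi> (wpos g) (wpos h)" "inj_on \<psi> (wpos g)" "\<psi> ` wpos g = wpos h"
    "\<And>s t. s \<in> wpos g \<Longrightarrow> t \<in> wpos g \<Longrightarrow> (s, t) \<in> wle g \<longleftrightarrow> (\<psi> s, \<psi> t) \<in> wle h"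
    "\<And>s. s \<in> wpos g \<Longrightarrow> wlab h (\<psi> s) = wlab g s"
    by (fact word_isoE [OF assms(2)])
  have in_g: "\<phi> s \<in> wpos g" if "s \<in> wpos f" for s using that \<phi>(3) by blast
  show ?thesis
    by (rule word_isoI [of "\<psi> \<circ> \<phi>"])
      (use bij_betw_trans [OF \<phi>(1) \<psi>(1)] \<phi>(4,5) \<psi>(4,5) in_g in auto)
qed

lemma lin_on_image:
  assumes lin: "lin_on P r"
    and \<phi>: "\<And>s t. s \<in> P \<Longrightarrow> t \<in> P \<Longrightarrow> (s, t) \<in> r \<longleftrightarrow> (\<phi> s, \<phi> t) \<in> r'"
  shows "lin_on (\<phi> ` P) r'"
proof (rule lin_onI; elim imageE; hypsubst)
  fix a b c assume P: "a \<in> P" "b \<in> P" "c \<in> P"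
  show "(\<phi> a, \<phi> a) \<in> r'" using lin_on_refl [OF lin P(1)] \<phi> [OF P(1,1)] by simp
  show "(\<phi> a, \<phi> b) \<in> r' \<or> (\<phi> b, \<phi> a) \<in> r'"
    using lin_on_total [OF lin P(1,2)] \<phi> [OF P(1,2)] \<phi> [OF P(2,1)] by simp
  show "\<phi> a = \<phi> b" if "(\<phi> a, \<phi> b) \<in> r'" "(\<phi> b, \<phi> a) \<in> r'"
    using lin_on_antisym [OF lin P(1,2)] \<phi> [OF P(1,2)] \<phi> [OF P(2,1)] that by simp
  show "(\<phi> a, \<phi> c) \<in> r'" if "(\<phi> a, \<phi> b) \<in> r'" "(\<phi> b, \<phi> c) \<in> r'"
    using lin_on_trans [OF lin P] \<phi> [OF P(1,2)] \<phi> [OF P(2,3)] \<phi> [OF P(1,3)] that by simp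
qed

text \<open>\<open>word_iso\<close> compares the orders only at positions, so it cannot exclude
  stray pairs in \<open>wle g\<close>; the last hypothesis does.\<close>

lemma word_over_iso:
  assumes f: "word_over L f" and "word_iso f g" and sub: "wle g \<subseteq> wpos g \<times> wpos g"
  shows "word_over L g"
proof -
  obtain \<phi> where \<phi>: "bij_betw \<phi> (wpos f) (wpos g)" "inj_on \<phi> (wpos f)" "\<phi> ` wpos f = wpos g"
    "\<And>s t. s \<in> wpos f \<Longrightarrow> t \<in> wpos f \<Longrightarrow> (s, t) \<in> wle f \<longleftrightarrow> (\<phi> s, \<phi> t) \<in> wle g"
    "\<And>s. s \<in> wpos f \<Longrightarrow> wlab g (\<phi> s) = wlab f s"
    by (fact word_isoE [OF assms(2)])
  show ?thesis
  proof (rule word_overI)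
    show "lin_on (wpos g) (wle g)"
      using lin_on_image [OF word_overD(1) [OF f] \<phi>(4)] by (simp add: \<phi>(3))
    show "wlab g s \<in> L" if "s \<in> wpos g" for s
      using that word_overD(3) [OF f] \<phi>(5) unfolding \<phi>(3) [symmetric] by auto
    have "{s \<in> wpos g. wlab g s = l} = \<phi> ` {s \<in> wpos f. wlab f s = l}" for l
      unfolding \<phi>(3) [symmetric] using \<phi>(5) by auto
    then show "finite {s \<in> wpos g. wlab g s = l}" if "l \<in> L" for l
      using word_overD(4) [OF f that] by simp
  qed (rule sub)
qed

lemma word_encode_words: "word_over L f \<Longrightarrow> word_encode f \<in> words L"
  unfolding words_iff
  by (rule word_over_iso [OF _ word_encode_iso])
    (use word_overD(2) in \<open>fastforce simp: word_encode_def\<close>)+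

lemma word_restrict_sel [simp]:
  "wpos (word_restrict f I) = wpos f \<inter> I" "wle (word_restrict f I) = wle f \<inter> I \<times> I"
  "wlab (word_restrict f I) = wlab f"
  by (simp_all add: word_restrict_def)

lemma word_restrict_restrict: "word_restrict (word_restrict f I) J = word_restrict f (I \<inter> J)"
  by (auto simp: word_restrict_def)

lemma word_restrict_full: "wle f \<subseteq> wpos f \<times> wpos f \<Longrightarrow> word_restrict f (wpos f) = f"
  by (simp add: word_restrict_def Int_absorb2)

lemma word_over_restrict: "word_over L f \<Longrightarrow> word_over L (word_restrict f I)"
proof (rule word_overI)
  assume f: "word_over L f"
  show "lin_on (wpos (word_restrict f I)) (wle (word_restrict f I))"
    using lin_on_image [OF lin_on_subset [OF word_overD(1) [OF f], of "wpos f \<inter> I"], of id "wle f \<inter> I \<times> I"]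
    by auto
  show "wle (word_restrict f I) \<subseteq> wpos (word_restrict f I) \<times> wpos (word_restrict f I)"
    using word_overD(2) [OF f] by auto
  show "wlab (word_restrict f I) s \<in> L" if "s \<in> wpos (word_restrict f I)" for s
    using word_overD(3) [OF f] that by auto
  show "finite {s \<in> wpos (word_restrict f I). wlab (word_restrict f I) s = l}" if "l \<in> L" for l
    by (rule finite_subset [OF _ word_overD(4) [OF f that]]) auto
qed

text \<open>The sets \<open>I\<close> and \<open>J\<close> are matched through labels, so that
  whatever isomorphism exists restricts. This suits preimages of sets of letters;
  \<open>word_iso_restrict_via\<close> is the version for a known isomorphism.\<close>

lemma word_iso_restrict:
  assumes "word_iso f g" "\<And>s t. s \<in> wpos f \<Longrightarrow> t \<in> wpos g \<Longrightarrow> wlab f s = wlab g t \<Longrightarrow> s \<in> I \<longleftrightarrow> t \<in> J"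
  shows "word_iso (word_restrict f I) (word_restrict g J)"
proof -
  obtain \<phi> where \<phi>: "bij_betw \<phi> (wpos f) (wpos g)" "inj_on \<phi> (wpos f)" "\<phi> ` wpos f = wpos g"
    "\<And>s t. s \<in> wpos f \<Longrightarrow> t \<in> wpos f \<Longrightarrow> (s, t) \<in> wle f \<longleftrightarrow> (\<phi> s, \<phi> t) \<in> wle g"
    "\<And>s. s \<in> wpos f \<Longrightarrow> wlab g (\<phi> s) = wlab f s"
    by (fact word_isoE [OF assms(1)])
  have IJ: "s \<in> I \<longleftrightarrow> \<phi> s \<in> J" if "s \<in> wpos f" for s
    using assms(2) [OF that, of "\<phi> s"] \<phi>(3,5) that by auto
  show ?thesis
  proof (rule word_isoI [of \<phi>])
    show "bij_betw \<phi> (wpos (word_restrict f I)) (wpos (word_restrict g J))"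
      using \<phi>(2) IJ unfolding bij_betw_def word_restrict_sel \<phi>(3) [symmetric]
      by (auto simp: inj_on_def)
  qed (use \<phi>(4,5) IJ in auto)
qed

lemma word_sum_sel [simp]:
  "wpos (word_sum f g) = wpos f <+> wpos g"
  "wlab (word_sum f g) (Inl s) = wlab f s" "wlab (word_sum f g) (Inr t) = wlab g t"
  "(Inl s, Inl s') \<in> wle (word_sum f g) \<longleftrightarrow> (s, s') \<in> wle f"
  "(Inr t, Inr t') \<in> wle (word_sum f g) \<longleftrightarrow> (t, t') \<in> wle g"
  "(Inl s, Inr t) \<in> wle (word_sum f g) \<longleftrightarrow> s \<in> wpos f \<and> t \<in> wpos g"
  "(Inr t, Inl s) \<notin> wle (word_sum f g)"
  by (force simp: word_sum_def)+

lemma word_over_sum: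
  assumes f: "word_over L f" and g: "word_over L g"
  shows "word_over L (word_sum f g)"
proof (rule word_overI)
  note F = word_overD [OF f] and G = word_overD [OF g]
  show "lin_on (wpos (word_sum f g)) (wle (word_sum f g))"
  proof (rule lin_onI)
    show "(a, a) \<in> wle (word_sum f g)" if "a \<in> wpos (word_sum f g)" for a
      using that lin_on_refl [OF F(1)] lin_on_refl [OF G(1)] by auto
    show "(a, b) \<in> wle (word_sum f g) \<or> (b, a) \<in> wle (word_sum f g)"
      if "a \<in> wpos (word_sum f g)" "b \<in> wpos (word_sum f g)" for a b
      using that lin_on_total [OF F(1)] lin_on_total [OF G(1)] by (cases a; cases b) auto
    show "a = b" if "a \<in> wpos (word_sum f g)" "b \<in> wpos (word_sum f g)"
      "(a, b) \<in> wle (word_sum f g)" "(b, a) \<in> wle (word_sum f g)" for a b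
      using that lin_on_antisym [OF F(1)] lin_on_antisym [OF G(1)] by auto
    show "(a, c) \<in> wle (word_sum f g)"
      if "a \<in> wpos (word_sum f g)" "b \<in> wpos (word_sum f g)" "c \<in> wpos (word_sum f g)"
        "(a, b) \<in> wle (word_sum f g)" "(b, c) \<in> wle (word_sum f g)" for a b c
      using that by (cases a; cases b; cases c)
        (auto intro: lin_on_trans [OF F(1)] lin_on_trans [OF G(1)] dest: subsetD [OF F(2)] subsetD [OF G(2)])
  qed
  show "wle (word_sum f g) \<subseteq> wpos (word_sum f g) \<times> wpos (word_sum f g)"
    using F(2) G(2) by (auto simp: word_sum_def)
  show "wlab (word_sum f g) s \<in> L" if "s \<in> wpos (word_sum f g)" for s
    using that F(3) G(3) by auto
  have "{s \<in> wpos (word_sum f g). wlab (word_sum f g) s = l} =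
      Inl ` {s \<in> wpos f. wlab f s = l} \<union> Inr ` {s \<in> wpos g. wlab g s = l}" for l
    by auto
  then show "finite {s \<in> wpos (word_sum f g). wlab (word_sum f g) s = l}" if "l \<in> L" for l
    using F(4) G(4) that by simp
qed

lemma word_sum_restrict:
  "word_restrict (word_sum f g) (A <+> B) = word_sum (word_restrict f A) (word_restrict g B)"
  by (auto simp: word_restrict_def word_sum_def)

lemma word_iso_sum:
  assumes "word_iso f f'" "word_iso g g'"
  shows "word_iso (word_sum f g) (word_sum f' g')"
proof -
  obtain \<phi> where \<phi>: "bij_betw \<phi> (wpos f) (wpos f')" "inj_on \<phi> (wpos f)" "\<phi> ` wpos f = wpos f'"
    "\<And>s t. s \<in> wpos f \<Longrightarrow> t \<in> wpos f \<Longrightarrow> (s, t) \<in> wle f \<longleftrightarrow> (\<phi> s, \<phi> t) \<in> wle f'"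
    "\<And>s. s \<in> wpos f \<Longrightarrow> wlab f' (\<phi> s) = wlab f s"
    by (fact word_isoE [OF assms(1)])
  obtain \<psi> where \<psi>: "bij_betw \<psi> (wpos g) (wpos g')" "inj_on \<psi> (wpos g)" "\<psi> ` wpos g = wpos g'"
    "\<And>s t. s \<in> wpos g \<Longrightarrow> t \<in> wpos g \<Longrightarrow> (s, t) \<in> wle g \<longleftrightarrow> (\<psi> s, \<psi> t) \<in> wle g'"
    "\<And>s. s \<in> wpos g \<Longrightarrow> wlab g' (\<psi> s) = wlab g s"
    by (fact word_isoE [OF assms(2)])
  have img: "s \<in> wpos f \<Longrightarrow> \<phi> s \<in> wpos f'" "t \<in> wpos g \<Longrightarrow> \<psi> t \<in> wpos g'" for s t
    using \<phi>(3) \<psi>(3) by auto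
  show ?thesis
  proof (rule word_isoI [of "map_sum \<phi> \<psi>"])
    have "inj_on (map_sum \<phi> \<psi>) (wpos f <+> wpos g)"
      by (rule inj_onI) (auto dest: inj_onD [OF \<phi>(2)] inj_onD [OF \<psi>(2)])
    moreover have "map_sum \<phi> \<psi> ` (wpos f <+> wpos g) = wpos f' <+> wpos g'"
      using \<phi>(3) \<psi>(3) by (simp add: Plus_def image_Un image_image) (simp add: image_image [symmetric])
    ultimately show "bij_betw (map_sum \<phi> \<psi>) (wpos (word_sum f g)) (wpos (word_sum f' g'))"
      by (simp add: bij_betw_def)
    show "(s, t) \<in> wle (word_sum f g) \<longleftrightarrow> (map_sum \<phi> \<psi> s, map_sum \<phi> \<psi> t) \<in> wle (word_sum f' g')"
      if "s \<in> wpos (word_sum f g)" "t \<in> wpos (word_sum f g)" for s t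
      using that \<phi>(4) \<psi>(4) img by auto
    show "wlab (word_sum f g) s = wlab (word_sum f' g') (map_sum \<phi> \<psi> s)"
      if "s \<in> wpos (word_sum f g)" for s
      using that \<phi>(5) \<psi>(5) by auto
  qed
qed

fun sum_assoc :: "('a + 'b) + 'c \<Rightarrow> 'a + ('b + 'c)" where
  "sum_assoc (Inl (Inl a)) = Inl a"
| "sum_assoc (Inl (Inr b)) = Inr (Inl b)"
| "sum_assoc (Inr c) = Inr (Inr c)"

lemma word_iso_sum_assoc:
  "word_iso (word_sum (word_sum f g) h) (word_sum f (word_sum g h))"
proof (rule word_isoI [of sum_assoc])
  have "inj_on sum_assoc ((wpos f <+> wpos g) <+> wpos h)"
    by (auto simp: inj_on_def)
  moreover have "sum_assoc ` ((wpos f <+> wpos g) <+> wpos h) = wpos f <+> (wpos g <+> wpos h)"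
    by (auto simp: Plus_def image_Un image_image)
  ultimately show "bij_betw sum_assoc (wpos (word_sum (word_sum f g) h)) (wpos (word_sum f (word_sum g h)))"
    by (simp add: bij_betw_def)
qed auto

lemma empty_word_over: "word_over L empty_word"
  by (rule word_overI) (auto simp: empty_word_def lin_on_def)

lemma empty_words: "empty_word \<in> words L"
  by (simp add: words_iff empty_word_over)

lemma word_iso_empty_sum: "word_iso (word_sum empty_word f) f"
proof (rule word_isoI [of projr])
  show "bij_betw projr (wpos (word_sum empty_word f)) (wpos f)"
    by (rule bij_betwI [of _ _ _ Inr]) (auto simp: empty_word_def)
qed (auto simp: empty_word_def)

lemma word_bar_sel [simp]:
  "wpos (word_bar \<iota> f) = wpos f" "wle (word_bar \<iota> f) = (wle f)\<inverse>" "wlab (word_bar \<iota> f) = \<iota> \<circ> wlab f"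
  by (simp_all add: word_bar_def word_rev_def)

lemma word_over_bar:
  assumes f: "word_over L f" and \<iota>: "free_involution L \<iota>"
  shows "word_over L (word_bar \<iota> f)"
proof (rule word_overI)
  show "lin_on (wpos (word_bar \<iota> f)) (wle (word_bar \<iota> f))"
    using lin_on_converse [OF word_overD(1) [OF f]] by simp
  show "wle (word_bar \<iota> f) \<subseteq> wpos (word_bar \<iota> f) \<times> wpos (word_bar \<iota> f)"
    using word_overD(2) [OF f] by auto
  show "wlab (word_bar \<iota> f) s \<in> L" if "s \<in> wpos (word_bar \<iota> f)" for s
    using that word_overD(3) [OF f] \<iota> by (simp add: free_involution_def)
  show "finite {s \<in> wpos (word_bar \<iota> f). wlab (word_bar \<iota> f) s = l}" if "l \<in> L" for l
  proof (rule finite_subset)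
    show "finite {s \<in> wpos f. wlab f s = \<iota> l}"
      using word_overD(4) [OF f] \<iota> that by (simp add: free_involution_def)
    show "{s \<in> wpos (word_bar \<iota> f). wlab (word_bar \<iota> f) s = l} \<subseteq> {s \<in> wpos f. wlab f s = \<iota> l}"
      using \<iota> word_overD(3) [OF f] by (auto simp: free_involution_def)
  qed
qed

section \<open>Cancellation and equivalence\<close>

lemma cancels_iso_right: "cancels \<iota> f g \<Longrightarrow> word_iso g h \<Longrightarrow> cancels \<iota> f h"
  unfolding cancels_iff by (blast intro: word_iso_trans)

lemma iso_cancels:
  assumes "word_over L f" "word_iso f g"
  shows "cancels \<iota> f g"
proof -
  have "cancelling \<iota> (wle f) (wlab f) (wpos f) {} id" by (simp add: cancelling_def)
  moreover have "word_iso (word_restrict f (wpos f - {})) g"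
    using assms word_restrict_full [OF word_overD(2)] by fastforce
  ultimately show ?thesis unfolding cancels_iff by blast
qed

lemma word_iso_restrict_via:
  assumes \<phi>: "inj_on \<phi> (wpos f)" "\<phi> ` wpos f = wpos g"
    "\<And>s t. s \<in> wpos f \<Longrightarrow> t \<in> wpos f \<Longrightarrow> (s, t) \<in> wle f \<longleftrightarrow> (\<phi> s, \<phi> t) \<in> wle g"
    "\<And>s. s \<in> wpos f \<Longrightarrow> wlab g (\<phi> s) = wlab f s"
    and I: "I \<subseteq> wpos f"
  shows "word_iso (word_restrict f I) (word_restrict g (\<phi> ` I))"
proof (rule word_isoI [of \<phi>])
  have "inj_on \<phi> I" "\<phi> ` I \<subseteq> wpos g" using \<phi>(1,2) I by (auto intro: inj_on_subset)
  then show "bij_betw \<phi> (wpos (word_restrict f I)) (wpos (word_restrict g (\<phi> ` I)))"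
    using I by (simp add: bij_betw_def Int_absorb1)
  show "(s, t) \<in> wle (word_restrict f I) \<longleftrightarrow> (\<phi> s, \<phi> t) \<in> wle (word_restrict g (\<phi> ` I))"
    if "s \<in> wpos (word_restrict f I)" "t \<in> wpos (word_restrict f I)" for s t
    using that \<phi>(3) by auto
  show "wlab (word_restrict f I) s = wlab (word_restrict g (\<phi> ` I)) (\<phi> s)"
    if "s \<in> wpos (word_restrict f I)" for s
    using that \<phi>(4) by auto
qed

lemma cancels_iso_left:
  assumes "word_iso f' f" "cancels \<iota> f' g"
  shows "cancels \<iota> f g"
proof -
  obtain \<phi> where \<phi>: "bij_betw \<phi> (wpos f') (wpos f)" "inj_on \<phi> (wpos f')" "\<phi> ` wpos f' = wpos f"
    "\<And>s t. s \<in> wpos f' \<Longrightarrow> t \<in> wpos f' \<Longrightarrow> (s, t) \<in> wle f' \<longleftrightarrow> (\<phi> s, \<phi> t) \<in> wle f"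
    "\<And>s. s \<in> wpos f' \<Longrightarrow> wlab f (\<phi> s) = wlab f' s"
    by (fact word_isoE [OF assms(1)])
  obtain T star where c: "cancelling \<iota> (wle f') (wlab f') (wpos f') T star"
    and iso: "word_iso (word_restrict f' (wpos f' - T)) g"
    using assms(2) unfolding cancels_iff by blast
  have T: "T \<subseteq> wpos f'" using c by (simp add: cancelling_def)
  have "cancelling \<iota> (wle f) (wlab f) (wpos f) (\<phi> ` T) (\<lambda>u. \<phi> (star (inv_into (wpos f') \<phi> u)))"
    using cancelling_transport [OF c \<phi>(2,4,5)] by (simp add: \<phi>(3))
  moreover have "wpos f - \<phi> ` T = \<phi> ` (wpos f' - T)"
    unfolding \<phi>(3) [symmetric] using inj_on_image_set_diff [OF \<phi>(2) _ T] by blast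
  then have "word_iso (word_restrict f' (wpos f' - T)) (word_restrict f (wpos f - \<phi> ` T))"
    using word_iso_restrict_via [OF \<phi>(2-5)] by simp
  then have "word_iso (word_restrict f (wpos f - \<phi> ` T)) g"
    using iso word_iso_sym word_iso_trans by blast
  ultimately show ?thesis unfolding cancels_iff by blast
qed

text \<open>Everything between two positions of the left summand lies in the left summand, so the
  segments of the cancellation are unchanged.\<close>

lemma cancels_sum_left:
  assumes "cancels \<iota> f f'" "word_over L g"
  shows "cancels \<iota> (word_sum f g) (word_sum f' g)"
proof -
  obtain T star where c: "cancelling \<iota> (wle f) (wlab f) (wpos f) T star"
    and iso: "word_iso (word_restrict f (wpos f - T)) f'"
    using assms(1) unfolding cancels_iff by blast
  have TP: "T \<subseteq> wpos f" using c by (simp add: cancelling_def)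
  have "cancelling \<iota> (wle (word_sum f g)) (wlab (word_sum f g)) (wpos (word_sum f g))
    (Inl ` T) (map_sum star id)"
  proof (rule cancellingI)
    fix t u assume t: "t \<in> Inl ` T" and u: "u \<in> wpos (word_sum f g)"
      "(t, u) \<in> wle (word_sum f g)" "(u, (map_sum star id) t) \<in> wle (word_sum f g)"
    from t obtain t' where t': "t = Inl t'" "t' \<in> T" by blast
    from u t'(1) obtain u' where u': "u = Inl u'" "u' \<in> wpos f" "(t', u') \<in> wle f" "(u', star t') \<in> wle f"
      by auto
    from cancelling_seg [OF c t'(2) u'(2-4)]
    show "u \<in> Inl ` T \<and> (t, (map_sum star id) u) \<in> wle (word_sum f g) \<and>
        ((map_sum star id) u, (map_sum star id) t) \<in> wle (word_sum f g)"
      by (simp add: t'(1) u'(1))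
  qed (use TP cancellingD [OF c] in auto)
  moreover have "wpos (word_sum f g) - Inl ` T = (wpos f - T) <+> wpos g" by auto
  then have "word_iso (word_restrict (word_sum f g) (wpos (word_sum f g) - Inl ` T)) (word_sum f' g)"
    using word_iso_sum [OF iso word_iso_refl]
    by (simp add: word_sum_restrict word_restrict_full [OF word_overD(2) [OF assms(2)]])
  ultimately show ?thesis unfolding cancels_iff by blast
qed

lemma cancels_sum_right:
  assumes "cancels \<iota> f f'" "word_over L g"
  shows "cancels \<iota> (word_sum g f) (word_sum g f')"
proof -
  obtain T star where c: "cancelling \<iota> (wle f) (wlab f) (wpos f) T star"
    and iso: "word_iso (word_restrict f (wpos f - T)) f'"
    using assms(1) unfolding cancels_iff by blast
  have TP: "T \<subseteq> wpos f" using c by (simp add: cancelling_def)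
  have "cancelling \<iota> (wle (word_sum g f)) (wlab (word_sum g f)) (wpos (word_sum g f))
    (Inr ` T) (map_sum id star)"
  proof (rule cancellingI)
    fix t u assume t: "t \<in> Inr ` T" and u: "u \<in> wpos (word_sum g f)"
      "(t, u) \<in> wle (word_sum g f)" "(u, (map_sum id star) t) \<in> wle (word_sum g f)"
    from t obtain t' where t': "t = Inr t'" "t' \<in> T" by blast
    from u t'(1) obtain u' where u': "u = Inr u'" "u' \<in> wpos f" "(t', u') \<in> wle f" "(u', star t') \<in> wle f"
      by auto
    from cancelling_seg [OF c t'(2) u'(2-4)]
    show "u \<in> Inr ` T \<and> (t, (map_sum id star) u) \<in> wle (word_sum g f) \<and>
        ((map_sum id star) u, (map_sum id star) t) \<in> wle (word_sum g f)"
      by (simp add: t'(1) u'(1))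
  qed (use TP cancellingD [OF c] in auto)
  moreover have "wpos (word_sum g f) - Inr ` T = wpos g <+> (wpos f - T)" by auto
  then have "word_iso (word_restrict (word_sum g f) (wpos (word_sum g f) - Inr ` T)) (word_sum g f')"
    using word_iso_sum [OF word_iso_refl iso]
    by (simp add: word_sum_restrict word_restrict_full [OF word_overD(2) [OF assms(2)]])
  ultimately show ?thesis unfolding cancels_iff by blast
qed

text \<open>Every position is cancelled. Both summands have the same positions in opposite orders,
  so exchanging the two copies is the reflection of the whole word in its midpoint and maps each
  segment from \<open>t\<close> to \<open>star t\<close> onto itself.\<close>

lemma cancels_bar_sum:
  assumes f: "word_over L f" and \<iota>: "free_involution L \<iota>"
  shows "cancels \<iota> (word_sum (word_bar \<iota> f) f) empty_word"
proof -
  let ?s = "word_sum (word_bar \<iota> f) f"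
  have "cancelling \<iota> (wle ?s) (wlab ?s) (wpos ?s) (wpos ?s) (case_sum Inr Inl)"
    unfolding cancelling_def
    using word_overD(3) [OF f] \<iota> by (auto simp: free_involution_def)
  moreover have "word_iso (word_restrict ?s (wpos ?s - wpos ?s)) empty_word"
    \<comment> \<open>Both words have no positions, so any map is an isomorphism.\<close>
    by (rule word_isoI [of undefined]) (auto simp: empty_word_def bij_betw_def)
  ultimately show ?thesis unfolding cancels_iff by blast
qed

section \<open>The generated equivalence and its compatibility with concatenation\<close>

lemma word_equiv_refl [simp]: "word_equiv L \<iota> f f"
  by (simp add: word_equiv_def)

lemma word_equiv_sym: "word_equiv L \<iota> f g \<Longrightarrow> word_equiv L \<iota> g f"
  unfolding word_equiv_def by (rule equivclp_sym)

lemma word_equiv_trans [trans]: "word_equiv L \<iota> f g \<Longrightarrow> word_equiv L \<iota> g h \<Longrightarrow> word_equiv L \<iota> f h"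
  unfolding word_equiv_def by (rule equivclp_trans)

lemma word_equiv_cancels:
  "f \<in> words L \<Longrightarrow> g \<in> words L \<Longrightarrow> cancels \<iota> f g \<Longrightarrow> word_equiv L \<iota> f g"
  unfolding word_equiv_def by (intro r_into_equivclp conjI)

lemma word_equiv_iso: "f \<in> words L \<Longrightarrow> g \<in> words L \<Longrightarrow> word_iso f g \<Longrightarrow> word_equiv L \<iota> f g"
  by (meson iso_cancels word_equiv_cancels words_iff)

text \<open>The universal property of the generated equivalence: an equivalence relation that
  contains all cancellations between words contains \<open>word_equiv\<close>. All invariance
  statements go through it.\<close>

lemma word_equiv_lift:
  assumes "word_equiv L \<iota> f g"
    and "\<And>f g. f \<in> words L \<Longrightarrow> g \<in> words L \<Longrightarrow> cancels \<iota> f g \<Longrightarrow> Q f g"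
    and "\<And>f. Q f f" "\<And>f g. Q f g \<Longrightarrow> Q g f" "\<And>f g h. Q f g \<Longrightarrow> Q g h \<Longrightarrow> Q f h"
  shows "Q f g"
  using assms(1) unfolding word_equiv_def
  by (induction rule: equivclp_induct) (use assms(2-5) in blast)+

lemma word_cat_iso: "word_over L f \<Longrightarrow> word_over L g \<Longrightarrow> word_iso (word_sum f g) (word_cat f g)"
  unfolding word_cat_def by (rule word_encode_iso [OF word_over_sum])

lemma word_cat_words [simp]: "f \<in> words L \<Longrightarrow> g \<in> words L \<Longrightarrow> word_cat f g \<in> words L"
  unfolding word_cat_def words_iff by (simp add: word_encode_words [unfolded words_iff] word_over_sum)

lemma cancels_cat:
  assumes "f \<in> words L" "g \<in> words L" "f' \<in> words L" "g' \<in> words L"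
    and "cancels \<iota> (word_sum f g) (word_sum f' g')"
  shows "word_equiv L \<iota> (word_cat f g) (word_cat f' g')"
proof (rule word_equiv_cancels)
  note o = assms(1-4) [unfolded words_iff]
  show "cancels \<iota> (word_cat f g) (word_cat f' g')"
    by (rule cancels_iso_left [OF word_cat_iso [OF o(1,2)]
          cancels_iso_right [OF assms(5) word_cat_iso [OF o(3,4)]]])
qed (use assms(1-4) in simp_all)

lemma word_cat_cong_left:
  assumes "word_equiv L \<iota> f f'" "g \<in> words L"
  shows "word_equiv L \<iota> (word_cat f g) (word_cat f' g)"
  using assms(1)
proof (rule word_equiv_lift)
  fix f h assume fh: "f \<in> words L" "h \<in> words L" "cancels \<iota> f h"
  show "word_equiv L \<iota> (word_cat f g) (word_cat h g)"
    by (rule cancels_cat [OF fh(1) assms(2) fh(2) assms(2)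
          cancels_sum_left [OF fh(3) assms(2) [unfolded words_iff]]])
qed (auto intro: word_equiv_sym word_equiv_trans)

lemma word_cat_cong_right:
  assumes "word_equiv L \<iota> f f'" "g \<in> words L"
  shows "word_equiv L \<iota> (word_cat g f) (word_cat g f')"
  using assms(1)
proof (rule word_equiv_lift)
  fix f h assume fh: "f \<in> words L" "h \<in> words L" "cancels \<iota> f h"
  show "word_equiv L \<iota> (word_cat g f) (word_cat g h)"
    by (rule cancels_cat [OF assms(2) fh(1) assms(2) fh(2)
          cancels_sum_right [OF fh(3) assms(2) [unfolded words_iff]]])
qed (auto intro: word_equiv_sym word_equiv_trans)

text \<open>\<open>word_cat\<close> re-encodes its positions each time, so threefold concatenations
  are not equal. Both are compared with raw sums, where the change of bracketing is the explicit
  bijection \<open>sum_assoc\<close>.\<close>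

lemma word_iso_cat_sum:
  assumes "word_over L f" "word_over L g" "word_over L h"
  shows "word_iso (word_cat (word_cat f g) h) (word_sum (word_sum f g) h)"
    "word_iso (word_cat f (word_cat g h)) (word_sum f (word_sum g h))"
proof -
  have o: "word_over L (word_cat f g)" "word_over L (word_cat g h)"
    using assms word_cat_words words_iff by blast+
  show "word_iso (word_cat (word_cat f g) h) (word_sum (word_sum f g) h)"
    by (rule word_iso_trans [OF word_iso_sym [OF word_cat_iso [OF o(1) assms(3)]]])
      (rule word_iso_sum [OF word_iso_sym [OF word_cat_iso [OF assms(1,2)]] word_iso_refl])
  show "word_iso (word_cat f (word_cat g h)) (word_sum f (word_sum g h))"
    by (rule word_iso_trans [OF word_iso_sym [OF word_cat_iso [OF assms(1) o(2)]]])
      (rule word_iso_sum [OF word_iso_refl word_iso_sym [OF word_cat_iso [OF assms(2,3)]]])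
qed

lemma word_cat_assoc:
  assumes "f \<in> words L" "g \<in> words L" "h \<in> words L"
  shows "word_equiv L \<iota> (word_cat (word_cat f g) h) (word_cat f (word_cat g h))"
proof (rule word_equiv_iso)
  show "word_iso (word_cat (word_cat f g) h) (word_cat f (word_cat g h))"
    using word_iso_cat_sum [OF assms [unfolded words_iff]]
    by (rule word_iso_trans [OF _ word_iso_trans [OF word_iso_sum_assoc word_iso_sym]])
qed (use assms in auto)

lemma word_cat_empty:
  assumes "f \<in> words L"
  shows "word_equiv L \<iota> (word_cat empty_word f) f"
proof (rule word_equiv_iso)
  show "word_iso (word_cat empty_word f) f"
    using word_cat_iso [OF empty_word_over assms [unfolded words_iff]]
    by (rule word_iso_trans [OF word_iso_sym word_iso_empty_sum])
qed (use assms in \<open>simp_all add: empty_words\<close>)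

lemma word_cat_bar:
  assumes "f \<in> words L" "free_involution L \<iota>"
  shows "word_equiv L \<iota> (word_cat (word_bar \<iota> f) f) empty_word"
proof (rule word_equiv_cancels)
  note f = assms(1) [unfolded words_iff]
  have bar: "word_over L (word_bar \<iota> f)" by (rule word_over_bar [OF f assms(2)])
  then show "word_cat (word_bar \<iota> f) f \<in> words L" "empty_word \<in> words L"
    using assms(1) empty_word_over words_iff by (blast intro: word_cat_words)+
  show "cancels \<iota> (word_cat (word_bar \<iota> f) f) empty_word"
    by (rule cancels_iso_left [OF word_cat_iso [OF bar f] cancels_bar_sum [OF f assms(2)]])
qed

section \<open>Big free groups\<close>

lemma bf_class_eq_iff:
  assumes "f \<in> words L" "g \<in> words L"
  shows "bf_class L \<iota> f = bf_class L \<iota> g \<longleftrightarrow> word_equiv L \<iota> f g"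
proof
  assume "bf_class L \<iota> f = bf_class L \<iota> g"
  then have "g \<in> bf_class L \<iota> f" using assms(2) by (simp add: bf_class_def)
  then show "word_equiv L \<iota> f g" by (simp add: bf_class_def)
qed (auto simp: bf_class_def intro: word_equiv_trans word_equiv_sym)

lemma bf_class_self: "f \<in> words L \<Longrightarrow> f \<in> bf_class L \<iota> f"
  by (simp add: bf_class_def)

lemma bf_class_memD: "g \<in> bf_class L \<iota> f \<Longrightarrow> g \<in> words L \<and> word_equiv L \<iota> f g"
  by (simp add: bf_class_def)

lemma carrier_BF: "carrier (BF L \<iota> \<S>) = bf_class L \<iota> ` \<S>"
  by (simp add: BF_def)

lemma one_BF: "\<one>\<^bsub>BF L \<iota> \<S>\<^esub> = bf_class L \<iota> empty_word"
  by (simp add: BF_def)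

text \<open>All pairs of representatives yield the same class, so the union in the definition
  collapses to a single class.\<close>

lemma mult_BF:
  assumes "f \<in> words L" "g \<in> words L"
  shows "bf_class L \<iota> f \<otimes>\<^bsub>BF L \<iota> \<S>\<^esub> bf_class L \<iota> g = bf_class L \<iota> (word_cat f g)"
proof -
  have "bf_class L \<iota> (word_cat f' g') = bf_class L \<iota> (word_cat f g)"
    if "f' \<in> bf_class L \<iota> f" "g' \<in> bf_class L \<iota> g" for f' g'
  proof -
    note f' = bf_class_memD [OF that(1)] and g' = bf_class_memD [OF that(2)]
    have "word_equiv L \<iota> (word_cat f g) (word_cat f' g')"
      using word_cat_cong_left [of L \<iota> f f' g] word_cat_cong_right [of L \<iota> g g' f'] assms f' g'
      by (blast intro: word_equiv_trans)
    then show ?thesis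
      using bf_class_eq_iff [of "word_cat f g" L "word_cat f' g'" \<iota>] assms f' g' by simp
  qed
  then have "(\<Union>f'\<in>bf_class L \<iota> f. \<Union>g'\<in>bf_class L \<iota> g. bf_class L \<iota> (word_cat f' g')) =
      (\<Union>f'\<in>bf_class L \<iota> f. \<Union>g'\<in>bf_class L \<iota> g. bf_class L \<iota> (word_cat f g))"
    by (intro SUP_cong refl) simp
  also have "\<dots> = bf_class L \<iota> (word_cat f g)"
    using bf_class_self [OF assms(1), of \<iota>] bf_class_self [OF assms(2), of \<iota>] by blast
  finally show ?thesis by (simp add: BF_def)
qed

text \<open>The closure properties behind the group axioms, shared by all words over an alphabet, by
  \<open>wordsS\<close> and by \<open>wordsS'\<close>.\<close>

locale word_system =
  fixes L :: "'l set" and \<iota> :: "'l \<Rightarrow> 'l" and \<S> :: "'l bword set"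
  assumes inv: "free_involution L \<iota>" and sub: "\<S> \<subseteq> words L" and empty: "empty_word \<in> \<S>"
    and cat: "\<And>f g. f \<in> \<S> \<Longrightarrow> g \<in> \<S> \<Longrightarrow> word_cat f g \<in> \<S>"
    and bar: "\<And>f. f \<in> \<S> \<Longrightarrow> word_bar \<iota> f \<in> \<S>"
begin

lemma in_words: "f \<in> \<S> \<Longrightarrow> f \<in> words L"
  using sub by blast

lemma mult: "f \<in> \<S> \<Longrightarrow> g \<in> \<S> \<Longrightarrow>
    bf_class L \<iota> f \<otimes>\<^bsub>BF L \<iota> \<S>\<^esub> bf_class L \<iota> g = bf_class L \<iota> (word_cat f g)"
  by (simp add: mult_BF in_words)

lemma class_eqI: "f \<in> \<S> \<Longrightarrow> g \<in> \<S> \<Longrightarrow> word_equiv L \<iota> f g \<Longrightarrow> bf_class L \<iota> f = bf_class L \<iota> g"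
  using bf_class_eq_iff in_words by blast

lemma bar_mult: "f \<in> \<S> \<Longrightarrow>
    bf_class L \<iota> (word_bar \<iota> f) \<otimes>\<^bsub>BF L \<iota> \<S>\<^esub> bf_class L \<iota> f = \<one>\<^bsub>BF L \<iota> \<S>\<^esub>"
  by (simp add: mult bar one_BF) (intro class_eqI word_cat_bar inv cat bar empty in_words; assumption)

lemma group_BF: "group (BF L \<iota> \<S>)"
proof (rule groupI; (unfold carrier_BF)?; (elim imageE, hypsubst)?)
  fix f g h assume S: "f \<in> \<S>" "g \<in> \<S>" "h \<in> \<S>"
  show "bf_class L \<iota> f \<otimes>\<^bsub>BF L \<iota> \<S>\<^esub> bf_class L \<iota> g \<in> bf_class L \<iota> ` \<S>"
    using S by (simp add: mult cat)
  show "bf_class L \<iota> f \<otimes>\<^bsub>BF L \<iota> \<S>\<^esub> bf_class L \<iota> g \<otimes>\<^bsub>BF L \<iota> \<S>\<^esub> bf_class L \<iota> h =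
    bf_class L \<iota> f \<otimes>\<^bsub>BF L \<iota> \<S>\<^esub> (bf_class L \<iota> g \<otimes>\<^bsub>BF L \<iota> \<S>\<^esub> bf_class L \<iota> h)"
    using class_eqI [OF cat [OF cat] cat [OF _ cat] word_cat_assoc] S by (simp add: mult cat in_words)
  show "\<one>\<^bsub>BF L \<iota> \<S>\<^esub> \<otimes>\<^bsub>BF L \<iota> \<S>\<^esub> bf_class L \<iota> f = bf_class L \<iota> f"
    using class_eqI [OF cat [OF empty] _ word_cat_empty] S by (simp add: mult one_BF empty in_words)
  show "\<exists>y\<in>bf_class L \<iota> ` \<S>. y \<otimes>\<^bsub>BF L \<iota> \<S>\<^esub> bf_class L \<iota> f = \<one>\<^bsub>BF L \<iota> \<S>\<^esub>"
    using bar_mult [OF S(1)] bar [OF S(1)] by blast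
qed (simp add: one_BF empty)

lemma inv_class:
  assumes "f \<in> \<S>"
  shows "inv\<^bsub>BF L \<iota> \<S>\<^esub> (bf_class L \<iota> f) = bf_class L \<iota> (word_bar \<iota> f)"
  by (rule group.inv_equality [OF group_BF bar_mult [OF assms]])
    (use assms bar in \<open>auto simp: carrier_BF\<close>)

end

lemma word_system_words:
  assumes "free_involution L \<iota>"
  shows "word_system L \<iota> (words L)"
proof
  show "word_bar \<iota> f \<in> words L" if "f \<in> words L" for f
    using that assms word_over_bar by (simp add: words_iff)
qed (use assms in \<open>simp_all add: empty_words\<close>)

lemma subgroup_BF:
  assumes "word_system L \<iota> \<S>" "word_system L \<iota> \<S>'" "\<S>' \<subseteq> \<S>"
  shows "subgroup (carrier (BF L \<iota> \<S>')) (BF L \<iota> \<S>)"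
proof -
  interpret S: word_system L \<iota> \<S> by fact
  interpret S': word_system L \<iota> \<S>' by fact
  have in_S: "f \<in> \<S>" if "f \<in> \<S>'" for f using that assms(3) by blast
  show ?thesis
  proof (rule group.subgroupI [OF S.group_BF]; (unfold carrier_BF)?; (elim imageE, hypsubst)?)
    show "bf_class L \<iota> ` \<S>' \<subseteq> bf_class L \<iota> ` \<S>" using assms(3) by blast
    show "bf_class L \<iota> ` \<S>' \<noteq> {}" using S'.empty by blast
    fix f g assume "f \<in> \<S>'" "g \<in> \<S>'"
    then show "inv\<^bsub>BF L \<iota> \<S>\<^esub> (bf_class L \<iota> f) \<in> bf_class L \<iota> ` \<S>'"
      "bf_class L \<iota> f \<otimes>\<^bsub>BF L \<iota> \<S>\<^esub> bf_class L \<iota> g \<in> bf_class L \<iota> ` \<S>'"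
      by (simp_all add: S.inv_class S.mult in_S S'.bar S'.cat)
  qed
qed

text \<open>Multiplication and unit are defined from representatives in \<open>words L\<close>
  without reference to the set of words. This puts \<open>BF\<close> of a smaller set into the form
  that the library uses for subgroups.\<close>

lemma BF_eq_update: "BF L \<iota> \<S>' = (BF L \<iota> \<S>)\<lparr>carrier := carrier (BF L \<iota> \<S>')\<rparr>"
  by (simp add: BF_def)

section \<open>Projection of words to a smaller alphabet\<close>

definition word_proj :: "'l set \<Rightarrow> ('s, 'l) tword \<Rightarrow> ('s, 'l) tword" where
  "word_proj A f = word_restrict f (wlab f -` A)"

lemma word_proj_over:
  assumes f: "word_over L f" and "A \<subseteq> L"
  shows "word_over A (word_proj A f)"
proof -
  note o = word_over_restrict [OF f, of "wlab f -` A"]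
  show ?thesis
    by (rule word_overI)
      (use word_overD(1,2) [OF o] word_overD(4) [OF o] assms(2) in \<open>auto simp: word_proj_def\<close>)
qed

lemma word_proj_words: "f \<in> words L \<Longrightarrow> A \<subseteq> L \<Longrightarrow> word_proj A f \<in> words A"
  unfolding words_iff by (rule word_proj_over)

lemma word_iso_proj: "word_iso f g \<Longrightarrow> word_iso (word_proj A f) (word_proj A g)"
  unfolding word_proj_def by (rule word_iso_restrict) auto

lemma word_proj_sum: "word_proj A (word_sum f g) = word_sum (word_proj A f) (word_proj A g)"
proof -
  have "wlab (word_sum f g) -` A = (wlab f -` A) <+> (wlab g -` A)"
  proof (rule Set.set_eqI)
    fix s show "s \<in> wlab (word_sum f g) -` A \<longleftrightarrow> s \<in> (wlab f -` A) <+> (wlab g -` A)"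
      by (cases s) auto
  qed
  then show ?thesis by (simp add: word_proj_def word_sum_restrict)
qed

lemma word_proj_proj: "A \<subseteq> B \<Longrightarrow> word_proj A (word_proj B f) = word_proj A f"
  by (simp add: word_proj_def word_restrict_restrict) (rule arg_cong [where f = "word_restrict f"], auto)

text \<open>Since \<open>A\<close> is closed under \<open>\<iota>\<close>, a cancelled position
  survives the projection together with its partner, so the same \<open>star\<close> works on the
  surviving part of \<open>T\<close>.\<close>

lemma word_proj_cancels:
  assumes "cancels \<iota> f g" "\<And>l. l \<in> A \<Longrightarrow> \<iota> l \<in> A"
  shows "cancels \<iota> (word_proj A f) (word_proj A g)"
proof -
  let ?Q = "wpos f \<inter> wlab f -` A"
  obtain T star where c: "cancelling \<iota> (wle f) (wlab f) (wpos f) T star"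
    and iso: "word_iso (word_restrict f (wpos f - T)) g"
    using assms(1) unfolding cancels_iff by blast
  have "cancelling \<iota> (wle f) (wlab f) ?Q (T \<inter> ?Q) star"
    by (rule cancelling_subset [OF c]) (use cancellingD(3,5) [OF c] assms(2) in auto)
  \<comment> \<open>Transport along the identity serves only to replace \<open>wle f\<close> by its
    restriction.\<close>
  from cancelling_transport [OF this, of id "wle (word_proj A f)" "wlab f"]
  have "cancelling \<iota> (wle (word_proj A f)) (wlab (word_proj A f)) (wpos (word_proj A f)) (T \<inter> ?Q)
      (\<lambda>u. id (star (inv_into ?Q id u)))"
    by (simp add: word_proj_def)
  moreover have "word_restrict (word_proj A f) (wpos (word_proj A f) - T \<inter> ?Q) =
      word_proj A (word_restrict f (wpos f - T))"
    by (simp add: word_proj_def word_restrict_restrict)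
      (auto simp: word_restrict_def)
  ultimately show ?thesis
    unfolding cancels_iff using word_iso_proj [OF iso, of A] by metis
qed

lemma word_proj_equiv:
  assumes "word_equiv L \<iota> f g" "A \<subseteq> L" "\<And>l. l \<in> A \<Longrightarrow> \<iota> l \<in> A"
  shows "word_equiv A \<iota> (word_proj A f) (word_proj A g)"
  using assms(1)
proof (rule word_equiv_lift)
  fix f g assume "f \<in> words L" "g \<in> words L" "cancels \<iota> f g"
  then show "word_equiv A \<iota> (word_proj A f) (word_proj A g)"
    by (intro word_equiv_cancels word_proj_words [OF _ assms(2)] word_proj_cancels assms(3))
qed (auto intro: word_equiv_sym word_equiv_trans)

lemma bf_proj_class:
  assumes "f \<in> words L" "A \<subseteq> L" "\<And>l. l \<in> A \<Longrightarrow> \<iota> l \<in> A"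
  shows "bf_proj \<iota> A (bf_class L \<iota> f) = bf_class A \<iota> (word_proj A f)"
proof -
  have "bf_class A \<iota> (word_proj A g) = bf_class A \<iota> (word_proj A f)" if "g \<in> bf_class L \<iota> f" for g
  proof -
    note g = bf_class_memD [OF that]
    have "word_equiv A \<iota> (word_proj A f) (word_proj A g)"
      by (rule word_proj_equiv [OF _ assms(2,3)]) (use g in auto)
    then show ?thesis
      using bf_class_eq_iff [OF word_proj_words word_proj_words, OF assms(1,2) _ assms(2)] g by metis
  qed
  then show ?thesis
    using bf_class_self [OF assms(1), of \<iota>] unfolding bf_proj_def word_proj_def [symmetric] by blast
qed

lemma word_proj_cat:
  assumes "f \<in> words L" "g \<in> words L" "A \<subseteq> L"
  shows "word_equiv A \<iota> (word_proj A (word_cat f g)) (word_cat (word_proj A f) (word_proj A g))"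
proof (rule word_equiv_iso)
  note o = assms(1,2) [unfolded words_iff]
  have "word_iso (word_proj A (word_cat f g)) (word_sum (word_proj A f) (word_proj A g))"
    using word_iso_proj [OF word_iso_sym [OF word_cat_iso [OF o]], of A] by (simp add: word_proj_sum)
  then show "word_iso (word_proj A (word_cat f g)) (word_cat (word_proj A f) (word_proj A g))"
    using word_cat_iso [OF word_proj_over [OF o(1) assms(3)] word_proj_over [OF o(2) assms(3)]]
    by (rule word_iso_trans)
  show "word_proj A (word_cat f g) \<in> words A"
    by (rule word_proj_words [OF word_cat_words [OF assms(1,2)] assms(3)])
  show "word_cat (word_proj A f) (word_proj A g) \<in> words A"
    by (rule word_cat_words [OF word_proj_words word_proj_words, OF assms(1,3,2,3)])
qed

context word_system
begin

lemma bf_proj_hom: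
  assumes "A \<subseteq> L" "\<And>l. l \<in> A \<Longrightarrow> \<iota> l \<in> A"
  shows "bf_proj \<iota> A \<in> hom (BF L \<iota> \<S>) (BF A \<iota> (words A))"
proof (rule homI; (unfold carrier_BF)?; (elim imageE, hypsubst)?)
  fix f g assume S: "f \<in> \<S>" "g \<in> \<S>"
  note p = word_proj_words [OF in_words assms(1)]
  show "bf_proj \<iota> A (bf_class L \<iota> f) \<in> bf_class A \<iota> ` words A"
    using p [OF S(1)] bf_proj_class [OF in_words [OF S(1)] assms] by auto
  show "bf_proj \<iota> A (bf_class L \<iota> f \<otimes>\<^bsub>BF L \<iota> \<S>\<^esub> bf_class L \<iota> g) =
      bf_proj \<iota> A (bf_class L \<iota> f) \<otimes>\<^bsub>BF A \<iota> (words A)\<^esub> bf_proj \<iota> A (bf_class L \<iota> g)"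
    using S p bf_class_eq_iff [OF word_proj_words word_cat_words, OF _ assms(1) p p]
      word_proj_cat [OF in_words in_words assms(1)]
    by (simp add: mult mult_BF bf_proj_class [OF _ assms] in_words cat)
qed

lemma bf_proj_kernel_iff:
  assumes "A \<subseteq> L" "\<And>l. l \<in> A \<Longrightarrow> \<iota> l \<in> A" "f \<in> \<S>"
  shows "bf_class L \<iota> f \<in> bf_proj_kernel L \<iota> \<S> A \<longleftrightarrow> word_equiv A \<iota> (word_proj A f) empty_word"
  using assms bf_class_eq_iff [OF word_proj_words [OF in_words] empty_word_over [folded words_iff]]
  by (auto simp: bf_proj_kernel_def kernel_def carrier_BF one_BF bf_proj_class [OF in_words])

lemma bf_proj_kernel_normal:
  assumes "A \<subseteq> L" "\<And>l. l \<in> A \<Longrightarrow> \<iota> l \<in> A"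
  shows "bf_proj_kernel L \<iota> \<S> A \<lhd> BF L \<iota> \<S>"
proof -
  have "free_involution A \<iota>" using inv assms by (auto simp: free_involution_def)
  then interpret A: word_system A \<iota> "words A" by (rule word_system_words)
  have "group_hom (BF L \<iota> \<S>) (BF A \<iota> (words A)) (bf_proj \<iota> A)"
    using group_BF A.group_BF bf_proj_hom [OF assms]
    by (simp add: group_hom_def group_hom_axioms_def)
  then show ?thesis unfolding bf_proj_kernel_def by (rule group_hom.normal_kernel)
qed

text \<open>The projection to \<open>A\<close> factors through the projection to
  \<open>B\<close>.\<close>

lemma bf_proj_kernel_mono:
  assumes "A \<subseteq> B" "B \<subseteq> L" "\<And>l. l \<in> A \<Longrightarrow> \<iota> l \<in> A" "\<And>l. l \<in> B \<Longrightarrow> \<iota> l \<in> B"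
  shows "bf_proj_kernel L \<iota> \<S> B \<subseteq> bf_proj_kernel L \<iota> \<S> A"
proof
  fix c assume c: "c \<in> bf_proj_kernel L \<iota> \<S> B"
  then obtain f where f: "f \<in> \<S>" "c = bf_class L \<iota> f"
    by (auto simp: bf_proj_kernel_def kernel_def carrier_BF)
  have "word_equiv B \<iota> (word_proj B f) empty_word"
    using c bf_proj_kernel_iff [OF assms(2,4) f(1)] f(2) by simp
  then have "word_equiv A \<iota> (word_proj A (word_proj B f)) (word_proj A empty_word)"
    by (rule word_proj_equiv) (use assms in auto)
  moreover have "word_proj A empty_word = empty_word"
    by (simp add: word_proj_def empty_word_def word_restrict_def)
  ultimately show "c \<in> bf_proj_kernel L \<iota> \<S> A"
    using bf_proj_kernel_iff [OF _ assms(3) f(1)] f(2) assms(1,2) word_proj_proj [OF assms(1), of f] by auto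
qed

end

section \<open>Trails and orbits\<close>

lemma touching_eq: "touching z f = hits (wlab f) (wpos f) {z}"
  by (auto simp: touching_def hits_def pts_def)

text \<open>The positions still available after the last used position \<open>s\<close>: the link
  between the stages of \<open>trail\<close> and the shrinking position sets of
  \<open>orbit\<close>.\<close>

definition later :: "('s, 'l) tword \<Rightarrow> 's option \<Rightarrow> 's set" where
  "later f s = {t \<in> wpos f. case s of None \<Rightarrow> True | Some s' \<Rightarrow> (s', t) \<in> wle f \<and> s' \<noteq> t}"

lemma later_None [simp]: "later f None = wpos f"
  by (simp add: later_def)

lemma later_subset: "later f s \<subseteq> wpos f"
  by (auto simp: later_def)

lemma later_Some:
  assumes "lin_on (wpos f) (wle f)" "t \<in> later f s" "\<And>s'. s = Some s' \<Longrightarrow> s' \<in> wpos f"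
  shows "later f (Some t) = {u \<in> later f s. (t, u) \<in> wle f \<and> u \<noteq> t}"
proof (cases s)
  case None
  then show ?thesis by (auto simp: later_def)
next
  case (Some s')
  have "s' \<in> wpos f" "t \<in> wpos f" "(s', t) \<in> wle f" "s' \<noteq> t"
    using assms(2,3) Some by (auto simp: later_def)
  then have "(s', u) \<in> wle f \<and> s' \<noteq> u" if "u \<in> wpos f" "(t, u) \<in> wle f" for u
    using lin_on_trans [OF assms(1), of s' t u] lin_on_antisym [OF assms(1), of s' t] that by auto
  then show ?thesis using Some by (auto simp: later_def)
qed

lemma the_other: "y \<in> pts l \<Longrightarrow> (THE z. {y, z} = {fst l, snd l}) = other y l"
  by (rule the_equality) (auto simp: pts_def other_def doubleton_eq_iff)

lemma least_pos_eq:
  assumes "lin_on (wpos f) (wle f)" "A \<subseteq> wpos f" "t \<in> A" "\<And>u. u \<in> A \<Longrightarrow> (t, u) \<in> wle f"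
  shows "least_pos f A = t"
  unfolding least_pos_def
proof (rule the_equality)
  fix s assume s: "s \<in> A \<and> (\<forall>t\<in>A. (s, t) \<in> wle f)"
  show "s = t"
    by (rule lin_on_antisym [OF assms(1)]) (use s assms in auto)
qed (use assms in auto)

lemma trail_Suc:
  assumes "trail f x n = Some (y, s)"
  shows "trail f x (Suc n) = (let A = hits (wlab f) (later f s) {y}; t = least_pos f A in
    if A = {} then None else Some (THE z. {y, z} = {fst (wlab f t), snd (wlab f t)}, Some t))"
proof -
  have "{t \<in> touching y f. case s of None \<Rightarrow> True | Some s' \<Rightarrow> (s', t) \<in> wle f \<and> s' \<noteq> t} =
      hits (wlab f) (later f s) {y}"
    by (auto simp: touching_eq hits_def later_def)
  then show ?thesis using assms by (simp only: trail.simps(2) option.case prod.case)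
qed

lemma trail_None: "trail f x n = None \<Longrightarrow> trail f x (n + k) = None"
  by (induction k) auto

declare trail.simps(2) [simp del]

lemma trail_step:
  assumes "trail f x n = Some (y, s)" "lin_on (wpos f) (wle f)"
    "t \<in> hits (wlab f) (later f s) {y}" "\<And>u. u \<in> hits (wlab f) (later f s) {y} \<Longrightarrow> (t, u) \<in> wle f"
  shows "trail f x (Suc n) = Some (other y (wlab f t), Some t)"
proof -
  have "least_pos f (hits (wlab f) (later f s) {y}) = t"
    by (rule least_pos_eq [OF assms(2) order_trans [OF hits_subset later_subset] assms(3,4)])
  moreover have "y \<in> pts (wlab f t)" using assms(3) by (simp add: hits_def)
  ultimately show ?thesis
    using assms(3) by (auto simp: trail_Suc [OF assms(1)] Let_def the_other)
qed

lemma trail_stop: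
  "trail f x n = Some (y, s) \<Longrightarrow> hits (wlab f) (later f s) {y} = {} \<Longrightarrow> trail f x (Suc n) = None"
  by (simp add: trail_Suc Let_def)

text \<open>The derivation of the orbit is replayed by the recursive trail. The stage
  \<open>n\<close> and last position \<open>s\<close> are arbitrary, since the induction continues
  from the middle of a trail.\<close>

lemma orbit_trail:
  assumes "orbit (wle f) (wlab f) P y V w" "lin_on (wpos f) (wle f)" "P = later f s"
    "trail f x n = Some (y, s)" "\<And>s'. s = Some s' \<Longrightarrow> s' \<in> wpos f"
  shows "\<exists>m s'. trail f x (n + m) = Some (w, s') \<and> trail f x (Suc (n + m)) = None"
  using assms
proof (induction arbitrary: n s rule: orbit.induct)
  case (stop P y)
  then show ?case using trail_stop [of f x n y s] by (metis add_0_right)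
next
  case (step t P y V w)
  have t: "t \<in> later f s" "t \<in> wpos f"
    using step.hyps(1) later_subset [of f s] by (auto simp: hits_def step.prems(2))
  have eq: "{u \<in> P. (t, u) \<in> wle f \<and> u \<noteq> t} = later f (Some t)"
    unfolding step.prems(2) by (rule later_Some [OF step.prems(1) t(1) step.prems(4), symmetric])
  have "trail f x (Suc n) = Some (other y (wlab f t), Some t)"
    by (rule trail_step [OF step.prems(3,1)]) (use step.hyps step.prems(2) in auto)
  from step.IH [OF step.prems(1) eq this] t(2)
  obtain m s' where "trail f x (Suc n + m) = Some (w, s')" "trail f x (Suc (Suc n + m)) = None"
    by auto
  then show ?case by (intro exI [of _ "Suc m"] exI [of _ s']) simp
qed

text \<open>Induction on the number \<open>k\<close> of stages left. Finiteness of the hits is what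
  guarantees that the definite description in \<open>least_pos\<close> denotes an actual least
  position.\<close>

lemma trail_orbit:
  assumes "trail f x n = Some (y, s)" "trail f x (Suc (n + k)) = None"
    and lin: "lin_on (wpos f) (wle f)" and "\<And>s'. s = Some s' \<Longrightarrow> s' \<in> wpos f"
    and fin: "\<And>x. x \<in> X \<Longrightarrow> finite (hits (wlab f) (wpos f) {x})"
    and X: "\<And>u. u \<in> wpos f \<Longrightarrow> pts (wlab f u) \<subseteq> X" and "y \<in> X"
  shows "\<exists>V w. orbit (wle f) (wlab f) (later f s) y V w"
  using assms(1,2,4,7)
proof (induction k arbitrary: n y s)
  case (0 n y s)
  let ?A = "hits (wlab f) (later f s) {y}"
  have A: "?A \<subseteq> wpos f" "finite ?A"
    using later_subset [of f s] finite_subset [OF _ fin [OF 0(4)], of ?A] by (auto simp: hits_def)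
  \<comment> \<open>A remaining hit would include a first one, and the trail would continue to stage
    \<open>Suc n\<close>.\<close>
  have "?A = {}"
  proof (rule ccontr)
    assume ne: "?A \<noteq> {}"
    obtain t where t: "t \<in> ?A" "\<And>u. u \<in> ?A \<Longrightarrow> (t, u) \<in> wle f"
      using finite_least [OF lin A ne] by blast
    show False using trail_step [OF 0(1) lin t] 0(2) by simp
  qed
  then show ?case using orbit.stop [of "wlab f" "later f s" y "wle f"] by (intro exI)
next
  case (Suc k n y s)
  let ?A = "hits (wlab f) (later f s) {y}"
  have A: "?A \<subseteq> wpos f" "finite ?A"
    using later_subset [of f s] finite_subset [OF _ fin [OF Suc(5)], of ?A] by (auto simp: hits_def)
  show ?case
  proof (cases "?A = {}")
    case True
    then show ?thesis using orbit.stop [of "wlab f" "later f s" y "wle f"] by (intro exI)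
  next
    case False
    obtain t where t: "t \<in> ?A" "\<And>u. u \<in> ?A \<Longrightarrow> (t, u) \<in> wle f"
      using finite_least [OF lin A False] by blast
    have tP: "t \<in> wpos f" "t \<in> later f s" using t(1) A(1) by (auto simp: hits_def)
    have "other y (wlab f t) \<in> X" using X [OF tP(1)] other_in_pts [of y "wlab f t"] by blast
    then obtain V w where "orbit (wle f) (wlab f) (later f (Some t)) (other y (wlab f t)) V w"
      using Suc.IH [OF trail_step [OF Suc(2) lin t]] Suc(3) tP(1) by auto
    then have "orbit (wle f) (wlab f) {u \<in> later f s. (t, u) \<in> wle f \<and> u \<noteq> t} (other y (wlab f t)) V w"
      by (subst later_Some [OF lin tP(2) Suc(4), symmetric])
    with t have "orbit (wle f) (wlab f) (later f s) y (insert y V) w"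
      by (intro orbit.step [of t]) auto
    then show ?thesis by (intro exI)
  qed
qed

text \<open>Once a trail is \<open>None\<close> it stays \<open>None\<close>, so the stage at which
  the orbit stops is the least one demanded by \<open>n_plus\<close>.\<close>

lemma orbit_x_infty:
  assumes "orbit (wle f) (wlab f) (wpos f) x V w" "lin_on (wpos f) (wle f)"
  shows "n_plus f x < \<infinity>" "x_infty f x = w"
proof -
  obtain m s where m: "trail f x m = Some (w, s)" "trail f x (Suc m) = None"
    using orbit_trail [OF assms, of None x 0] by auto
  have "(LEAST n. trail f x (Suc n) = None) = m"
  proof (rule Least_equality [where P = "\<lambda>n. trail f x (Suc n) = None"])
    fix k assume k: "trail f x (Suc k) = None"
    show "m \<le> k"
    proof (rule ccontr)
      assume "\<not> m \<le> k"
      then have "m = Suc k + (m - Suc k)" by simp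
      then show False using trail_None [OF k, of "m - Suc k"] m(1) by simp
    qed
  qed (rule m(2))
  moreover have "\<exists>n. trail f x (Suc n) = None" using m(2) by (rule exI)
  ultimately have "n_plus f x = enat m" unfolding n_plus_def by (simp only: if_True)
  then show "n_plus f x < \<infinity>" "x_infty f x = w" using m(1) by (simp_all add: x_infty_def)
qed

lemma n_plus_iff:
  assumes "lin_on (wpos f) (wle f)"
    and "\<And>x. x \<in> X \<Longrightarrow> finite (hits (wlab f) (wpos f) {x})"
    and "\<And>u. u \<in> wpos f \<Longrightarrow> pts (wlab f u) \<subseteq> X" and "x \<in> X"
  shows "n_plus f x < \<infinity> \<longleftrightarrow> (\<exists>V w. orbit (wle f) (wlab f) (wpos f) x V w)"
proof
  assume "n_plus f x < \<infinity>"
  then obtain n where "trail f x (Suc (0 + n)) = None"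
    by (auto simp: n_plus_def split: if_splits)
  from trail_orbit [OF _ this assms(1) _ assms(2,3,4), of None]
  show "\<exists>V w. orbit (wle f) (wlab f) (wpos f) x V w" by simp
qed (use orbit_x_infty [OF _ assms(1)] in blast)

text \<open>From here on the step counters are replaced by the existence of orbits in both
  directions, which is easier to glue and restrict.\<close>

lemma wordsS_iff:
  "f \<in> wordsS X \<longleftrightarrow> f \<in> words (transp_letters X) \<and> tame X (wle f) (wlab f) (wpos f)"
proof (cases "f \<in> words (transp_letters X) \<and> (\<forall>x\<in>X. finite (hits (wlab f) (wpos f) {x}))")
  case True
  note f = word_overD [OF conjunct1 [OF True, unfolded words_iff]]
  have X: "pts (wlab f u) \<subseteq> X" if "u \<in> wpos f" for u
    using f(3) [OF that] by (simp add: pts_transp)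
  have "n_plus f x < \<infinity> \<longleftrightarrow> (\<exists>V w. orbit (wle f) (wlab f) (wpos f) x V w)" if "x \<in> X" for x
    using n_plus_iff [OF f(1) _ X that] True by simp
  moreover have "n_minus f x < \<infinity> \<longleftrightarrow> (\<exists>V w. orbit ((wle f)\<inverse>) (wlab f) (wpos f) x V w)"
    if "x \<in> X" for x
    using n_plus_iff [of "word_rev f" X x] lin_on_converse [OF f(1)] X that True
    by (simp add: n_minus_def word_rev_def)
  ultimately show ?thesis
    using True by (auto simp: wordsS_def words0_def touching_eq tame_def)
next
  case False
  then show ?thesis by (auto simp: wordsS_def words0_def touching_eq tame_def)
qed

section \<open>The admissible sets of words\<close>

lemma tame_rel_cong:
  "tame X r lab P \<Longrightarrow> (\<And>s t. s \<in> P \<Longrightarrow> t \<in> P \<Longrightarrow> (s, t) \<in> r \<longleftrightarrow> (s, t) \<in> r') \<Longrightarrow>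
    (\<And>s. s \<in> P \<Longrightarrow> pts (lab' s) = pts (lab s)) \<Longrightarrow> tame X r' lab' P"
  using tame_transport [of X r lab P id r' lab'] by simp

lemma orbit_rel_cong:
  "orbit r lab P y V w \<Longrightarrow> (\<And>s t. s \<in> P \<Longrightarrow> t \<in> P \<Longrightarrow> (s, t) \<in> r \<longleftrightarrow> (s, t) \<in> r') \<Longrightarrow>
    (\<And>s. s \<in> P \<Longrightarrow> pts (lab' s) = pts (lab s)) \<Longrightarrow> orbit r' lab' P y V w"
  using orbit_transport [of r lab P y V w id r' lab'] by simp

lemma orbit_iso:
  assumes "word_iso f g" "orbit (wle f) (wlab f) (wpos f) x V w"
  shows "orbit (wle g) (wlab g) (wpos g) x V w"
proof -
  obtain \<phi> where \<phi>: "bij_betw \<phi> (wpos f) (wpos g)" "inj_on \<phi> (wpos f)" "\<phi> ` wpos f = wpos g"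
    "\<And>s t. s \<in> wpos f \<Longrightarrow> t \<in> wpos f \<Longrightarrow> (s, t) \<in> wle f \<longleftrightarrow> (\<phi> s, \<phi> t) \<in> wle g"
    "\<And>s. s \<in> wpos f \<Longrightarrow> wlab g (\<phi> s) = wlab f s"
    by (fact word_isoE [OF assms(1)])
  show ?thesis
    using orbit_transport [OF assms(2) \<phi>(2,4), of "wlab g"] \<phi>(5) by (simp add: \<phi>(3))
qed

text \<open>Tameness of sets of positions replaces membership of restricted words, so the order and
  the labels of \<open>f\<close> itself can be kept on every interval.\<close>

definition interval_tame :: "'x set \<Rightarrow> ('s, 'x \<times> 'x) tword \<Rightarrow> bool" where
  "interval_tame X f \<longleftrightarrow> (\<forall>I. word_interval f I \<longrightarrow> tame X (wle f) (wlab f) I)"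

lemma word_intervalD:
  "word_interval f I \<Longrightarrow> s \<in> I \<Longrightarrow> t \<in> I \<Longrightarrow> u \<in> wpos f \<Longrightarrow> (s, u) \<in> wle f \<Longrightarrow> (u, t) \<in> wle f \<Longrightarrow> u \<in> I"
  unfolding word_interval_def seg_def by blast

lemma word_intervalI:
  assumes "I \<subseteq> wpos f"
    and "\<And>s t u. s \<in> I \<Longrightarrow> t \<in> I \<Longrightarrow> u \<in> wpos f \<Longrightarrow> (s, u) \<in> wle f \<Longrightarrow> (u, t) \<in> wle f \<Longrightarrow> u \<in> I"
  shows "word_interval f I"
  using assms unfolding word_interval_def seg_def by blast

lemma word_interval_subset: "word_interval f I \<Longrightarrow> I \<subseteq> wpos f"
  by (simp add: word_interval_def)

lemma interval_tameD: "interval_tame X f \<Longrightarrow> tame X (wle f) (wlab f) (wpos f)"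
  by (simp add: interval_tame_def word_interval_def seg_def)

lemma wordsS'_iff: "f \<in> wordsS' X \<longleftrightarrow> f \<in> words (transp_letters X) \<and> interval_tame X f"
proof -
  have "word_restrict f I \<in> wordsS X \<longleftrightarrow> tame X (wle f) (wlab f) I"
    if f: "f \<in> words (transp_letters X)" and I: "word_interval f I" for I
  proof -
    have "word_restrict f I \<in> words (transp_letters X)"
      using f word_over_restrict unfolding words_iff by blast
    moreover have "wpos f \<inter> I = I" using word_interval_subset [OF I] by blast
    moreover have "tame X (wle f \<inter> I \<times> I) (wlab f) I \<longleftrightarrow> tame X (wle f) (wlab f) I"
    proof
      show "tame X (wle f) (wlab f) I" if "tame X (wle f \<inter> I \<times> I) (wlab f) I"
        using that by (rule tame_rel_cong) auto
      show "tame X (wle f \<inter> I \<times> I) (wlab f) I" if "tame X (wle f) (wlab f) I"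
        using that by (rule tame_rel_cong) auto
    qed
    ultimately show ?thesis by (simp add: wordsS_iff)
  qed
  then show ?thesis by (auto simp: wordsS'_def interval_tame_def)
qed

lemma wordsS'_subset: "wordsS' X \<subseteq> wordsS X"
  using interval_tameD by (auto simp: wordsS'_iff wordsS_iff)

lemma wordsS_words: "wordsS X \<subseteq> words (transp_letters X)"
  by (auto simp: wordsS_iff)

lemma tame_iso:
  assumes "word_iso f g" "tame X (wle f) (wlab f) (wpos f)"
  shows "tame X (wle g) (wlab g) (wpos g)"
proof -
  obtain \<phi> where \<phi>: "bij_betw \<phi> (wpos f) (wpos g)" "inj_on \<phi> (wpos f)" "\<phi> ` wpos f = wpos g"
    "\<And>s t. s \<in> wpos f \<Longrightarrow> t \<in> wpos f \<Longrightarrow> (s, t) \<in> wle f \<longleftrightarrow> (\<phi> s, \<phi> t) \<in> wle g"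
    "\<And>s. s \<in> wpos f \<Longrightarrow> wlab g (\<phi> s) = wlab f s"
    by (fact word_isoE [OF assms(1)])
  show ?thesis
    using tame_transport [OF assms(2) \<phi>(2,4), of "wlab g"] \<phi>(5) by (simp add: \<phi>(3))
qed

lemma interval_tame_iso:
  assumes "word_iso f g" "interval_tame X f"
  shows "interval_tame X g"
  unfolding interval_tame_def
proof (intro allI impI)
  fix J assume J: "word_interval g J"
  obtain \<phi> where \<phi>: "bij_betw \<phi> (wpos f) (wpos g)" "inj_on \<phi> (wpos f)" "\<phi> ` wpos f = wpos g"
    "\<And>s t. s \<in> wpos f \<Longrightarrow> t \<in> wpos f \<Longrightarrow> (s, t) \<in> wle f \<longleftrightarrow> (\<phi> s, \<phi> t) \<in> wle g"
    "\<And>s. s \<in> wpos f \<Longrightarrow> wlab g (\<phi> s) = wlab f s"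
    by (fact word_isoE [OF assms(1)])
  define I where "I = {s \<in> wpos f. \<phi> s \<in> J}"
  have I: "I \<subseteq> wpos f" "\<phi> ` I = J"
    using word_interval_subset [OF J] \<phi>(3) by (auto simp: I_def)
  have "word_interval f I"
  proof (rule word_intervalI [OF I(1)])
    fix s t u assume *: "s \<in> I" "t \<in> I" "u \<in> wpos f" "(s, u) \<in> wle f" "(u, t) \<in> wle f"
    then have "s \<in> wpos f" "t \<in> wpos f" "\<phi> s \<in> J" "\<phi> t \<in> J" by (auto simp: I_def)
    then have "\<phi> u \<in> J"
      using word_intervalD [OF J, of "\<phi> s" "\<phi> t" "\<phi> u"] * \<phi>(4) [of s u] \<phi>(4) [of u t] \<phi>(3) by blast
    then show "u \<in> I" using *(3) by (simp add: I_def)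
  qed
  then have "tame X (wle f) (wlab f) I" using assms(2) by (simp add: interval_tame_def)
  from tame_transport [OF this, of \<phi> "wle g" "wlab g"]
  show "tame X (wle g) (wlab g) J"
    using \<phi>(2,4,5) I by (auto simp: inj_on_subset subset_iff)
qed

lemma word_sum_order:
  "p \<in> Inl ` P \<Longrightarrow> q \<in> Inr ` Q \<Longrightarrow> P \<subseteq> wpos f \<Longrightarrow> Q \<subseteq> wpos g \<Longrightarrow>
    (p, q) \<in> wle (word_sum f g) \<and> p \<noteq> q"
  by auto

lemma tame_sum:
  assumes o: "word_over (transp_letters X) f" "word_over (transp_letters X) g"
    and "P \<subseteq> wpos f" "Q \<subseteq> wpos g" "tame X (wle f) (wlab f) P" "tame X (wle g) (wlab g) Q"
  shows "tame X (wle (word_sum f g)) (wlab (word_sum f g)) (P <+> Q)"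
  unfolding Plus_def
proof (rule tame_union)
  note s = word_over_sum [OF o]
  have sub: "Inl ` P \<union> Inr ` Q \<subseteq> wpos (word_sum f g)" using assms(3,4) by auto
  show "tame X (wle (word_sum f g)) (wlab (word_sum f g)) (Inl ` P)"
    by (rule tame_transport [OF assms(5)]) auto
  show "tame X (wle (word_sum f g)) (wlab (word_sum f g)) (Inr ` Q)"
    by (rule tame_transport [OF assms(6)]) auto
  show "lin_on (Inl ` P \<union> Inr ` Q) (wle (word_sum f g))"
    by (rule lin_on_subset [OF word_overD(1) [OF s] sub])
  show "(p, q) \<in> wle (word_sum f g) \<and> p \<noteq> q" if "p \<in> Inl ` P" "q \<in> Inr ` Q" for p q
    using word_sum_order [OF that assms(3,4)] .
  show "pts (wlab (word_sum f g) u) \<subseteq> X" if "u \<in> Inl ` P \<union> Inr ` Q" for u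
    using word_overD(3) [OF s subsetD [OF sub that]] by (simp add: pts_transp)
qed

text \<open>An interval of the sum is an interval of \<open>f\<close> followed by an interval of
  \<open>g\<close>, to which \<open>tame_sum\<close> applies.\<close>

lemma interval_tame_sum:
  assumes o: "word_over (transp_letters X) f" "word_over (transp_letters X) g"
    and "interval_tame X f" "interval_tame X g"
  shows "interval_tame X (word_sum f g)"
  unfolding interval_tame_def
proof (intro allI impI)
  fix J assume J: "word_interval (word_sum f g) J"
  let ?P = "Inl -` J" and ?Q = "Inr -` J"
  note sub = word_interval_subset [OF J]
  have P: "word_interval f ?P"
  proof (rule word_intervalI)
    show "?P \<subseteq> wpos f" using sub by auto
    show "u \<in> ?P" if "s \<in> ?P" "t \<in> ?P" "u \<in> wpos f" "(s, u) \<in> wle f" "(u, t) \<in> wle f" for s t u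
      using word_intervalD [OF J, of "Inl s" "Inl t" "Inl u"] that by auto
  qed
  have Q: "word_interval g ?Q"
  proof (rule word_intervalI)
    show "?Q \<subseteq> wpos g" using sub by auto
    show "u \<in> ?Q" if "s \<in> ?Q" "t \<in> ?Q" "u \<in> wpos g" "(s, u) \<in> wle g" "(u, t) \<in> wle g" for s t u
      using word_intervalD [OF J, of "Inr s" "Inr t" "Inr u"] that by auto
  qed
  have "tame X (wle (word_sum f g)) (wlab (word_sum f g)) (?P <+> ?Q)"
    using tame_sum [OF o word_interval_subset [OF P] word_interval_subset [OF Q]] P Q assms(3,4)
    by (simp add: interval_tame_def)
  moreover have "?P <+> ?Q = J"
  proof (rule Set.set_eqI)
    fix s show "s \<in> ?P <+> ?Q \<longleftrightarrow> s \<in> J" by (cases s) auto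
  qed
  ultimately show "tame X (wle (word_sum f g)) (wlab (word_sum f g)) J" by simp
qed

lemma tame_bar:
  "tame X (wle f) (wlab f) I \<Longrightarrow> tame X (wle (word_bar prod.swap f)) (wlab (word_bar prod.swap f)) I"
  using tame_rel_cong [OF tame_converse, of X "wle f" "wlab f" I "(wle f)\<inverse>" "prod.swap \<circ> wlab f"]
  by simp

lemma word_interval_bar: "word_interval (word_bar \<iota> f) I \<Longrightarrow> word_interval f I"
  by (rule word_intervalI) (use word_interval_subset in fastforce, auto dest: word_intervalD)

lemma interval_tame_bar: "interval_tame X f \<Longrightarrow> interval_tame X (word_bar prod.swap f)"
  unfolding interval_tame_def by (blast intro: tame_bar word_interval_bar)

text \<open>
  A word obtained by cancellation has its intervals \<open>J\<close> inside the convex hulls \<open>I\<close> of \<open>J\<close> in the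
  original word; \<open>t \<in> T \<inter> I\<close> forces \<open>star t \<in> I\<close>, as the points of \<open>J\<close> around \<open>t\<close> are not in \<open>T\<close>.
\<close>

lemma interval_tame_cancels:
  assumes f: "word_over (transp_letters X) f" and "interval_tame X f" "cancels prod.swap f g"
  shows "interval_tame X g"
proof -
  obtain T star where c: "cancelling prod.swap (wle f) (wlab f) (wpos f) T star"
    and iso: "word_iso (word_restrict f (wpos f - T)) g"
    using assms(3) unfolding cancels_iff by blast
  note lin = word_overD(1) [OF f]
  have "tame X (wle f) (wlab f) J" if J: "word_interval (word_restrict f (wpos f - T)) J" for J
  proof -
    have JT: "J \<subseteq> wpos f - T" using word_interval_subset [OF J] by auto
    define I where "I = {s \<in> wpos f. (\<exists>a\<in>J. (a, s) \<in> wle f) \<and> (\<exists>b\<in>J. (s, b) \<in> wle f)}"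
    have IP: "I \<subseteq> wpos f" by (auto simp: I_def)
    have "word_interval f I"
    proof (rule word_intervalI [OF IP])
      fix s t u assume *: "s \<in> I" "t \<in> I" "u \<in> wpos f" "(s, u) \<in> wle f" "(u, t) \<in> wle f"
      then obtain a b where ab: "a \<in> J" "(a, s) \<in> wle f" "b \<in> J" "(t, b) \<in> wle f"
        by (auto simp: I_def)
      then have "(a, u) \<in> wle f" "(u, b) \<in> wle f"
        using lin_on_trans [OF lin, of a s u] lin_on_trans [OF lin, of u t b] * JT IP by blast+
      then show "u \<in> I" using ab *(3) by (auto simp: I_def)
    qed
    then have tI: "tame X (wle f) (wlab f) I" using assms(2) by (simp add: interval_tame_def)
    have "star t \<in> I" if t: "t \<in> T" "t \<in> I" for t
    proof -
      note st = cancellingD [OF c t(1)]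
      obtain a b where ab: "a \<in> J" "(a, t) \<in> wle f" "b \<in> J" "(t, b) \<in> wle f"
        using t(2) by (auto simp: I_def)
      have abP: "a \<in> wpos f" "b \<in> wpos f" "a \<notin> T" "b \<notin> T" using ab JT by auto
      \<comment> \<open>Otherwise \<open>b\<close> would lie in the segment from \<open>t\<close> to
        \<open>star t\<close>, hence in \<open>T\<close>.\<close>
      have "(star t, b) \<in> wle f"
      proof (rule ccontr)
        assume "(star t, b) \<notin> wle f"
        then have "(b, star t) \<in> wle f" using lin_on_total [OF lin abP(2) st(5)] by blast
        then show False using cancelling_seg(1) [OF c t(1) abP(2) ab(4)] abP by blast
      qed
      \<comment> \<open>The mirror image, using the segment that starts at \<open>star t\<close> and
        ends at \<open>star (star t) = t\<close>.\<close>
      moreover have "(a, star t) \<in> wle f"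
      proof (rule ccontr)
        assume "(a, star t) \<notin> wle f"
        then have "(star t, a) \<in> wle f" using lin_on_total [OF lin abP(1) st(5)] by blast
        then show False
          using cancelling_seg(1) [OF c st(1) abP(1)] ab(2) abP st(2) by simp
      qed
      ultimately show ?thesis using ab st by (auto simp: I_def)
    qed
    then have "cancelling prod.swap (wle f) (wlab f) I (T \<inter> I) star"
      by (rule cancelling_subset [OF c IP])
    then have "tame X (wle f) (wlab f) (I - T \<inter> I)"
      by (rule tame_cancelling [OF tI lin_on_subset [OF lin IP]])
        (use word_overD(3) [OF f] IP in blast)
    moreover have "I - T \<inter> I = J"
    proof
      show "I - T \<inter> I \<subseteq> J"
      proof
        fix u assume u: "u \<in> I - T \<inter> I"
        then obtain a b where ab: "a \<in> J" "(a, u) \<in> wle f" "b \<in> J" "(u, b) \<in> wle f"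
          by (auto simp: I_def)
        show "u \<in> J"
          by (rule word_intervalD [OF J ab(1,3)]) (use u ab JT IP in auto)
      qed
      show "J \<subseteq> I - T \<inter> I"
        using JT lin_on_refl [OF lin] by (auto simp: I_def)
    qed
    ultimately show ?thesis by simp
  qed
  then have "tame X (wle (word_restrict f (wpos f - T))) (wlab (word_restrict f (wpos f - T))) J"
    if "word_interval (word_restrict f (wpos f - T)) J" for J
    using that word_interval_subset [OF that]
    by (auto intro: tame_rel_cong [of X "wle f" "wlab f" J])
  then show ?thesis
    by (intro interval_tame_iso [OF iso]) (simp add: interval_tame_def)
qed

lemma interval_tame_finite:
  assumes "word_over L f" "finite (wpos f)"
  shows "interval_tame X f"
  unfolding interval_tame_def
  using assms tame_finite lin_on_subset word_overD(1) word_interval_subset finite_subset by metis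

lemma free_involution_transp: "free_involution (transp_letters X) prod.swap"
  by (auto simp: free_involution_def transp_letters_def)

lemma wordsS_system: "word_system (transp_letters X) prod.swap (wordsS X)"
proof
  fix f g assume fg: "f \<in> wordsS X" "g \<in> wordsS X"
  note o = fg [unfolded wordsS_iff words_iff]
  have "tame X (wle (word_sum f g)) (wlab (word_sum f g)) (wpos (word_sum f g))"
    using tame_sum [of X f g "wpos f" "wpos g"] o by simp
  then show "word_cat f g \<in> wordsS X"
    using tame_iso [OF word_cat_iso] o by (auto simp: wordsS_iff words_iff [symmetric])
next
  fix f assume f: "f \<in> wordsS X"
  then show "word_bar prod.swap f \<in> wordsS X"
    using tame_bar [of X f "wpos f"] word_over_bar [OF _ free_involution_transp, of X f]
    by (simp add: wordsS_iff words_iff)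
qed (use empty_word_over free_involution_transp in \<open>auto simp: wordsS_iff words_iff empty_word_def
    intro!: tame_finite simp: lin_on_def\<close>)

lemma wordsS'_system: "word_system (transp_letters X) prod.swap (wordsS' X)"
proof
  fix f g assume fg: "f \<in> wordsS' X" "g \<in> wordsS' X"
  note o = fg [unfolded wordsS'_iff words_iff]
  have "interval_tame X (word_sum f g)"
    using interval_tame_sum [of X f g] o by simp
  then show "word_cat f g \<in> wordsS' X"
    using interval_tame_iso [OF word_cat_iso] o by (auto simp: wordsS'_iff words_iff [symmetric])
next
  fix f assume f: "f \<in> wordsS' X"
  then show "word_bar prod.swap f \<in> wordsS' X"
    using interval_tame_bar [of X f] word_over_bar [OF _ free_involution_transp, of X f]
    by (simp add: wordsS'_iff words_iff)
next
  show "empty_word \<in> wordsS' X"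
    using interval_tame_finite [OF empty_word_over, of X] empty_words [of "transp_letters X"]
    by (simp add: wordsS'_iff) (simp add: empty_word_def)
qed (use free_involution_transp in \<open>auto simp: wordsS'_iff\<close>)

lemma wordsS'_admissible: "admissible_words (transp_letters X) prod.swap (wordsS' X)"
proof -
  interpret word_system "transp_letters X" prod.swap "wordsS' X" by (rule wordsS'_system)
  show ?thesis
    unfolding admissible_words_def using sub cat bar interval_tame_cancels
    by (auto simp: wordsS'_iff words_iff)
qed

section \<open>Invariance of the end point\<close>

lemma finite_words_finite:
  assumes "f \<in> words A" "finite A"
  shows "finite (wpos f)"
proof -
  note f = word_overD [OF assms(1) [unfolded words_iff]]
  have "wpos f \<subseteq> (\<Union>l\<in>A. {s \<in> wpos f. wlab f s = l})" using f(3) by auto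
  moreover have "finite (\<Union>l\<in>A. {s \<in> wpos f. wlab f s = l})" using f(4) assms(2) by blast
  ultimately show ?thesis by (rule finite_subset)
qed

definition ends :: "('s, 'x \<times> 'x) tword \<Rightarrow> 'x \<Rightarrow> 'x \<Rightarrow> bool" where
  "ends f x w \<longleftrightarrow> (\<exists>V. orbit (wle f) (wlab f) (wpos f) x V w)"

lemma ends_unique: "word_over L f \<Longrightarrow> ends f x w \<Longrightarrow> ends f x w' \<Longrightarrow> w = w'"
  unfolding ends_def using orbit_det word_overD(1) by metis

text \<open>Cancellation is followed only from \<open>f\<close> to \<open>g\<close>. Conversely, the
  finite word \<open>f\<close> has some end point from \<open>x\<close>; it is carried over to
  \<open>g\<close>, where it must be the given one.\<close>

lemma ends_cancels:
  assumes f: "f \<in> words A" and g: "g \<in> words A" and A: "finite A" "A \<subseteq> transp_letters X"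
    and "cancels prod.swap f g"
  shows "ends f x w \<longleftrightarrow> ends g x w"
proof -
  note F = word_overD [OF f [unfolded words_iff]]
  obtain T star where c: "cancelling prod.swap (wle f) (wlab f) (wpos f) T star"
    and iso: "word_iso (word_restrict f (wpos f - T)) g"
    using assms(5) unfolding cancels_iff by blast
  have ne: "fst (wlab f t) \<noteq> snd (wlab f t)" if "t \<in> wpos f" for t
    using F(3) [OF that] A(2) by (auto simp: pts_transp)
  have fg: "ends g x w" if e: "ends f x w" for w
  proof -
    obtain V where "orbit (wle f) (wlab f) (wpos f) x V w" using e by (auto simp: ends_def)
    then obtain V' where "orbit (wle f) (wlab f) (wpos f - T) x V' w"
      using orbit_cancelling [OF finite_words_finite [OF f A(1)] F(1) c ne] by blast
    then have "orbit (wle f \<inter> (wpos f - T) \<times> (wpos f - T)) (wlab f) (wpos f - T) x V' w"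
      by (rule orbit_rel_cong) auto
    moreover have "wpos f \<inter> (wpos f - T) = wpos f - T" by auto
    ultimately show ?thesis
      using orbit_iso [OF iso, of x V' w] by (auto simp: ends_def)
  qed
  moreover have "ends f x w" if "ends g x w"
  proof -
    obtain w' where "ends f x w'"
      using finite_orbit_exists [OF finite_words_finite [OF f A(1)] F(1)] unfolding ends_def by metis
    then show ?thesis using fg [of w'] ends_unique [OF g [unfolded words_iff] that] by auto
  qed
  ultimately show ?thesis by blast
qed

lemma ends_equiv_finite:
  assumes "word_equiv A prod.swap f g" "finite A" "A \<subseteq> transp_letters X"
  shows "\<forall>w. ends f x w \<longleftrightarrow> ends g x w"
  using assms(1)
proof (rule word_equiv_lift)
  fix f g assume "f \<in> words A" "g \<in> words A" "cancels prod.swap f g"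
  from ends_cancels [OF this(1,2) assms(2,3) this(3)]
  show "\<forall>w. ends f x w \<longleftrightarrow> ends g x w" by blast
qed simp_all

lemma orbit_proj:
  assumes "orbit (wle f) (wlab f) (wpos f) x V w" "wlab f ` hits (wlab f) (wpos f) V \<subseteq> A"
  shows "orbit (wle (word_proj A f)) (wlab (word_proj A f)) (wpos (word_proj A f)) x V w"
proof -
  have "orbit (wle f) (wlab f) (wpos f \<inter> wlab f -` A) x V w"
    by (rule orbit_restrict [OF assms(1)]) (use assms(2) hits_subset [of "wlab f" "wpos f" V] in auto)
  then show ?thesis unfolding word_proj_def word_restrict_sel
    by (rule orbit_rel_cong) auto
qed

lemma finite_hits_tame:
  assumes "tame X r lab P" "V \<subseteq> X" "finite V"
  shows "finite (hits lab P V)"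
  by (rule finite_hits) (use assms in \<open>auto simp: tame_def\<close>)

lemma word_over_pts: "word_over (transp_letters X) f \<Longrightarrow> s \<in> wpos f \<Longrightarrow> pts (wlab f s) \<subseteq> X"
  using word_overD(3) [of "transp_letters X" f s] by (simp add: pts_transp)

lemma wordsS_over: "f \<in> wordsS X \<Longrightarrow> word_over (transp_letters X) f"
  by (simp add: wordsS_iff words_iff)

text \<open>
  Both trails only meet letters from a finite set \<open>A\<close>, and all words over \<open>A\<close>, including those of a
  chain of cancellations between the projections to \<open>A\<close>, are finite.
\<close>

lemma ends_equiv:
  assumes f: "f \<in> wordsS X" and g: "g \<in> wordsS X" and "word_equiv (transp_letters X) prod.swap f g"
    and "x \<in> X" "ends f x w" "ends g x w'"
  shows "w = w'"
proof -
  obtain V V' where V: "orbit (wle f) (wlab f) (wpos f) x V w"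
    "orbit (wle g) (wlab g) (wpos g) x V' w'"
    using assms(5,6) by (auto simp: ends_def)
  note o = f [unfolded wordsS_iff words_iff] g [unfolded wordsS_iff words_iff]
  have VX: "V \<subseteq> X" "V' \<subseteq> X"
    using orbit_subset [OF V(1) assms(4)] orbit_subset [OF V(2) assms(4)]
      word_over_pts [OF wordsS_over [OF f]] word_over_pts [OF wordsS_over [OF g]] by blast+
  define B where "B = wlab f ` hits (wlab f) (wpos f) V \<union> wlab g ` hits (wlab g) (wpos g) V'"
  \<comment> \<open>\<open>B\<close> consists of the letters met by the two trails; it is closed
    under inversion so that cancellations project to \<open>A\<close>.\<close>
  define A where "A = B \<union> prod.swap ` B"
  have "finite (hits (wlab f) (wpos f) V)" "finite (hits (wlab g) (wpos g) V')"
    using finite_hits_tame [OF conjunct2 [OF o(1)] VX(1)] finite_hits_tame [OF conjunct2 [OF o(2)] VX(2)]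
      orbit_in [OF V(1)] orbit_in [OF V(2)] by auto
  then have "finite B" by (simp add: B_def)
  then have "finite A" by (simp add: A_def)
  have "B \<subseteq> transp_letters X"
    using word_overD(3) [OF wordsS_over [OF f]] word_overD(3) [OF wordsS_over [OF g]]
    by (auto simp: B_def hits_def)
  then have A: "A \<subseteq> transp_letters X" by (auto simp: A_def transp_letters_def)
  have "word_equiv A prod.swap (word_proj A f) (word_proj A g)"
    by (rule word_proj_equiv [OF assms(3) A]) (auto simp: A_def)
  from ends_equiv_finite [OF this \<open>finite A\<close> A]
  have "ends (word_proj A f) x w \<longleftrightarrow> ends (word_proj A g) x w" by blast
  moreover have "ends (word_proj A f) x w" "ends (word_proj A g) x w'"
    using orbit_proj [OF V(1), of A] orbit_proj [OF V(2), of A] by (auto simp: ends_def A_def B_def)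
  ultimately show ?thesis
    using ends_unique [OF word_proj_over [OF _ A]] o by blast
qed

lemma x_infty_ends: "word_over L f \<Longrightarrow> ends f x w \<Longrightarrow> x_infty f x = w"
  unfolding ends_def using orbit_x_infty(2) word_overD(1) by metis

lemma ends_x_infty:
  assumes "f \<in> wordsS X" "x \<in> X"
  shows "ends f x (x_infty f x)" "x_infty f x \<in> X"
proof -
  note o = assms(1) [unfolded wordsS_iff words_iff]
  obtain V w where V: "orbit (wle f) (wlab f) (wpos f) x V w"
    using o assms(2) by (auto simp: tame_def)
  then have *: "ends f x w" by (auto simp: ends_def)
  then show "ends f x (x_infty f x)" using x_infty_ends o by metis
  have "V \<subseteq> X" using orbit_subset [OF V assms(2)] word_over_pts [OF wordsS_over [OF assms(1)]] by blast
  then show "x_infty f x \<in> X" using orbit_in [OF V] x_infty_ends [OF _ *] o by auto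
qed

lemma x_infty_equiv:
  assumes "f \<in> wordsS X" "g \<in> wordsS X" "word_equiv (transp_letters X) prod.swap f g" "x \<in> X"
  shows "x_infty f x = x_infty g x"
  using ends_equiv [OF assms ends_x_infty(1) [OF assms(1,4)] ends_x_infty(1) [OF assms(2,4)]] .

text \<open>The trail runs through \<open>f\<close> and continues from its end point through
  \<open>g\<close>; thus words act on points from the right.\<close>

lemma x_infty_cat:
  assumes f: "f \<in> wordsS X" and g: "g \<in> wordsS X" and "x \<in> X"
  shows "x_infty (word_cat f g) x = x_infty g (x_infty f x)"
proof -
  note o = f [unfolded wordsS_iff words_iff] g [unfolded wordsS_iff words_iff]
  let ?s = "word_sum f g"
  obtain V where V: "orbit (wle f) (wlab f) (wpos f) x V (x_infty f x)"
    using ends_x_infty [OF f assms(3)] by (auto simp: ends_def)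
  obtain V' where V': "orbit (wle g) (wlab g) (wpos g) (x_infty f x) V' (x_infty g (x_infty f x))"
    using ends_x_infty [OF g ends_x_infty(2) [OF f assms(3)]] by (auto simp: ends_def)
  have 1: "orbit (wle ?s) (wlab ?s) (Inl ` wpos f) x V (x_infty f x)"
    by (rule orbit_transport [OF V]) auto
  have 2: "orbit (wle ?s) (wlab ?s) (Inr ` wpos g) (x_infty f x) V' (x_infty g (x_infty f x))"
    by (rule orbit_transport [OF V']) auto
  note fo = wordsS_over [OF f] and go = wordsS_over [OF g]
  have lin: "lin_on (Inl ` wpos f \<union> Inr ` wpos g) (wle ?s)"
    using word_overD(1) [OF word_over_sum [OF fo go]] by (simp add: Plus_def)
  have "orbit (wle ?s) (wlab ?s) (Inl ` wpos f \<union> Inr ` wpos g) x (V \<union> V') (x_infty g (x_infty f x))"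
    by (rule orbit_concat [OF 1 2 lin]) auto
  then have "orbit (wle ?s) (wlab ?s) (wpos ?s) x (V \<union> V') (x_infty g (x_infty f x))"
    by (simp add: Plus_def)
  then have "ends (word_cat f g) x (x_infty g (x_infty f x))"
    unfolding ends_def by (intro exI orbit_iso [OF word_cat_iso [OF fo go]])
  then show ?thesis
    by (rule x_infty_ends [OF wordsS_over [OF word_system.cat [OF wordsS_system f g]]])
qed

lemma x_infty_empty: "x_infty empty_word x = x"
proof (rule x_infty_ends [OF empty_word_over])
  show "ends empty_word x x"
    unfolding ends_def by (rule exI [of _ "{x}"], rule orbit.stop) (simp add: hits_def empty_word_def)
qed

section \<open>Topologies given by subgroups\<close>

text \<open>Under these conditions \<open>subgroup_topology\<close> is a topology in which left
  cosets of the basic subgroups are open. They hold both for the subgroups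
  \<open>W_subgroup X C\<close> and for the kernels defining the natural topology.\<close>

locale subgroup_base = group G for G (structure) +
  fixes \<B> :: "'a set set"
  assumes base_nonempty: "\<B> \<noteq> {}"
    and base_subgroup: "\<And>H. H \<in> \<B> \<Longrightarrow> subgroup H G"
    and base_inter: "\<And>H K. H \<in> \<B> \<Longrightarrow> K \<in> \<B> \<Longrightarrow> \<exists>M\<in>\<B>. M \<subseteq> H \<inter> K"
begin

lemma l_coset_mono: "H \<subseteq> K \<Longrightarrow> u <# H \<subseteq> u <# K"
  by (auto simp: l_coset_def)

lemma in_l_coset: "u \<in> carrier G \<Longrightarrow> H \<in> \<B> \<Longrightarrow> u \<in> u <# H"
  using subgroup.one_closed [OF base_subgroup] by (force simp: l_coset_def)

lemma openin_subgroup_topology: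
  "openin (subgroup_topology G \<B>) U \<longleftrightarrow> U \<subseteq> carrier G \<and> (\<forall>u\<in>U. \<exists>H\<in>\<B>. u <# H \<subseteq> U)"
proof -
  have "istopology (\<lambda>U. U \<subseteq> carrier G \<and> (\<forall>u\<in>U. \<exists>H\<in>\<B>. u <# H \<subseteq> U))"
    unfolding istopology_def
  proof (intro conjI allI impI; (elim conjE)?)
    fix S T
    assume *: "\<forall>u\<in>S. \<exists>H\<in>\<B>. u <# H \<subseteq> S" "\<forall>u\<in>T. \<exists>H\<in>\<B>. u <# H \<subseteq> T" "S \<subseteq> carrier G"
    show "S \<inter> T \<subseteq> carrier G" using *(3) by blast
    show "\<forall>u\<in>S \<inter> T. \<exists>H\<in>\<B>. u <# H \<subseteq> S \<inter> T"
    proof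
      fix u assume "u \<in> S \<inter> T"
      then obtain H K where HK: "H \<in> \<B>" "u <# H \<subseteq> S" "K \<in> \<B>" "u <# K \<subseteq> T" using * by blast
      then obtain M where M: "M \<in> \<B>" "M \<subseteq> H" "M \<subseteq> K" using base_inter [of H K] by blast
      have "u <# M \<subseteq> S \<inter> T"
        using l_coset_mono [OF M(2), of u] l_coset_mono [OF M(3), of u] HK(2,4) by blast
      then show "\<exists>M\<in>\<B>. u <# M \<subseteq> S \<inter> T" using M(1) by blast
    qed
  next
    fix \<K>
    assume "\<forall>K\<in>\<K>. K \<subseteq> carrier G \<and> (\<forall>u\<in>K. \<exists>H\<in>\<B>. u <# H \<subseteq> K)"
    then show "\<Union>\<K> \<subseteq> carrier G" "\<forall>u\<in>\<Union>\<K>. \<exists>H\<in>\<B>. u <# H \<subseteq> \<Union>\<K>"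
      by (blast, meson Sup_upper UnionE order_trans)
  qed
  then show ?thesis unfolding subgroup_topology_def by (simp add: topology_inverse')
qed

lemma topspace_subgroup_topology: "topspace (subgroup_topology G \<B>) = carrier G"
proof
  show "topspace (subgroup_topology G \<B>) \<subseteq> carrier G"
    using openin_subgroup_topology [of "topspace (subgroup_topology G \<B>)"] by simp
  have "openin (subgroup_topology G \<B>) (carrier G)"
    unfolding openin_subgroup_topology
    using base_nonempty l_coset_subset_G subgroup.subset [OF base_subgroup] by blast
  then show "carrier G \<subseteq> topspace (subgroup_topology G \<B>)" by (rule openin_subset)
qed

lemma openin_l_coset:
  assumes "u \<in> carrier G" "H \<in> \<B>"
  shows "openin (subgroup_topology G \<B>) (u <# H)"
  unfolding openin_subgroup_topology
proof (intro conjI ballI bexI)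
  interpret H: subgroup H G by (rule base_subgroup [OF assms(2)])
  show "u <# H \<subseteq> carrier G" by (rule l_coset_subset_G [OF H.subset assms(1)])
  fix v assume "v \<in> u <# H"
  then obtain h where h: "h \<in> H" "v = u \<otimes> h" by (auto simp: l_coset_def)
  show "v <# H \<subseteq> u <# H"
  proof
    fix w assume "w \<in> v <# H"
    then obtain k where k: "k \<in> H" "w = v \<otimes> k" by (auto simp: l_coset_def)
    then have "w = u \<otimes> (h \<otimes> k)" using h assms(1) by (simp add: m_assoc)
    then show "w \<in> u <# H" using h(1) k(1) by (auto simp: l_coset_def)
  qed
qed (rule assms(2))

lemma openin_subtopology_subgroup:
  assumes "K \<subseteq> carrier G"
  shows "openin (subtopology (subgroup_topology G \<B>) K) U \<longleftrightarrow>
    U \<subseteq> K \<and> (\<forall>u\<in>U. \<exists>H\<in>\<B>. (u <# H) \<inter> K \<subseteq> U)"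
proof
  assume "openin (subtopology (subgroup_topology G \<B>) K) U"
  then obtain V where V: "openin (subgroup_topology G \<B>) V" "U = V \<inter> K"
    by (auto simp: openin_subtopology)
  have "\<exists>H\<in>\<B>. (u <# H) \<inter> K \<subseteq> U" if "u \<in> U" for u
    using V that unfolding openin_subgroup_topology by blast
  then show "U \<subseteq> K \<and> (\<forall>u\<in>U. \<exists>H\<in>\<B>. (u <# H) \<inter> K \<subseteq> U)" using V(2) by blast
next
  assume U: "U \<subseteq> K \<and> (\<forall>u\<in>U. \<exists>H\<in>\<B>. (u <# H) \<inter> K \<subseteq> U)"
  \<comment> \<open>The largest candidate: all basic cosets whose trace on \<open>K\<close> lies in
    \<open>U\<close>.\<close>
  define V where "V = \<Union>{u <# H | u H. u \<in> U \<and> H \<in> \<B> \<and> (u <# H) \<inter> K \<subseteq> U}"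
  have "openin (subgroup_topology G \<B>) V"
    unfolding V_def using U assms by (intro openin_Union) (auto intro: openin_l_coset)
  moreover have "U = V \<inter> K"
  proof
    show "U \<subseteq> V \<inter> K"
    proof
      fix u assume u: "u \<in> U"
      then obtain H where H: "H \<in> \<B>" "(u <# H) \<inter> K \<subseteq> U" using U by blast
      have "u \<in> u <# H" using u U assms by (intro in_l_coset H(1)) auto
      then show "u \<in> V \<inter> K" using u U H unfolding V_def by blast
    qed
    show "V \<inter> K \<subseteq> U" unfolding V_def by blast
  qed
  ultimately show "openin (subtopology (subgroup_topology G \<B>) K) U"
    unfolding openin_subtopology by blast
qed

text \<open>Left translations are continuous by construction; continuity of both operations in all
  variables comes from the hypothesis on conjugates, by writing \<open>u k v h\<close> as
  \<open>u v\<close> times \<open>(inv v k v) h\<close>.\<close>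

lemma topological_group_subgroup_topology:
  assumes conj: "\<And>g H. g \<in> carrier G \<Longrightarrow> H \<in> \<B> \<Longrightarrow> \<exists>K\<in>\<B>. \<forall>k\<in>K. inv g \<otimes> k \<otimes> g \<in> H"
  shows "topological_group G (subgroup_topology G \<B>)"
  unfolding topological_group_def
proof (intro conjI)
  let ?T = "subgroup_topology G \<B>"
  show "group G" ..
  show top: "topspace ?T = carrier G" by (rule topspace_subgroup_topology)
  show "continuous_map (prod_topology ?T ?T) ?T (\<lambda>(x, y). x \<otimes> y)"
    unfolding continuous_map_def
  proof (intro conjI allI impI)
    show "(\<lambda>(x, y). x \<otimes> y) \<in> topspace (prod_topology ?T ?T) \<rightarrow> topspace ?T" by (auto simp: top)
    fix W assume W: "openin ?T W"
    show "openin (prod_topology ?T ?T) {p \<in> topspace (prod_topology ?T ?T). (case p of (x, y) \<Rightarrow> x \<otimes> y) \<in> W}"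
      unfolding openin_prod_topology_alt
    proof (intro allI impI)
      fix u v assume "(u, v) \<in> {p \<in> topspace (prod_topology ?T ?T). (case p of (x, y) \<Rightarrow> x \<otimes> y) \<in> W}"
      then have uv: "u \<in> carrier G" "v \<in> carrier G" "u \<otimes> v \<in> W" by (auto simp: top)
      then obtain H where H: "H \<in> \<B>" "(u \<otimes> v) <# H \<subseteq> W"
        using W unfolding openin_subgroup_topology by blast
      obtain K where K: "K \<in> \<B>" "\<forall>k\<in>K. inv v \<otimes> k \<otimes> v \<in> H" using conj [OF uv(2) H(1)] by blast
      interpret H: subgroup H G by (rule base_subgroup [OF H(1)])
      interpret K: subgroup K G by (rule base_subgroup [OF K(1)])
      have "u \<otimes> k \<otimes> (v \<otimes> h) \<in> W" if "k \<in> K" "h \<in> H" for k h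
      proof -
        have c: "k \<in> carrier G" "h \<in> carrier G" using that by auto
        have e: "k \<otimes> v = v \<otimes> (inv v \<otimes> k \<otimes> v)"
          using c uv by (simp add: m_assoc [symmetric])
        have "u \<otimes> k \<otimes> (v \<otimes> h) = u \<otimes> (k \<otimes> v) \<otimes> h" using c uv by (simp add: m_assoc)
        also have "\<dots> = u \<otimes> v \<otimes> ((inv v \<otimes> k \<otimes> v) \<otimes> h)"
          by (subst e) (use c uv in \<open>simp add: m_assoc\<close>)
        finally have "u \<otimes> k \<otimes> (v \<otimes> h) = u \<otimes> v \<otimes> ((inv v \<otimes> k \<otimes> v) \<otimes> h)" .
        moreover have "(inv v \<otimes> k \<otimes> v) \<otimes> h \<in> H" using K(2) that by blast
        ultimately show ?thesis using H(2) by (auto simp: l_coset_def)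
      qed
      then have "(u <# K) \<times> (v <# H) \<subseteq> {p \<in> topspace (prod_topology ?T ?T). (case p of (x, y) \<Rightarrow> x \<otimes> y) \<in> W}"
        using uv by (auto simp: top l_coset_def)
      then show "\<exists>U V. openin ?T U \<and> openin ?T V \<and> u \<in> U \<and> v \<in> V \<and>
          U \<times> V \<subseteq> {p \<in> topspace (prod_topology ?T ?T). (case p of (x, y) \<Rightarrow> x \<otimes> y) \<in> W}"
        using openin_l_coset [OF uv(1) K(1)] openin_l_coset [OF uv(2) H(1)]
          in_l_coset [OF uv(1) K(1)] in_l_coset [OF uv(2) H(1)] by blast
    qed
  qed
  show "continuous_map ?T ?T (\<lambda>x. inv x)"
    unfolding continuous_map_def
  proof (intro conjI allI impI)
    show "(\<lambda>x. inv x) \<in> topspace ?T \<rightarrow> topspace ?T" by (auto simp: top)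
    fix W assume W: "openin ?T W"
    show "openin ?T {x \<in> topspace ?T. inv x \<in> W}"
      unfolding openin_subgroup_topology
    proof (intro conjI ballI)
      show "{x \<in> topspace ?T. inv x \<in> W} \<subseteq> carrier G" by (auto simp: top)
      fix u assume "u \<in> {x \<in> topspace ?T. inv x \<in> W}"
      then have u: "u \<in> carrier G" "inv u \<in> W" by (auto simp: top)
      then obtain H where H: "H \<in> \<B>" "inv u <# H \<subseteq> W"
        using W unfolding openin_subgroup_topology by blast
      obtain K where K: "K \<in> \<B>" "\<forall>k\<in>K. inv (inv u) \<otimes> k \<otimes> inv u \<in> H"
        using conj [OF inv_closed [OF u(1)] H(1)] by blast
      interpret K: subgroup K G by (rule base_subgroup [OF K(1)])
      have "inv (u \<otimes> k) \<in> W" if "k \<in> K" for k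
      proof -
        have k: "k \<in> carrier G" "inv k \<in> K" using that by auto
        \<comment> \<open>Inversion turns the left coset of \<open>u\<close> into a right coset;
          conjugating by \<open>inv u\<close> turns it back into a left coset of
          \<open>inv u\<close>.\<close>
        have "inv (u \<otimes> k) = inv u \<otimes> (u \<otimes> inv k \<otimes> inv u)"
          using k u by (simp add: inv_mult_group m_assoc [symmetric])
        moreover have "u \<otimes> inv k \<otimes> inv u \<in> H" using K(2) k(2) u(1) by force
        ultimately show ?thesis using H(2) by (auto simp: l_coset_def)
      qed
      then have "u <# K \<subseteq> {x \<in> topspace ?T. inv x \<in> W}"
        using u by (auto simp: top l_coset_def)
      then show "\<exists>H\<in>\<B>. u <# H \<subseteq> {x \<in> topspace ?T. inv x \<in> W}" using K(1) by blast
    qed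
  qed
qed

end

lemma topological_group_subgroup:
  assumes "topological_group G \<T>" "subgroup K G"
  shows "topological_group (G\<lparr>carrier := K\<rparr>) (subtopology \<T> K)"
proof -
  interpret group G using assms(1) by (simp add: topological_group_def)
  interpret K: subgroup K G by (rule assms(2))
  have T: "topspace \<T> = carrier G"
    "continuous_map (prod_topology \<T> \<T>) \<T> (\<lambda>(x, y). x \<otimes>\<^bsub>G\<^esub> y)"
    "continuous_map \<T> \<T> (\<lambda>x. inv\<^bsub>G\<^esub> x)"
    using assms(1) by (simp_all add: topological_group_def)
  have top: "topspace (subtopology \<T> K) = K" using K.subset by (auto simp: T(1))
  have "continuous_map (prod_topology (subtopology \<T> K) (subtopology \<T> K)) (subtopology \<T> K)
      (\<lambda>(x, y). x \<otimes>\<^bsub>G\<^esub> y)"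
    unfolding continuous_map_in_subtopology subtopology_Times [symmetric]
    using continuous_map_from_subtopology [OF T(2), of "K \<times> K"] by auto
  moreover have "continuous_map (subtopology \<T> K) (subtopology \<T> K) (\<lambda>x. inv\<^bsub>G\<^esub> x)"
    unfolding continuous_map_in_subtopology
    using continuous_map_from_subtopology [OF T(3), of K] by (auto simp: top)
  then have "continuous_map (subtopology \<T> K) (subtopology \<T> K) (\<lambda>x. inv\<^bsub>G\<lparr>carrier := K\<rparr>\<^esub> x)"
    by (rule continuous_map_eq) (simp add: top m_inv_consistent [OF assms(2)])
  ultimately show ?thesis
    using subgroup_imp_group [OF assms(2)] top by (simp add: topological_group_def)
qed

section \<open>The action on points\<close>

abbreviation BFS :: "'x set \<Rightarrow> ('x \<times> 'x) bword set monoid" where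
  "BFS X \<equiv> BF (transp_letters X) prod.swap (wordsS X)"

abbreviation BFS' :: "'x set \<Rightarrow> ('x \<times> 'x) bword set monoid" where
  "BFS' X \<equiv> BF (transp_letters X) prod.swap (wordsS' X)"

abbreviation cls :: "'x set \<Rightarrow> ('x \<times> 'x) bword \<Rightarrow> ('x \<times> 'x) bword set" where
  "cls X \<equiv> bf_class (transp_letters X) prod.swap"

text \<open>A class is formed in all of \<open>words\<close> and also contains words without
  well-defined end points, so the representative is chosen inside \<open>wordsS\<close>.\<close>

definition act :: "'x set \<Rightarrow> ('x \<times> 'x) bword set \<Rightarrow> 'x \<Rightarrow> 'x" where
  "act X c x = x_infty (SOME f. f \<in> c \<inter> wordsS X) x"

lemma act_cls:
  assumes "f \<in> wordsS X" "x \<in> X"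
  shows "act X (cls X f) x = x_infty f x"
proof -
  have "f \<in> cls X f \<inter> wordsS X"
    using assms(1) wordsS_words [of X] bf_class_self by blast
  then have "(SOME f'. f' \<in> cls X f \<inter> wordsS X) \<in> cls X f \<inter> wordsS X"
    by (rule someI [of "\<lambda>f'. f' \<in> cls X f \<inter> wordsS X"])
  then show ?thesis
    unfolding act_def using x_infty_equiv [OF assms(1) _ _ assms(2)] bf_class_memD by fastforce
qed

lemma group_BFS: "group (BFS X)"
  by (rule word_system.group_BF [OF wordsS_system])

lemma group_BFS': "group (BFS' X)"
  by (rule word_system.group_BF [OF wordsS'_system])

lemma subgroup_BFS': "subgroup (carrier (BFS' X)) (BFS X)"
  by (rule subgroup_BF [OF wordsS_system wordsS'_system wordsS'_subset])

lemma carrier_BFS': "c \<in> carrier (BFS' X) \<Longrightarrow> c \<in> carrier (BFS X)"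
  using wordsS'_subset by (auto simp: carrier_BF)

lemma mult_BFS': "c \<otimes>\<^bsub>BFS' X\<^esub> d = c \<otimes>\<^bsub>BFS X\<^esub> d"
  by (simp add: BF_def)

lemma inv_BFS':
  assumes "c \<in> carrier (BFS' X)"
  shows "inv\<^bsub>BFS' X\<^esub> c = inv\<^bsub>BFS X\<^esub> c"
  using group.m_inv_consistent [OF group_BFS subgroup_BFS' assms]
  by (simp add: BF_eq_update [symmetric])

lemma act_in: "c \<in> carrier (BFS X) \<Longrightarrow> x \<in> X \<Longrightarrow> act X c x \<in> X"
  by (auto simp: carrier_BF act_cls ends_x_infty)

lemma act_mult:
  assumes "c \<in> carrier (BFS X)" "d \<in> carrier (BFS X)" "x \<in> X"
  shows "act X (c \<otimes>\<^bsub>BFS X\<^esub> d) x = act X d (act X c x)"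
proof -
  interpret word_system "transp_letters X" prod.swap "wordsS X" by (rule wordsS_system)
  obtain f g where "f \<in> wordsS X" "g \<in> wordsS X" "c = cls X f" "d = cls X g"
    using assms(1,2) by (auto simp: carrier_BF)
  then show ?thesis
    using assms(3) by (simp add: mult act_cls cat x_infty_cat ends_x_infty)
qed

lemma act_one: "x \<in> X \<Longrightarrow> act X (\<one>\<^bsub>BFS X\<^esub>) x = x"
  unfolding one_BF using act_cls [OF word_system.empty [OF wordsS_system]] x_infty_empty by metis

lemma act_inv:
  assumes "c \<in> carrier (BFS X)" "x \<in> X"
  shows "act X (inv\<^bsub>BFS X\<^esub> c) (act X c x) = x" "act X c (act X (inv\<^bsub>BFS X\<^esub> c) x) = x"
proof -
  interpret group "BFS X" by (rule group_BFS)
  show "act X (inv\<^bsub>BFS X\<^esub> c) (act X c x) = x"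
    using act_mult [OF assms(1) inv_closed [OF assms(1)] assms(2)] assms by (simp add: act_one)
  show "act X c (act X (inv\<^bsub>BFS X\<^esub> c) x) = x"
    using act_mult [OF inv_closed [OF assms(1)] assms(1,2)] assms by (simp add: act_one)
qed

section \<open>The topology\<close>

lemma transp_letters_mono: "C \<subseteq> X \<Longrightarrow> transp_letters C \<subseteq> transp_letters X"
  by (auto simp: transp_letters_def)

lemma swap_transp: "l \<in> transp_letters C \<Longrightarrow> prod.swap l \<in> transp_letters C"
  by (auto simp: transp_letters_def)

lemma W_subgroup_iff:
  assumes "C \<subseteq> X"
  shows "c \<in> W_subgroup X C \<longleftrightarrow> c \<in> carrier (BFS X) \<and>
    c \<in> bf_proj_kernel (transp_letters X) prod.swap (wordsS X) (transp_letters C) \<and>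
    (\<forall>x\<in>C. act X c x = x)"
  using assms act_cls by (fastforce simp: W_subgroup_def carrier_BF)

lemma W_subgroup_subgroup:
  assumes "C \<subseteq> X"
  shows "subgroup (W_subgroup X C) (BFS X)"
proof -
  interpret group "BFS X" by (rule group_BFS)
  interpret word_system "transp_letters X" prod.swap "wordsS X" by (rule wordsS_system)
  let ?K = "bf_proj_kernel (transp_letters X) prod.swap (wordsS X) (transp_letters C)"
  have "?K \<lhd> BFS X"
    by (rule bf_proj_kernel_normal [OF transp_letters_mono [OF assms] swap_transp])
  then interpret K: normal ?K "BFS X" .
  have act_fix: "act X (inv\<^bsub>BFS X\<^esub> c) x = x" if "c \<in> carrier (BFS X)" "act X c x = x" "x \<in> C" for c x
    using act_inv(1) [OF that(1), of x] that assms by auto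
  show ?thesis
  proof (rule subgroupI)
    show "W_subgroup X C \<subseteq> carrier (BFS X)" using W_subgroup_iff [OF assms] by blast
    have "\<one>\<^bsub>BFS X\<^esub> \<in> W_subgroup X C"
      using K.one_closed by (auto simp: W_subgroup_iff [OF assms] act_one [OF subsetD [OF assms]])
    then show "W_subgroup X C \<noteq> {}" by blast
    show "inv\<^bsub>BFS X\<^esub> c \<in> W_subgroup X C" if "c \<in> W_subgroup X C" for c
      using that act_fix by (auto simp: W_subgroup_iff [OF assms])
    show "c \<otimes>\<^bsub>BFS X\<^esub> d \<in> W_subgroup X C" if "c \<in> W_subgroup X C" "d \<in> W_subgroup X C" for c d
      using that by (auto simp: W_subgroup_iff [OF assms] act_mult [OF _ _ subsetD [OF assms]])
  qed
qed

lemma W_subgroup_mono: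
  assumes "C \<subseteq> D" "D \<subseteq> X"
  shows "W_subgroup X D \<subseteq> W_subgroup X C"
proof -
  interpret word_system "transp_letters X" prod.swap "wordsS X" by (rule wordsS_system)
  have "bf_proj_kernel (transp_letters X) prod.swap (wordsS X) (transp_letters D) \<subseteq>
      bf_proj_kernel (transp_letters X) prod.swap (wordsS X) (transp_letters C)"
    by (intro bf_proj_kernel_mono transp_letters_mono assms swap_transp)
  moreover have "C \<subseteq> X" using assms by blast
  ultimately show ?thesis
    unfolding subset_iff W_subgroup_iff [OF assms(2)] W_subgroup_iff [OF \<open>C \<subseteq> X\<close>]
    using assms(1) by blast
qed

text \<open>The kernel part is normal, but fixing \<open>C\<close> is not. The conjugate sends
  \<open>x\<close> by \<open>inv g\<close>, then \<open>k\<close>, then \<open>g\<close>; it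
  suffices that \<open>k\<close> also fixes the images of \<open>C\<close> under
  \<open>inv g\<close>, and these are added to \<open>D\<close>.\<close>

lemma W_subgroup_conj:
  assumes "C \<subseteq> X" "finite C" "g \<in> carrier (BFS X)"
  shows "\<exists>D. D \<subseteq> X \<and> finite D \<and> (\<forall>k\<in>W_subgroup X D. inv\<^bsub>BFS X\<^esub> g \<otimes>\<^bsub>BFS X\<^esub> k \<otimes>\<^bsub>BFS X\<^esub> g \<in> W_subgroup X C)"
proof (intro exI conjI ballI)
  interpret group "BFS X" by (rule group_BFS)
  interpret word_system "transp_letters X" prod.swap "wordsS X" by (rule wordsS_system)
  let ?D = "C \<union> act X (inv\<^bsub>BFS X\<^esub> g) ` C"
  show D: "?D \<subseteq> X" using act_in [OF inv_closed [OF assms(3)]] assms(1) by auto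
  show "finite ?D" using assms(2) by simp
  let ?K = "bf_proj_kernel (transp_letters X) prod.swap (wordsS X) (transp_letters C)"
  have "?K \<lhd> BFS X"
    by (rule bf_proj_kernel_normal [OF transp_letters_mono [OF assms(1)] swap_transp])
  then interpret K: normal ?K "BFS X" .
  fix k assume k: "k \<in> W_subgroup X ?D"
  then have kc: "k \<in> carrier (BFS X)" and fix_D: "\<forall>x\<in>?D. act X k x = x"
    by (simp_all add: W_subgroup_iff [OF D])
  have "k \<in> ?K"
    using W_subgroup_mono [OF Un_upper1 D] k by (auto simp: W_subgroup_iff [OF assms(1)])
  then have "inv\<^bsub>BFS X\<^esub> g \<otimes>\<^bsub>BFS X\<^esub> k \<otimes>\<^bsub>BFS X\<^esub> g \<in> ?K"
    using K.inv_op_closed1 assms(3) by blast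
  moreover have "act X (inv\<^bsub>BFS X\<^esub> g \<otimes>\<^bsub>BFS X\<^esub> k \<otimes>\<^bsub>BFS X\<^esub> g) x = x" if "x \<in> C" for x
  proof -
    have x: "x \<in> X" "act X (inv\<^bsub>BFS X\<^esub> g) x \<in> ?D" using that assms(1) by auto
    then show ?thesis
      using fix_D act_mult [OF _ assms(3), of "inv\<^bsub>BFS X\<^esub> g \<otimes>\<^bsub>BFS X\<^esub> k" x]
        act_mult [OF inv_closed [OF assms(3)] kc x(1)] kc assms(3) act_inv(2) [OF assms(3) x(1)]
      by simp
  qed
  ultimately show "inv\<^bsub>BFS X\<^esub> g \<otimes>\<^bsub>BFS X\<^esub> k \<otimes>\<^bsub>BFS X\<^esub> g \<in> W_subgroup X C"
    using kc assms(3) by (simp add: W_subgroup_iff [OF assms(1)])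
qed

lemma W_base: "subgroup_base (BFS X) (W_subgroup X ` {C. C \<subseteq> X \<and> finite C})"
proof -
  interpret group "BFS X" by (rule group_BFS)
  show ?thesis
  proof (intro subgroup_base.intro subgroup_base_axioms.intro group_BFS)
    show "W_subgroup X ` {C. C \<subseteq> X \<and> finite C} \<noteq> {}" by blast
    show "subgroup H (BFS X)" if "H \<in> W_subgroup X ` {C. C \<subseteq> X \<and> finite C}" for H
      using that W_subgroup_subgroup by auto
    fix H K assume "H \<in> W_subgroup X ` {C. C \<subseteq> X \<and> finite C}" "K \<in> W_subgroup X ` {C. C \<subseteq> X \<and> finite C}"
    then obtain C D where CD: "H = W_subgroup X C" "K = W_subgroup X D" "C \<subseteq> X" "D \<subseteq> X" "finite C" "finite D"
      by auto
    have "W_subgroup X (C \<union> D) \<subseteq> H \<inter> K"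
      using W_subgroup_mono [of C "C \<union> D" X] W_subgroup_mono [of D "C \<union> D" X] CD by auto
    then show "\<exists>M\<in>W_subgroup X ` {C. C \<subseteq> X \<and> finite C}. M \<subseteq> H \<inter> K"
      using CD by blast
  qed
qed

lemma topological_group_topS': "topological_group (BFS' X) (topS' X)"
proof -
  interpret subgroup_base "BFS X" "W_subgroup X ` {C. C \<subseteq> X \<and> finite C}" by (rule W_base)
  have "topological_group (BFS X) (topS X)"
    unfolding topS_def
  proof (rule topological_group_subgroup_topology)
    fix g H assume g: "g \<in> carrier (BFS X)" and "H \<in> W_subgroup X ` {C. C \<subseteq> X \<and> finite C}"
    then obtain C where C: "C \<subseteq> X" "finite C" "H = W_subgroup X C" by auto
    from W_subgroup_conj [OF C(1,2) g] C(3)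
    show "\<exists>K\<in>W_subgroup X ` {C. C \<subseteq> X \<and> finite C}. \<forall>k\<in>K. inv\<^bsub>BFS X\<^esub> g \<otimes>\<^bsub>BFS X\<^esub> k \<otimes>\<^bsub>BFS X\<^esub> g \<in> H"
      by auto
  qed
  from topological_group_subgroup [OF this subgroup_BFS'] show ?thesis
    unfolding topS'_def by (simp add: BF_eq_update [symmetric])
qed

lemma openin_topS':
  "openin (topS' X) U \<longleftrightarrow> U \<subseteq> carrier (BFS' X) \<and>
    (\<forall>u\<in>U. \<exists>C. C \<subseteq> X \<and> finite C \<and>
      (\<forall>v\<in>carrier (BFS' X). inv\<^bsub>BFS X\<^esub> u \<otimes>\<^bsub>BFS X\<^esub> v \<in> W_subgroup X C \<longrightarrow> v \<in> U))"
proof -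
  interpret subgroup_base "BFS X" "W_subgroup X ` {C. C \<subseteq> X \<and> finite C}" by (rule W_base)
  have mem: "v \<in> u <#\<^bsub>BFS X\<^esub> W_subgroup X C \<longleftrightarrow> inv\<^bsub>BFS X\<^esub> u \<otimes>\<^bsub>BFS X\<^esub> v \<in> W_subgroup X C"
    if uv: "u \<in> carrier (BFS X)" "v \<in> carrier (BFS X)" and C: "C \<subseteq> X" for u v C
  proof
    assume "v \<in> u <#\<^bsub>BFS X\<^esub> W_subgroup X C"
    then obtain k where "k \<in> W_subgroup X C" "v = u \<otimes>\<^bsub>BFS X\<^esub> k" by (auto simp: l_coset_def)
    moreover from this have "k \<in> carrier (BFS X)" using W_subgroup_iff [OF C] by blast
    ultimately show "inv\<^bsub>BFS X\<^esub> u \<otimes>\<^bsub>BFS X\<^esub> v \<in> W_subgroup X C"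
      using uv by (simp add: m_assoc [symmetric])
  next
    assume "inv\<^bsub>BFS X\<^esub> u \<otimes>\<^bsub>BFS X\<^esub> v \<in> W_subgroup X C"
    moreover have "v = u \<otimes>\<^bsub>BFS X\<^esub> (inv\<^bsub>BFS X\<^esub> u \<otimes>\<^bsub>BFS X\<^esub> v)"
      using uv by (simp add: m_assoc [symmetric])
    ultimately show "v \<in> u <#\<^bsub>BFS X\<^esub> W_subgroup X C" by (auto simp: l_coset_def)
  qed
  have sub: "carrier (BFS' X) \<subseteq> carrier (BFS X)" using carrier_BFS' by blast
  have eq: "(\<exists>H\<in>W_subgroup X ` {C. C \<subseteq> X \<and> finite C}. (u <#\<^bsub>BFS X\<^esub> H) \<inter> carrier (BFS' X) \<subseteq> U) \<longleftrightarrow>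
      (\<exists>C. C \<subseteq> X \<and> finite C \<and>
      (\<forall>v\<in>carrier (BFS' X). inv\<^bsub>BFS X\<^esub> u \<otimes>\<^bsub>BFS X\<^esub> v \<in> W_subgroup X C \<longrightarrow> v \<in> U))"
    if u: "u \<in> carrier (BFS' X)" for u
  proof -
    have "(u <#\<^bsub>BFS X\<^esub> W_subgroup X C) \<inter> carrier (BFS' X) \<subseteq> U \<longleftrightarrow>
        (\<forall>v\<in>carrier (BFS' X). inv\<^bsub>BFS X\<^esub> u \<otimes>\<^bsub>BFS X\<^esub> v \<in> W_subgroup X C \<longrightarrow> v \<in> U)"
      if "C \<subseteq> X" for C
      using mem [OF carrier_BFS' [OF u] carrier_BFS' that] by blast
    then show ?thesis by auto
  qed
  show ?thesis
    unfolding topS'_def topS_def openin_subtopology_subgroup [OF sub]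
    using eq by (intro conj_cong refl ball_cong) blast
qed

lemma topspace_topS': "topspace (topS' X) = carrier (BFS' X)"
  using topological_group_topS' by (auto simp: topological_group_def)

section \<open>Comparison with the natural topology\<close>

lemma natural_base:
  "subgroup_base (BFS' X) (bf_proj_kernel (transp_letters X) prod.swap (wordsS' X) `
     {A. A \<subseteq> transp_letters X \<and> finite A \<and> prod.swap ` A = A})" (is "subgroup_base _ ?B")
proof -
  interpret group "BFS' X" by (rule group_BFS')
  interpret word_system "transp_letters X" prod.swap "wordsS' X" by (rule wordsS'_system)
  let ?K = "bf_proj_kernel (transp_letters X) prod.swap (wordsS' X)"
  show ?thesis
  proof (intro subgroup_base.intro subgroup_base_axioms.intro group_BFS')
    show "?B \<noteq> {}" by blast
    fix H assume "H \<in> ?B"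
    then obtain A where A: "A \<subseteq> transp_letters X" "prod.swap ` A = A" "H = ?K A" "finite A" by auto
    then have "H \<lhd> BFS' X" using bf_proj_kernel_normal [of A] by blast
    then show "subgroup H (BFS' X)" by (rule normal_imp_subgroup)
    fix K assume "K \<in> ?B"
    then obtain B where B: "B \<subseteq> transp_letters X" "prod.swap ` B = B" "K = ?K B" "finite B" by auto
    have "?K (A \<union> B) \<subseteq> H \<inter> K"
      using bf_proj_kernel_mono [of A "A \<union> B"] bf_proj_kernel_mono [of B "A \<union> B"] A B by blast
    moreover have "?K (A \<union> B) \<in> ?B" using A B by (auto simp: image_Un)
    ultimately show "\<exists>M\<in>?B. M \<subseteq> H \<inter> K" by blast
  qed
qed

text \<open>For a finite set \<open>A\<close> of letters let \<open>C\<close> be the set of points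
  occurring in them. Then \<open>A\<close> lies in \<open>transp_letters C\<close>, so the kernel of
  the projection to \<open>A\<close> contains the kernel belonging to \<open>C\<close>.\<close>

lemma natural_coarser:
  assumes "openin (natural_topology (transp_letters X) prod.swap (wordsS' X)) U"
  shows "openin (topS' X) U"
  unfolding openin_topS'
proof (intro conjI ballI)
  let ?K = "bf_proj_kernel (transp_letters X) prod.swap"
  interpret subgroup_base "BFS' X" "?K (wordsS' X) `
     {A. A \<subseteq> transp_letters X \<and> finite A \<and> prod.swap ` A = A}" by (rule natural_base)
  note U = assms [unfolded natural_topology_def openin_subgroup_topology]
  show "U \<subseteq> carrier (BFS' X)" using U by blast
  fix u assume u: "u \<in> U"
  then obtain A where A: "A \<subseteq> transp_letters X" "finite A" "prod.swap ` A = A"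
    "u <#\<^bsub>BFS' X\<^esub> ?K (wordsS' X) A \<subseteq> U"
    using U by blast
  have uc: "u \<in> carrier (BFS' X)" using u U by blast
  define C where "C = fst ` A \<union> snd ` A"
  have C: "C \<subseteq> X" "finite C" "A \<subseteq> transp_letters C"
    using A(1,2) by (auto simp: C_def transp_letters_def image_iff) (metis fst_conv snd_conv)+
  have "v \<in> U" if v: "v \<in> carrier (BFS' X)" "inv\<^bsub>BFS X\<^esub> u \<otimes>\<^bsub>BFS X\<^esub> v \<in> W_subgroup X C" for v
  proof -
    let ?w = "inv\<^bsub>BFS' X\<^esub> u \<otimes>\<^bsub>BFS' X\<^esub> v"
    have w: "?w = inv\<^bsub>BFS X\<^esub> u \<otimes>\<^bsub>BFS X\<^esub> v" by (simp add: mult_BFS' inv_BFS' [OF uc])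
    have "?w \<in> ?K (wordsS X) (transp_letters C)"
      using v(2) unfolding w W_subgroup_iff [OF C(1)] by blast
    then have "?w \<in> ?K (wordsS X) A"
      using word_system.bf_proj_kernel_mono [OF wordsS_system C(3) transp_letters_mono [OF C(1)]]
        A(3) swap_transp by blast
    then have "?w \<in> ?K (wordsS' X) A"
      using uc v(1) by (simp add: bf_proj_kernel_def kernel_def)
    moreover have "v = u \<otimes>\<^bsub>BFS' X\<^esub> ?w" using uc v(1) by (simp add: m_assoc [symmetric])
    ultimately show ?thesis using A(4) by (auto simp: l_coset_def)
  qed
  then show "\<exists>C. C \<subseteq> X \<and> finite C \<and>
      (\<forall>v\<in>carrier (BFS' X). inv\<^bsub>BFS X\<^esub> u \<otimes>\<^bsub>BFS X\<^esub> v \<in> W_subgroup X C \<longrightarrow> v \<in> U)"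
    using C by blast
qed

section \<open>Letters and finite words\<close>

abbreviation letter :: "'x set \<Rightarrow> 'x \<times> 'x \<Rightarrow> ('x \<times> 'x) bword set" where
  "letter X \<equiv> bf_letter (transp_letters X) prod.swap"

lemma letter_word_words: "l \<in> L \<Longrightarrow> letter_word l \<in> words L"
  unfolding words_iff
  by (rule word_overI) (auto simp: letter_word_def lin_on_def)

lemma finite_word_wordsS':
  assumes "f \<in> words (transp_letters X)" "finite (wpos f)"
  shows "f \<in> wordsS' X"
  using assms interval_tame_finite [OF assms(1) [unfolded words_iff] assms(2)] by (simp add: wordsS'_iff)

lemma letter_word_wordsS': "l \<in> transp_letters X \<Longrightarrow> letter_word l \<in> wordsS' X"
  by (rule finite_word_wordsS' [OF letter_word_words]) (auto simp: letter_word_def)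

lemma letter_carrier: "l \<in> transp_letters X \<Longrightarrow> letter X l \<in> carrier (BFS' X)"
  unfolding carrier_BF bf_letter_def by (rule imageI [OF letter_word_wordsS'])

definition transpose :: "'x \<times> 'x \<Rightarrow> 'x \<Rightarrow> 'x" where
  "transpose l x = (if x \<in> pts l then other x l else x)"

lemma act_letter:
  assumes "l \<in> transp_letters X" "x \<in> X"
  shows "act X (letter X l) x = transpose l x"
proof -
  note w = letter_word_words [OF assms(1)]
  have "lin_on {(l, 0)} (wle (letter_word l))"
    using word_overD(1) [OF w [unfolded words_iff]] by (simp add: letter_word_def)
  from orbit_singleton [OF this, of "wlab (letter_word l)" x]
  have "\<exists>V. orbit (wle (letter_word l)) (wlab (letter_word l)) {(l, 0)} x V (transpose l x)"
    by (auto simp: transpose_def letter_word_def)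
  then have "ends (letter_word l) x (transpose l x)"
    by (simp add: ends_def letter_word_def)
  then show ?thesis
    using act_cls [OF _ assms(2)] letter_word_wordsS' [OF assms(1)] wordsS'_subset [of X]
      x_infty_ends [OF w [unfolded words_iff]]
    unfolding bf_letter_def by (metis subsetD)
qed

lemma inv_letter:
  assumes "l \<in> transp_letters X"
  shows "inv\<^bsub>BFS' X\<^esub> (letter X l) = letter X (prod.swap l)"
proof -
  interpret word_system "transp_letters X" prod.swap "wordsS' X" by (rule wordsS'_system)
  note w = letter_word_wordsS' [OF assms] and w' = letter_word_wordsS' [OF swap_transp [OF assms]]
  have "word_iso (word_bar prod.swap (letter_word l)) (letter_word (prod.swap l))"
    by (rule word_isoI [of "\<lambda>_. (prod.swap l, 0)"]) (auto simp: letter_word_def bij_betw_def)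
  then have "cls X (word_bar prod.swap (letter_word l)) = cls X (letter_word (prod.swap l))"
    by (intro class_eqI bar w w' word_equiv_iso in_words)
  then show ?thesis using inv_class [OF w] by (simp add: bf_letter_def)
qed

section \<open>Finite words as products of letters\<close>

definition list_prod :: "('a, 'b) monoid_scheme \<Rightarrow> ('l \<Rightarrow> 'a) \<Rightarrow> 'l list \<Rightarrow> 'a" where
  "list_prod G t ls = foldr (\<lambda>l c. t l \<otimes>\<^bsub>G\<^esub> c) ls \<one>\<^bsub>G\<^esub>"

lemma list_prod_simps [simp]:
  "list_prod G t [] = \<one>\<^bsub>G\<^esub>" "list_prod G t (l # ls) = t l \<otimes>\<^bsub>G\<^esub> list_prod G t ls"
  by (simp_all add: list_prod_def)

lemma list_prod_closed:
  "monoid G \<Longrightarrow> (\<And>l. l \<in> set ls \<Longrightarrow> t l \<in> carrier G) \<Longrightarrow> list_prod G t ls \<in> carrier G"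
  by (induction ls) (auto intro: monoid.m_closed)

lemma list_prod_snoc:
  assumes "monoid G" "\<And>k. k \<in> set ls \<Longrightarrow> t k \<in> carrier G" "t l \<in> carrier G"
  shows "list_prod G t (ls @ [l]) = list_prod G t ls \<otimes>\<^bsub>G\<^esub> t l"
proof -
  interpret monoid G by fact
  show ?thesis using assms(2)
    by (induction ls) (use assms(3) in \<open>auto simp: m_assoc list_prod_closed [OF assms(1)]\<close>)
qed

text \<open>Because the interpretation of letters is a parameter of \<open>list_prod\<close>, one
  list can be evaluated both in the group and in a quotient, where the relators hold as
  equations.\<close>

lemma list_prod_hom:
  assumes "group_hom G H h" "\<And>l. l \<in> set ls \<Longrightarrow> t l \<in> carrier G"
  shows "h (list_prod G t ls) = list_prod H (\<lambda>l. h (t l)) ls"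
proof -
  interpret group_hom G H h by fact
  show ?thesis using assms(2)
    by (induction ls) (auto simp: list_prod_closed [OF G.monoid_axioms])
qed

lemma word_iso_least_letter:
  assumes lin: "lin_on (wpos f) (wle f)" and t: "t \<in> wpos f" "\<And>u. u \<in> wpos f \<Longrightarrow> (t, u) \<in> wle f"
  shows "word_iso (word_sum (letter_word (wlab f t)) (word_restrict f (wpos f - {t}))) f"
    (is "word_iso ?s f")
proof (rule word_isoI [of "case_sum (\<lambda>_. t) id"])
  have min: "(u, t) \<notin> wle f" if "u \<in> wpos f" "u \<noteq> t" for u
    using lin_on_antisym [OF lin t(1) that(1) t(2) [OF that(1)]] that(2) by blast
  have pos: "wpos ?s = insert (Inl (wlab f t, 0)) (Inr ` (wpos f - {t}))"
    by (auto simp: letter_word_def)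
  show "bij_betw (case_sum (\<lambda>_. t) id) (wpos ?s) (wpos f)"
    unfolding pos using t(1) by (auto simp: bij_betw_def inj_on_def image_image)
  show "(a, b) \<in> wle ?s \<longleftrightarrow> (case_sum (\<lambda>_. t) id a, case_sum (\<lambda>_. t) id b) \<in> wle f"
    if "a \<in> wpos ?s" "b \<in> wpos ?s" for a b
    using that t(2) min lin_on_refl [OF lin t(1)]
    unfolding pos by (auto simp: letter_word_def)
  show "wlab ?s a = wlab f (case_sum (\<lambda>_. t) id a)" if "a \<in> wpos ?s" for a
    using that unfolding pos by (auto simp: letter_word_def)
qed

lemma finite_word_list_prod:
  assumes "f \<in> words (transp_letters X)" "finite (wpos f)"
  shows "\<exists>ls. set ls \<subseteq> transp_letters X \<and> cls X f = list_prod (BFS' X) (letter X) ls"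
  using assms
proof (induction "card (wpos f)" arbitrary: f rule: less_induct)
  case less
  interpret word_system "transp_letters X" prod.swap "wordsS' X" by (rule wordsS'_system)
  note o = word_overD [OF less.prems(1) [unfolded words_iff]]
  show ?case
  proof (cases "wpos f = {}")
    case True
    have "word_iso f empty_word"
      by (rule word_isoI [of id]) (use True in \<open>auto simp: empty_word_def bij_betw_def\<close>)
    then have "cls X f = cls X empty_word"
      by (intro class_eqI word_equiv_iso less.prems empty_words finite_word_wordsS' empty) (simp_all add: less.prems)
    then show ?thesis by (intro exI [of _ "[]"]) (simp add: one_BF)
  next
    case False
    obtain t where t: "t \<in> wpos f" "\<And>u. u \<in> wpos f \<Longrightarrow> (t, u) \<in> wle f"
      using finite_least [OF o(1) order_refl less.prems(2) False] by blast
    let ?l = "wlab f t" and ?g = "word_restrict f (wpos f - {t})"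
    have l: "?l \<in> transp_letters X" by (rule o(3) [OF t(1)])
    have g: "?g \<in> words (transp_letters X)"
      using less.prems(1) word_over_restrict unfolding words_iff by blast
    have fg: "finite (wpos ?g)" using less.prems(2) by simp
    have "card (wpos ?g) < card (wpos f)"
      using less.prems(2) t(1) by (intro psubset_card_mono) auto
    then obtain ls where ls: "set ls \<subseteq> transp_letters X" "cls X ?g = list_prod (BFS' X) (letter X) ls"
      using less.hyps [OF _ g fg] by blast
    note iso = word_iso_least_letter [OF o(1) t]
    have "word_iso (word_cat (letter_word ?l) ?g) f"
      by (rule word_iso_trans [OF word_iso_sym iso])
        (rule word_cat_iso [OF letter_word_words [OF l, unfolded words_iff] g [unfolded words_iff]])
    then have "cls X (word_cat (letter_word ?l) ?g) = cls X f"
      using word_equiv_iso [OF word_cat_words [OF letter_word_words [OF l] g] less.prems(1)]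
      by (simp add: bf_class_eq_iff letter_word_words [OF l] g less.prems(1))
    moreover have "cls X (word_cat (letter_word ?l) ?g) = letter X ?l \<otimes>\<^bsub>BFS' X\<^esub> cls X ?g"
      by (simp add: bf_letter_def mult_BF [OF letter_word_words [OF l] g])
    ultimately show ?thesis using ls l by (intro exI [of _ "?l # ls"]) simp
  qed
qed

lemma list_prod_letters_carrier:
  "set ls \<subseteq> transp_letters X \<Longrightarrow> list_prod (BFS' X) (letter X) ls \<in> carrier (BFS' X)"
  by (rule list_prod_closed [OF group.is_monoid [OF group_BFS']]) (auto intro: letter_carrier)

lemma list_prod_finite_words_subgroup:
  "set ls \<subseteq> transp_letters X \<Longrightarrow>
    list_prod (BFS' X) (letter X) ls \<in> finite_words_subgroup (transp_letters X) prod.swap (wordsS' X)"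
  unfolding finite_words_subgroup_def
  by (induction ls) (auto intro: generate.one generate.eng generate.incl)

lemma act_list_prod_fixed:
  assumes "set ls \<subseteq> transp_letters (X - C)" "x \<in> C" "x \<in> X"
  shows "act X (list_prod (BFS' X) (letter X) ls) x = x"
  using assms(1)
proof (induction ls)
  case Nil
  then show ?case using act_one [OF assms(3)] by (simp add: one_BF)
next
  case (Cons l ls)
  have l: "l \<in> transp_letters X" "x \<notin> pts l" and ls: "set ls \<subseteq> transp_letters X"
    using Cons.prems assms(2) transp_letters_mono [of "X - C" X] by (auto simp: pts_transp)
  have "act X (letter X l) x = x" using act_letter [OF l(1) assms(3)] l(2) by (simp add: transpose_def)
  then show ?case
    using Cons act_mult [OF carrier_BFS' [OF letter_carrier [OF l(1)]]
        carrier_BFS' [OF list_prod_letters_carrier [OF ls]] assms(3)]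
    by (simp add: mult_BFS')
qed

text \<open>The letters must avoid \<open>C\<close> altogether: a letter with exactly one point in
  \<open>C\<close> also projects to the empty word over \<open>transp_letters C\<close>, but it
  moves that point.\<close>

lemma list_prod_W_subgroup:
  assumes "set ls \<subseteq> transp_letters (X - C)" "C \<subseteq> X"
  shows "list_prod (BFS' X) (letter X) ls \<in> W_subgroup X C"
  using assms(1)
proof (induction ls)
  case Nil
  then show ?case
    using subgroup.one_closed [OF W_subgroup_subgroup [OF assms(2)]] by (simp add: one_BF)
next
  case (Cons l ls)
  interpret word_system "transp_letters X" prod.swap "wordsS X" by (rule wordsS_system)
  have l: "l \<in> transp_letters X" "pts l \<inter> C = {}"
    using Cons.prems by (auto simp: pts_transp)
  then have "l \<notin> transp_letters C" by (auto simp: pts_transp pts_def)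
  have w: "letter_word l \<in> wordsS X" using letter_word_wordsS' [OF l(1)] wordsS'_subset by blast
  have e: "word_proj (transp_letters C) (letter_word l) = empty_word"
    using \<open>l \<notin> transp_letters C\<close> by (auto simp: word_proj_def letter_word_def word_restrict_def empty_word_def)
  have "letter X l \<in> bf_proj_kernel (transp_letters X) prod.swap (wordsS X) (transp_letters C)"
    unfolding bf_letter_def
    using bf_proj_kernel_iff [OF transp_letters_mono [OF assms(2)] swap_transp w] e by simp
  moreover have "act X (letter X l) x = x" if "x \<in> C" for x
    using act_letter [OF l(1) subsetD [OF assms(2) that]] l(2) that by (auto simp: transpose_def)
  ultimately have "letter X l \<in> W_subgroup X C"
    using carrier_BFS' [OF letter_carrier [OF l(1)]] by (simp add: W_subgroup_iff [OF assms(2)])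
  then show ?case
    using Cons subgroup.m_closed [OF W_subgroup_subgroup [OF assms(2)]] by (simp add: mult_BFS')
qed

section \<open>Approximation by finite words\<close>

text \<open>Only positions meeting a point visited from \<open>E\<close> are kept. They are finitely
  many, they contain all steps of the trails from \<open>E\<close>, and they contain every letter
  between points of \<open>E\<close>.\<close>

lemma finite_approximation:
  assumes f: "f \<in> wordsS X" and E: "finite E" "E \<subseteq> X"
  shows "\<exists>g \<in> words (transp_letters X). finite (wpos g) \<and>
    word_proj (transp_letters E) g = word_proj (transp_letters E) f \<and>
    (\<forall>x\<in>E. x_infty g x = x_infty f x)"
proof -
  note fo = wordsS_over [OF f]
  have "\<exists>V. orbit (wle f) (wlab f) (wpos f) x V (x_infty f x)" if "x \<in> E" for x
    using ends_x_infty(1) [OF f] that E(2) by (auto simp: ends_def)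
  then obtain V where V: "\<And>x. x \<in> E \<Longrightarrow> orbit (wle f) (wlab f) (wpos f) x (V x) (x_infty f x)"
    by metis
  \<comment> \<open>\<open>E\<close> is included so that no letter over \<open>E\<close> is lost;
    the sets \<open>V x\<close> are included so that the trails survive the restriction.\<close>
  define D where "D = E \<union> (\<Union>x\<in>E. V x)"
  have D: "finite D" "D \<subseteq> X"
  proof -
    show "finite D" using E(1) orbit_in [OF V] by (auto simp: D_def)
    have "V x \<subseteq> X" if "x \<in> E" for x
      using orbit_subset [OF V [OF that] subsetD [OF E(2) that] word_over_pts [OF fo]] .
    then show "D \<subseteq> X" using E(2) by (auto simp: D_def)
  qed
  define P where "P = hits (wlab f) (wpos f) D"
  have PF: "finite P" "P \<subseteq> wpos f"
    using finite_hits_tame [OF _ D(2,1)] f unfolding P_def wordsS_iff by (blast, intro hits_subset)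
  let ?g = "word_restrict f P"
  have gpos: "wpos ?g = P" using PF(2) by auto
  have go: "word_over (transp_letters X) ?g" by (rule word_over_restrict [OF fo])
  have "word_proj (transp_letters E) ?g = word_restrict f (wpos f \<inter> (P \<inter> wlab f -` transp_letters E))"
    by (auto simp: word_proj_def word_restrict_def)
      (use word_overD(2) [OF fo] in blast)+
  moreover have "wpos f \<inter> (P \<inter> wlab f -` transp_letters E) = wpos f \<inter> wlab f -` transp_letters E"
    by (auto simp: P_def hits_def D_def pts_def transp_letters_def)
  moreover have "word_restrict f (wpos f \<inter> wlab f -` transp_letters E) = word_proj (transp_letters E) f"
    using word_overD(2) [OF fo] by (auto simp: word_proj_def word_restrict_def)
  ultimately have "word_proj (transp_letters E) ?g = word_proj (transp_letters E) f" by simp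
  moreover have "x_infty ?g x = x_infty f x" if "x \<in> E" for x
  proof (rule x_infty_ends [OF go])
    have "orbit (wle f) (wlab f) P x (V x) (x_infty f x)"
      by (rule orbit_restrict [OF V [OF that] PF(2)]) (use that in \<open>auto simp: P_def hits_def D_def\<close>)
    then have "orbit (wle ?g) (wlab ?g) P x (V x) (x_infty f x)"
      by (rule orbit_rel_cong) auto
    then show "ends ?g x (x_infty f x)" unfolding ends_def gpos by blast
  qed
  ultimately show ?thesis using go PF(1) gpos unfolding words_iff [symmetric] by metis
qed

lemma (in word_system) bf_proj_kernel_diff:
  assumes A: "A \<subseteq> L" "\<And>l. l \<in> A \<Longrightarrow> \<iota> l \<in> A" and f: "f \<in> \<S>" and g: "g \<in> \<S>"
    and eq: "word_proj A f = word_proj A g"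
  shows "inv\<^bsub>BF L \<iota> \<S>\<^esub> (bf_class L \<iota> f) \<otimes>\<^bsub>BF L \<iota> \<S>\<^esub> bf_class L \<iota> g \<in> bf_proj_kernel L \<iota> \<S> A"
proof -
  have "free_involution A \<iota>" using inv A by (auto simp: free_involution_def)
  then interpret A: word_system A \<iota> "words A" by (rule word_system_words)
  interpret h: group_hom "BF L \<iota> \<S>" "BF A \<iota> (words A)" "bf_proj \<iota> A"
    using group_BF A.group_BF bf_proj_hom [OF A]
    by (simp add: group_hom_def group_hom_axioms_def)
  have c: "bf_class L \<iota> f \<in> carrier (BF L \<iota> \<S>)" "bf_class L \<iota> g \<in> carrier (BF L \<iota> \<S>)"
    using f g by (auto simp: carrier_BF)
  have "bf_proj \<iota> A (bf_class L \<iota> g) = bf_proj \<iota> A (bf_class L \<iota> f)"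
    using bf_proj_class [OF in_words [OF f] A] bf_proj_class [OF in_words [OF g] A] eq by simp
  then show ?thesis
    using c by (simp add: bf_proj_kernel_def kernel_def)
qed

text \<open>A finite word with the same projection and the same end points on a suitable finite set
  lies in the same left coset of \<open>W_subgroup X C\<close>, and a finite word is a product of
  letters.\<close>

lemma W_subgroup_approximation:
  assumes u: "u \<in> carrier (BFS' X)" and C: "finite C" "C \<subseteq> X"
  shows "\<exists>ls. set ls \<subseteq> transp_letters X \<and>
    inv\<^bsub>BFS X\<^esub> u \<otimes>\<^bsub>BFS X\<^esub> list_prod (BFS' X) (letter X) ls \<in> W_subgroup X C"
proof -
  interpret group "BFS X" by (rule group_BFS)
  interpret word_system "transp_letters X" prod.swap "wordsS X" by (rule wordsS_system)
  obtain f where f: "f \<in> wordsS' X" "u = cls X f" using u by (auto simp: carrier_BF)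
  have fS: "f \<in> wordsS X" using f(1) wordsS'_subset by blast
  have uc: "u \<in> carrier (BFS X)" by (rule carrier_BFS' [OF u])
  \<comment> \<open>The quotient moves \<open>x \<in> C\<close> first by the inverse of
    \<open>u\<close>, so the end points of \<open>g\<close> and \<open>f\<close> must agree at the
    images of \<open>C\<close> under that inverse.\<close>
  define E where "E = C \<union> act X (inv\<^bsub>BFS X\<^esub> u) ` C"
  have E: "finite E" "E \<subseteq> X"
    using C act_in [OF inv_closed [OF uc]] by (auto simp: E_def)
  obtain g where g: "g \<in> words (transp_letters X)" "finite (wpos g)"
    "word_proj (transp_letters E) g = word_proj (transp_letters E) f"
    "\<And>x. x \<in> E \<Longrightarrow> x_infty g x = x_infty f x"
    using finite_approximation [OF fS E] by blast
  obtain ls where ls: "set ls \<subseteq> transp_letters X" "cls X g = list_prod (BFS' X) (letter X) ls"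
    using finite_word_list_prod [OF g(1,2)] by blast
  have gS: "g \<in> wordsS X" using finite_word_wordsS' [OF g(1,2)] wordsS'_subset by blast
  have gc: "cls X g \<in> carrier (BFS X)" using gS by (auto simp: carrier_BF)
  have "transp_letters C \<subseteq> transp_letters E" by (rule transp_letters_mono) (simp add: E_def)
  then have "word_proj (transp_letters C) f = word_proj (transp_letters C) g"
    using g(3) word_proj_proj by metis
  then have "inv\<^bsub>BFS X\<^esub> u \<otimes>\<^bsub>BFS X\<^esub> cls X g \<in>
      bf_proj_kernel (transp_letters X) prod.swap (wordsS X) (transp_letters C)"
    unfolding f(2) by (intro bf_proj_kernel_diff transp_letters_mono C swap_transp fS gS)
  moreover have "act X (inv\<^bsub>BFS X\<^esub> u \<otimes>\<^bsub>BFS X\<^esub> cls X g) x = x" if "x \<in> C" for x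
  proof -
    have x: "x \<in> X" "act X (inv\<^bsub>BFS X\<^esub> u) x \<in> E" using that C by (auto simp: E_def)
    then have x': "act X (inv\<^bsub>BFS X\<^esub> u) x \<in> X" using E by blast
    have "act X (cls X g) (act X (inv\<^bsub>BFS X\<^esub> u) x) = act X u (act X (inv\<^bsub>BFS X\<^esub> u) x)"
      using g(4) [OF x(2)] by (simp add: f(2) act_cls [OF gS x' [unfolded f(2)]] act_cls [OF fS x' [unfolded f(2)]])
    then show ?thesis
      using act_mult [OF inv_closed [OF uc] gc x(1)] act_inv(2) [OF uc x(1)] by simp
  qed
  ultimately show ?thesis
    using ls uc gc by (auto simp: W_subgroup_iff [OF C(2)])
qed

lemma finite_words_dense:
  "topS' X closure_of finite_words_subgroup (transp_letters X) prod.swap (wordsS' X) = topspace (topS' X)"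
proof
  show "topspace (topS' X) \<subseteq>
      topS' X closure_of finite_words_subgroup (transp_letters X) prod.swap (wordsS' X)"
  proof
    fix u assume u: "u \<in> topspace (topS' X)"
    have "\<exists>y. y \<in> finite_words_subgroup (transp_letters X) prod.swap (wordsS' X) \<and> y \<in> U"
      if U: "u \<in> U" "openin (topS' X) U" for U
    proof -
      obtain C where C: "C \<subseteq> X" "finite C"
        "\<And>v. v \<in> carrier (BFS' X) \<Longrightarrow> inv\<^bsub>BFS X\<^esub> u \<otimes>\<^bsub>BFS X\<^esub> v \<in> W_subgroup X C \<Longrightarrow> v \<in> U"
        using U(1) U(2) [unfolded openin_topS'] by metis
      obtain ls where ls: "set ls \<subseteq> transp_letters X"
        "inv\<^bsub>BFS X\<^esub> u \<otimes>\<^bsub>BFS X\<^esub> list_prod (BFS' X) (letter X) ls \<in> W_subgroup X C"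
        using W_subgroup_approximation [OF _ C(2,1)] u topspace_topS' by blast
      show ?thesis
        using C(3) [OF list_prod_letters_carrier [OF ls(1)] ls(2)]
          list_prod_finite_words_subgroup [OF ls(1)] by blast
    qed
    then show "u \<in> topS' X closure_of finite_words_subgroup (transp_letters X) prod.swap (wordsS' X)"
      using u by (auto simp: in_closure_of)
  qed
qed (rule closure_of_subset_topspace)

lemma topS'_admissible:
  "admissible_topology (transp_letters X) prod.swap (wordsS' X) (topS' X)"
  unfolding admissible_topology_def
  using topological_group_topS' natural_coarser finite_words_dense by blast

section \<open>The homomorphism to the symmetric group\<close>

text \<open>The inverse converts the right action into a homomorphism for composition of functions;
  restriction to \<open>X\<close> makes the map extensional, as \<open>Bij\<close> demands.\<close>

definition perm :: "'x set \<Rightarrow> ('x \<times> 'x) bword set \<Rightarrow> 'x \<Rightarrow> 'x" where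
  "perm X c = (\<lambda>x\<in>X. act X (inv\<^bsub>BFS X\<^esub> c) x)"

lemma perm_Bij:
  assumes "c \<in> carrier (BFS X)"
  shows "perm X c \<in> Bij X"
proof -
  interpret group "BFS X" by (rule group_BFS)
  have "bij_betw (act X (inv\<^bsub>BFS X\<^esub> c)) X X"
    by (rule bij_betwI [of _ _ _ "act X c"])
      (use act_in [OF assms] act_in [OF inv_closed [OF assms]] act_inv [OF assms] in auto)
  then show ?thesis
    by (simp add: Bij_def perm_def cong: bij_betw_cong)
qed

lemma perm_mult:
  assumes "c \<in> carrier (BFS X)" "d \<in> carrier (BFS X)"
  shows "perm X (c \<otimes>\<^bsub>BFS X\<^esub> d) = compose X (perm X c) (perm X d)"
proof
  interpret group "BFS X" by (rule group_BFS)
  fix x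
  show "perm X (c \<otimes>\<^bsub>BFS X\<^esub> d) x = compose X (perm X c) (perm X d) x"
    using assms act_mult [OF inv_closed [OF assms(2)] inv_closed [OF assms(1)], of x]
      act_in [OF inv_closed [OF assms(2)], of x]
    by (simp add: perm_def compose_def inv_mult_group)
qed

lemma carrier_BijGroup: "carrier (BijGroup X) = Bij X"
  by (simp add: BijGroup_def)

lemma mult_BijGroup: "g \<in> Bij X \<Longrightarrow> f \<in> Bij X \<Longrightarrow> g \<otimes>\<^bsub>BijGroup X\<^esub> f = compose X g f"
  by (simp add: BijGroup_def)

lemma one_BijGroup: "\<one>\<^bsub>BijGroup X\<^esub> = (\<lambda>x\<in>X. x)"
  by (simp add: BijGroup_def)

lemma perm_hom: "group_hom (BFS' X) (BijGroup X) (perm X)"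
proof (intro group_hom.intro group_hom_axioms.intro group_BFS' group_BijGroup homI)
  fix c d assume "c \<in> carrier (BFS' X)" "d \<in> carrier (BFS' X)"
  note cd = this [THEN carrier_BFS']
  show "perm X c \<in> carrier (BijGroup X)" using perm_Bij [OF cd(1)] by (simp add: BijGroup_def)
  show "perm X (c \<otimes>\<^bsub>BFS' X\<^esub> d) = perm X c \<otimes>\<^bsub>BijGroup X\<^esub> perm X d"
    using perm_Bij [OF cd(1)] perm_Bij [OF cd(2)] perm_mult [OF cd] by (simp add: BijGroup_def mult_BFS')
qed

lemma perm_kernel:
  "kernel (BFS' X) (BijGroup X) (perm X) = {c \<in> carrier (BFS' X). \<forall>x\<in>X. act X c x = x}"
proof -
  have "perm X c = (\<lambda>x\<in>X. x) \<longleftrightarrow> (\<forall>x\<in>X. act X c x = x)" if "c \<in> carrier (BFS' X)" for c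
  proof -
    note c = carrier_BFS' [OF that]
    have "perm X c = (\<lambda>x\<in>X. x) \<longleftrightarrow> (\<forall>x\<in>X. act X (inv\<^bsub>BFS X\<^esub> c) x = x)"
      by (auto simp: perm_def fun_eq_iff restrict_def)
    also have "\<dots> \<longleftrightarrow> (\<forall>x\<in>X. act X c x = x)"
      using act_inv [OF c] by metis
    finally show ?thesis .
  qed
  then show ?thesis by (auto simp: kernel_def BijGroup_def)
qed

section \<open>Every permutation comes from a word\<close>

lemma orbit_single_hit:
  assumes "t \<in> P" "y \<in> pts (lab t)" "(t, t) \<in> r" "hits lab P {y} \<subseteq> {t}"
    "hits lab P {other y (lab t)} \<subseteq> {t}"
  shows "orbit r lab P y {y, other y (lab t)} (other y (lab t))"
proof (rule orbit.step [where t = t])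
  show "t \<in> hits lab P {y}" using assms(1,2) by (simp add: hits_def)
  show "\<forall>u\<in>hits lab P {y}. (t, u) \<in> r" using assms(3,4) by blast
  show "orbit r lab {u \<in> P. (t, u) \<in> r \<and> u \<noteq> t} (other y (lab t)) {other y (lab t)} (other y (lab t))"
    by (rule orbit.stop) (use assms(5) in \<open>auto simp: hits_def\<close>)
qed

text \<open>One letter is placed for each 2-cycle. A well-order of \<open>X\<close> serves to select
  one of its two orientations and to order the letters by their first points. As every point occurs
  in at most one letter, the order does not influence the trails.\<close>

lemma involution_word:
  fixes X :: "'x set"
  assumes in_X: "\<And>x. x \<in> X \<Longrightarrow> \<alpha> x \<in> X" and invol: "\<And>x. x \<in> X \<Longrightarrow> \<alpha> (\<alpha> x) = x"
  shows "\<exists>f \<in> wordsS' X. \<forall>x\<in>X. x_infty f x = \<alpha> x"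
proof -
  obtain r :: "'x rel" where "well_order_on X r" using well_order_on by blast
  then have r: "lin_on X r"
    unfolding well_order_on_def linear_order_on_iff by blast
  define P :: "(('x \<times> 'x) \<times> nat) set" where
    "P = {((x, \<alpha> x), 0) | x. x \<in> X \<and> \<alpha> x \<noteq> x \<and> (x, \<alpha> x) \<in> r}"
  define f :: "('x \<times> 'x) bword" where
    "f = \<lparr>wpos = P, wle = {(p, q) \<in> P \<times> P. (fst (fst p), fst (fst q)) \<in> r}, wlab = fst\<rparr>"
  have sel: "wpos f = P" "wlab f = fst" "wle f = {(p, q) \<in> P \<times> P. (fst (fst p), fst (fst q)) \<in> r}"
    by (simp_all add: f_def)
  have unique: "p = q" if pq: "p \<in> P" "q \<in> P" "x \<in> pts (fst p)" "x \<in> pts (fst q)" for p q x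
  proof -
    obtain a b where ab: "p = ((a, \<alpha> a), 0)" "a \<in> X" "\<alpha> a \<noteq> a" "(a, \<alpha> a) \<in> r"
      "q = ((b, \<alpha> b), 0)" "b \<in> X" "\<alpha> b \<noteq> b" "(b, \<alpha> b) \<in> r"
      using pq(1,2) by (auto simp: P_def)
    have "x = a \<or> x = \<alpha> a" "x = b \<or> x = \<alpha> b" using pq(3,4) ab by (auto simp: pts_def)
    then have "a = b \<or> b = \<alpha> a" using invol ab by metis
    \<comment> \<open>Otherwise both orientations of one 2-cycle would have been selected, and
      antisymmetry would give \<open>a = \<alpha> a\<close>.\<close>
    moreover have "b \<noteq> \<alpha> a"
      using ab invol [OF ab(2)] lin_on_antisym [OF r ab(2) in_X [OF ab(2)]] by auto
    ultimately show ?thesis using ab by simp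
  qed
  have lin: "lin_on P (wle f)"
  proof (rule lin_onI)
    have X: "fst (fst p) \<in> X" if "p \<in> P" for p using that by (auto simp: P_def)
    show "(a, a) \<in> wle f" if "a \<in> P" for a
      using that lin_on_refl [OF r X] by (simp add: sel)
    show "(a, b) \<in> wle f \<or> (b, a) \<in> wle f" if "a \<in> P" "b \<in> P" for a b
      using that lin_on_total [OF r X X] by (simp add: sel)
    show "a = b" if "a \<in> P" "b \<in> P" "(a, b) \<in> wle f" "(b, a) \<in> wle f" for a b
    proof (rule unique [OF that(1,2)])
      show "fst (fst a) \<in> pts (fst a)" by (simp add: pts_def)
      have "fst (fst a) = fst (fst b)"
        using that(3,4) lin_on_antisym [OF r X X, OF that(1,2)] by (simp add: sel)
      then show "fst (fst a) \<in> pts (fst b)" by (simp add: pts_def)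
    qed
    show "(a, c) \<in> wle f"
      if "a \<in> P" "b \<in> P" "c \<in> P" "(a, b) \<in> wle f" "(b, c) \<in> wle f" for a b c
      using that(4,5) lin_on_trans [OF r X X X, OF that(1-3)] that(1,3) by (simp add: sel)
  qed
  have fw: "word_over (transp_letters X) f"
  proof (rule word_overI)
    show "finite {s \<in> wpos f. wlab f s = l}" for l
      by (rule finite_subset [of _ "{(l, 0)}"]) (auto simp: sel P_def)
  qed (use lin in_X in \<open>auto simp: sel P_def transp_letters_def\<close>)
  have hits_t: "hits fst I {x} \<subseteq> {t}" if "I \<subseteq> P" "t \<in> I" "x \<in> pts (fst t)" for I t x
  proof
    fix p assume "p \<in> hits fst I {x}"
    then have "p \<in> P" "x \<in> pts (fst p)" using that(1) by (auto simp: hits_def)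
    then show "p \<in> {t}" using unique [of p t x] that by blast
  qed
  have orb: "orbit s fst I x {x, other x (fst t)} (other x (fst t))"
    if "I \<subseteq> P" "t \<in> I" "x \<in> pts (fst t)" "(t, t) \<in> s" for s I x t
    by (rule orbit_single_hit [OF that(2-4)
          hits_t [OF that(1-3)] hits_t [OF that(1,2) other_in_pts]])
  have some_orbit: "\<exists>V w. orbit s fst I x V w" if "I \<subseteq> P" "s = wle f \<or> s = (wle f)\<inverse>" for s I x
  proof (cases "hits fst I {x} = {}")
    case True
    then show ?thesis using orbit.stop [OF True] by (intro exI)
  next
    case False
    then obtain t where t: "t \<in> I" "x \<in> pts (fst t)" by (auto simp: hits_def)
    have "(t, t) \<in> wle f" using lin_on_refl [OF lin] t(1) that(1) by blast
    then have "(t, t) \<in> s" using that(2) by blast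
    from orb [OF that(1) t this] show ?thesis by (intro exI)
  qed
  have "tame X (wle f) fst I" if "I \<subseteq> P" for I
    unfolding tame_def
  proof (intro ballI conjI some_orbit that)
    fix x
    have "p = q" if "p \<in> hits fst I {x}" "q \<in> hits fst I {x}" for p q
      using unique [of p q x] that \<open>I \<subseteq> P\<close> by (auto simp: hits_def)
    then show "finite (hits fst I {x})" by (metis finite.simps subsetI subset_singletonD singletonI)
  qed simp_all
  then have "f \<in> wordsS' X"
    using fw word_interval_subset [of f] by (simp add: wordsS'_iff words_iff interval_tame_def sel)
  moreover have "x_infty f x = \<alpha> x" if x: "x \<in> X" for x
  proof (rule x_infty_ends [OF fw])
    show "ends f x (\<alpha> x)"
    proof (cases "\<alpha> x = x")
      case True
      have "x \<notin> pts (fst p)" if "p \<in> P" for p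
        using that True invol by (auto simp: P_def pts_def)
      then have "hits fst P {x} = {}" by (auto simp: hits_def)
      from orbit.stop [OF this] show ?thesis using True by (auto simp: ends_def sel)
    next
      case False
      obtain t where t: "t \<in> P" "fst t = (x, \<alpha> x) \<or> fst t = (\<alpha> x, x)"
        using lin_on_total [OF r x in_X [OF x]] invol [OF x] False x in_X [OF x]
        unfolding P_def by fastforce
      have o: "x \<in> pts (fst t)" "other x (fst t) = \<alpha> x"
        using t(2) False by (elim disjE; simp add: pts_def other_def)+
      show ?thesis
        using orb [OF order_refl t(1) o(1) lin_on_refl [OF lin t(1)]] unfolding o(2)
        by (auto simp: ends_def sel)
    qed
  qed
  ultimately show ?thesis by blast
qed

text \<open>
  On a cycle, indexed so that the permutation is \<open>n \<mapsto> n + 1\<close>, it is the composition of the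
  reflections \<open>n \<mapsto> - n\<close> and \<open>n \<mapsto> 1 - n\<close>.
\<close>

lemma Bij_two_involutions:
  assumes \<pi>: "\<pi> \<in> Bij X"
  obtains \<alpha> \<beta> where "\<And>x. x \<in> X \<Longrightarrow> \<alpha> x \<in> X \<and> \<alpha> (\<alpha> x) = x" "\<And>x. x \<in> X \<Longrightarrow> \<beta> x \<in> X \<and> \<beta> (\<beta> x) = x"
    "\<And>x. x \<in> X \<Longrightarrow> \<pi> x = \<beta> (\<alpha> x)"
proof -
  interpret group "BijGroup X" by (rule group_BijGroup)
  have \<pi>c: "\<pi> \<in> carrier (BijGroup X)" using \<pi> by (simp add: BijGroup_def)
  define pw where "pw n x = (\<pi> [^]\<^bsub>BijGroup X\<^esub> (n::int)) x" for n x
  have B: "\<pi> [^]\<^bsub>BijGroup X\<^esub> (n::int) \<in> Bij X" for n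
    using int_pow_closed [OF \<pi>c, of n] by (simp only: carrier_BijGroup)
  have pw_in: "pw n x \<in> X" if "x \<in> X" for n x
    using Bij_imp_funcset [OF B] that by (auto simp: pw_def)
  have pw_add: "pw (m + n) x = pw m (pw n x)" if "x \<in> X" for m n x
    using that by (simp add: pw_def int_pow_mult [OF \<pi>c] mult_BijGroup [OF B B] compose_def)
  have pw_0: "pw 0 x = x" if "x \<in> X" for x
    using that by (simp add: pw_def one_BijGroup)
  have pw_1: "pw 1 x = \<pi> x" for x using \<pi>c by (simp add: pw_def)
  \<comment> \<open>The choice depends only on the cycle as a set, so all its points get the same
    representative, which serves as the origin of the indexing.\<close>
  define rep where "rep x = (SOME y. y \<in> range (\<lambda>n. pw n x))" for x
  have rep: "\<exists>n. x = pw n (rep x)" "rep x \<in> X" if "x \<in> X" for x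
  proof -
    have "rep x \<in> range (\<lambda>n. pw n x)" unfolding rep_def by (rule someI [of _ "pw 0 x"]) simp
    then obtain n where n: "rep x = pw n x" by blast
    then have "pw (- n) (rep x) = x" using pw_add [OF that, of "- n" n] pw_0 [OF that] by simp
    then show "\<exists>n. x = pw n (rep x)" by metis
    show "rep x \<in> X" using n pw_in [OF that] by simp
  qed
  have rep_pw: "rep (pw m x) = rep x" if "x \<in> X" for m x
  proof -
    have "pw n x \<in> range (\<lambda>n. pw n (pw m x))" for n
      using pw_add [OF that, of "n - m" m] by (metis diff_add_cancel rangeI)
    moreover have "pw n (pw m x) \<in> range (\<lambda>n. pw n x)" for n
      using pw_add [OF that, of n m] by (metis rangeI)
    ultimately have "range (\<lambda>n. pw n (pw m x)) = range (\<lambda>n. pw n x)" by blast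
    then show ?thesis by (simp add: rep_def)
  qed
  define \<alpha> where "\<alpha> x = pw (- (SOME n. x = pw n (rep x))) (rep x)" for x
  \<comment> \<open>On a finite cycle the exponent is not unique, but equal powers at the
    representative have equal inverse powers there, so the reflection is well defined.\<close>
  have \<alpha>: "\<alpha> (pw n (rep x)) = pw (- n) (rep x)" if "x \<in> X" for n x
  proof -
    let ?r = "rep x"
    have r: "?r \<in> X" by (rule rep(2) [OF that])
    have "rep ?r = ?r" using rep(1) [OF that] rep_pw [OF r] by metis
    then have rr: "rep (pw n ?r) = ?r" using rep_pw [OF r] by simp
    define m where "m = (SOME m. pw n ?r = pw m ?r)"
    have m: "pw n ?r = pw m ?r" unfolding m_def by (rule someI [of _ n]) simp
    have "pw (- m) ?r = pw (- m) (pw (- n) (pw n ?r))"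
      using pw_add [OF r, of "- n" n] pw_0 [OF r] by simp
    also have "\<dots> = pw (- m - n + m) ?r"
      unfolding m using pw_add [OF pw_in [OF r], of "- m" "- n" m] pw_add [OF r, of "- m - n" m] by simp
    finally have "pw (- m) ?r = pw (- n) ?r" by simp
    then show ?thesis by (simp add: \<alpha>_def rr m_def)
  qed
  \<comment> \<open>This is the reflection sending index n to 1 - n: first n to - n, then one step
    along the cycle.\<close>
  define \<beta> where "\<beta> x = \<pi> (\<alpha> x)" for x
  have \<alpha>2: "\<alpha> x \<in> X \<and> \<alpha> (\<alpha> x) = x" and \<beta>2: "\<beta> x \<in> X \<and> \<beta> (\<beta> x) = x" if x: "x \<in> X" for x
  proof -
    let ?r = "rep x"
    have r: "?r \<in> X" by (rule rep(2) [OF that])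
    obtain n where n: "x = pw n ?r" using rep(1) [OF x] by blast
    have a: "\<alpha> x = pw (- n) ?r" using \<alpha> [OF x, of n] n by simp
    then show "\<alpha> x \<in> X \<and> \<alpha> (\<alpha> x) = x" using \<alpha> [OF x, of "- n"] n pw_in [OF r] by simp
    have b: "\<beta> x = pw (1 - n) ?r"
      unfolding \<beta>_def a using pw_add [OF r, of 1 "- n"] by (simp add: pw_1)
    have "\<beta> (\<beta> x) = \<pi> (pw (n - 1) ?r)" unfolding b using \<alpha> [OF x, of "1 - n"] by (simp add: \<beta>_def)
    also have "\<dots> = x" using pw_add [OF r, of 1 "n - 1"] n by (simp add: pw_1)
    finally show "\<beta> x \<in> X \<and> \<beta> (\<beta> x) = x" using b pw_in [OF r] by simp
  qed
  have "\<pi> x = \<beta> (\<alpha> x)" if "x \<in> X" for x using \<alpha>2 [OF that] by (simp add: \<beta>_def)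
  then show ?thesis using that \<alpha>2 \<beta>2 by blast
qed

lemma perm_surj: "perm X ` carrier (BFS' X) = carrier (BijGroup X)"
proof
  interpret h: group_hom "BFS' X" "BijGroup X" "perm X" by (rule perm_hom)
  show "perm X ` carrier (BFS' X) \<subseteq> carrier (BijGroup X)" by auto
  show "carrier (BijGroup X) \<subseteq> perm X ` carrier (BFS' X)"
  proof
    fix \<pi> assume "\<pi> \<in> carrier (BijGroup X)"
    then have \<pi>: "\<pi> \<in> Bij X" by (simp add: BijGroup_def)
    have inv_word: "\<exists>c\<in>carrier (BFS' X). \<forall>x\<in>X. perm X c x = \<alpha> x"
      if \<alpha>: "\<And>x. x \<in> X \<Longrightarrow> \<alpha> x \<in> X \<and> \<alpha> (\<alpha> x) = x" for \<alpha>
    proof -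
      obtain f where f: "f \<in> wordsS' X" "\<And>x. x \<in> X \<Longrightarrow> x_infty f x = \<alpha> x"
        using involution_word [of X \<alpha>] \<alpha> by blast
      have fS: "f \<in> wordsS X" using f(1) wordsS'_subset by blast
      then have c: "cls X f \<in> carrier (BFS X)" by (auto simp: carrier_BF)
      \<comment> \<open>The inverse in \<open>perm\<close> is harmless here, because
        \<open>\<alpha>\<close> is its own inverse on \<open>X\<close>.\<close>
      have "perm X (cls X f) x = \<alpha> x" if "x \<in> X" for x
        using act_inv(1) [OF c, of "\<alpha> x"] act_cls [OF fS, of "\<alpha> x"] f(2) \<alpha> [OF that] that
        by (simp add: perm_def)
      then show ?thesis using f(1) by (auto simp: carrier_BF)
    qed
    obtain \<alpha> \<beta> where ab: "\<And>x. x \<in> X \<Longrightarrow> \<alpha> x \<in> X \<and> \<alpha> (\<alpha> x) = x" "\<And>x. x \<in> X \<Longrightarrow> \<beta> x \<in> X \<and> \<beta> (\<beta> x) = x"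
      "\<And>x. x \<in> X \<Longrightarrow> \<pi> x = \<beta> (\<alpha> x)"
      using Bij_two_involutions [OF \<pi>] by blast
    obtain a b where c: "a \<in> carrier (BFS' X)" "b \<in> carrier (BFS' X)"
      "\<And>x. x \<in> X \<Longrightarrow> perm X a x = \<alpha> x" "\<And>x. x \<in> X \<Longrightarrow> perm X b x = \<beta> x"
      using inv_word [of \<alpha>] inv_word [of \<beta>] ab(1,2) by blast
    \<comment> \<open>The word for \<beta> comes first, as \<open>perm\<close> turns products into
      composites with the left factor applied last.\<close>
    have "perm X (b \<otimes>\<^bsub>BFS' X\<^esub> a) = compose X (perm X b) (perm X a)"
      using perm_mult [OF carrier_BFS' carrier_BFS'] c by (simp add: mult_BFS')
    also have "\<dots> = \<pi>"
    proof (rule extensionalityI [of _ X])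
      show "\<pi> \<in> extensional X" using Bij_imp_extensional [OF \<pi>] .
      show "compose X (perm X b) (perm X a) x = \<pi> x" if "x \<in> X" for x
        using that c ab by (simp add: compose_def)
    qed (simp add: compose_extensional)
    finally show "\<pi> \<in> perm X ` carrier (BFS' X)" using h.G.m_closed [OF c(2,1)] by blast
  qed
qed

section \<open>The relators\<close>

text \<open>The relators as equations between abstract transpositions. It is instantiated by
  quotients of \<open>BFS' X\<close>, where \<open>t_swap\<close> follows from the square relators
  because swapping a letter inverts it.\<close>

locale transposition_group = group H for H (structure) +
  fixes X :: "'x set" and t :: "'x \<times> 'x \<Rightarrow> 'a"
  assumes t_closed: "\<And>l. l \<in> transp_letters X \<Longrightarrow> t l \<in> carrier H"
    and t_swap: "\<And>l. l \<in> transp_letters X \<Longrightarrow> t (prod.swap l) = t l"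
    and t_square: "\<And>l. l \<in> transp_letters X \<Longrightarrow> t l \<otimes> t l = \<one>"
    and t_commute: "\<And>x y z w. {x, y, z, w} \<subseteq> X \<Longrightarrow> card {x, y, z, w} = 4 \<Longrightarrow>
      t (x, y) \<otimes> t (z, w) = t (z, w) \<otimes> t (x, y)"
    and t_conj: "\<And>x y z. {x, y, z} \<subseteq> X \<Longrightarrow> card {x, y, z} = 3 \<Longrightarrow>
      t (x, y) \<otimes> t (x, z) = t (y, z) \<otimes> t (x, y)"
begin

text \<open>Moves a letter involving \<open>x\<close> to the right past an arbitrary letter. What is
  left behind avoids \<open>x\<close>, and at most one letter involving \<open>x\<close> remains;
  the partner of \<open>x\<close> may change.\<close>

lemma push_letter:
  assumes Y: "Y \<subseteq> X" and l: "l \<in> transp_letters Y" and x: "x \<in> Y" "y \<in> Y" "x \<noteq> y"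
  shows "t (x, y) \<otimes> t l = \<one> \<or>
    (\<exists>k \<in> transp_letters (Y - {x}). \<exists>z \<in> Y - {x}. t (x, y) \<otimes> t l = t k \<otimes> t (x, z))"
proof -
  \<comment> \<open>Up to reversing the orientation of the second letter by \<open>t_swap\<close>,
    these cases are exhaustive.\<close>
  have main: "t (x, y) \<otimes> t (a, b) = \<one> \<or>
      (\<exists>k \<in> transp_letters (Y - {x}). \<exists>z \<in> Y - {x}. t (x, y) \<otimes> t (a, b) = t k \<otimes> t (x, z))"
    if ab: "a \<in> Y" "b \<in> Y" "a \<noteq> b" and cases: "(a \<notin> {x, y} \<and> b \<notin> {x, y}) \<or> a = x \<or> (a = y \<and> b \<noteq> x)"
    for a b
    using cases
  proof (elim disjE conjE)
    assume *: "a \<notin> {x, y}" "b \<notin> {x, y}"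
    have "t (x, y) \<otimes> t (a, b) = t (a, b) \<otimes> t (x, y)"
      by (rule t_commute) (use * ab x Y in auto)
    moreover have "(a, b) \<in> transp_letters (Y - {x})" using * ab by (auto simp: transp_letters_def)
    ultimately show ?thesis using x by blast
  next
    assume *: "a = x"
    show ?thesis
    proof (cases "b = y")
      case True
      then show ?thesis using t_square [of "(x, y)"] * x Y by (auto simp: transp_letters_def)
    next
      case False
      have "t (x, y) \<otimes> t (x, b) = t (y, b) \<otimes> t (x, y)"
        by (rule t_conj) (use * False ab x Y in auto)
      moreover have "(y, b) \<in> transp_letters (Y - {x})"
        using * False ab x by (auto simp: transp_letters_def)
      ultimately show ?thesis using x * by blast
    qed
  next
    assume *: "a = y" "b \<noteq> x"
    \<comment> \<open>The relator for the triple \<open>b, y, x\<close>, read from right to left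
      after reversing orientations, is the rule needed when the letters share
      \<open>y\<close>.\<close>
    have "t (b, y) \<otimes> t (b, x) = t (y, x) \<otimes> t (b, y)"
      by (rule t_conj) (use * ab x Y in auto)
    moreover have "t (y, x) = t (x, y)" "t (b, y) = t (y, b)" "t (b, x) = t (x, b)"
      using t_swap [of "(x, y)"] t_swap [of "(y, b)"] t_swap [of "(x, b)"] * ab x Y
      by (auto simp: transp_letters_def)
    ultimately have "t (x, y) \<otimes> t (y, b) = t (y, b) \<otimes> t (x, b)" by simp
    moreover have "(y, b) \<in> transp_letters (Y - {x})" using * ab x by (auto simp: transp_letters_def)
    ultimately show ?thesis using * ab by blast
  qed
  obtain a b where ab: "l = (a, b)" "a \<in> Y" "b \<in> Y" "a \<noteq> b"
    using l by (auto simp: transp_letters_def)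
  have "t (b, a) = t l" using t_swap [of l] ab Y by (auto simp: transp_letters_def)
  then show ?thesis using main [of a b] main [of b a] ab x(3) by auto
qed

text \<open>A normal form with respect to \<open>x\<close>: all letters involving \<open>x\<close>
  are collected into at most one, at the right end. Its presence decides whether \<open>x\<close> is
  moved.\<close>

lemma isolate_point:
  assumes Y: "Y \<subseteq> X" and x: "x \<in> Y" and ls: "set ls \<subseteq> transp_letters Y"
  shows "\<exists>us. set us \<subseteq> transp_letters (Y - {x}) \<and>
    (list_prod H t ls = list_prod H t us \<or>
     (\<exists>y \<in> Y - {x}. list_prod H t ls = list_prod H t us \<otimes> t (x, y)))"
  using ls
proof (induction ls rule: rev_induct)
  case Nil
  then show ?case by (intro exI [of _ "[]"]) simp
next
  case (snoc l ls)
  have in_X: "k \<in> transp_letters X" if "k \<in> transp_letters Y \<or> k \<in> transp_letters (Y - {x})" for k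
    using that Y by (auto simp: transp_letters_def)
  have l: "l \<in> transp_letters Y" "t l \<in> carrier H" using snoc.prems t_closed in_X by auto
  have prod_ls: "list_prod H t (ls @ [l]) = list_prod H t ls \<otimes> t l"
    by (rule list_prod_snoc) (use snoc.prems t_closed in_X in \<open>auto intro: is_monoid\<close>)
  obtain us where us: "set us \<subseteq> transp_letters (Y - {x})"
    "list_prod H t ls = list_prod H t us \<or> (\<exists>y \<in> Y - {x}. list_prod H t ls = list_prod H t us \<otimes> t (x, y))"
    using snoc by auto
  have tus: "t k \<in> carrier H" if "k \<in> set us" for k using that us(1) t_closed in_X by blast
  have cus: "list_prod H t us \<in> carrier H" by (rule list_prod_closed [OF is_monoid tus])
  have us_snoc: "list_prod H t (us @ [k]) = list_prod H t us \<otimes> t k" if "k \<in> transp_letters (Y - {x})" for k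
    by (rule list_prod_snoc [OF is_monoid tus]) (use that t_closed in_X in auto)
  have xz: "t (x, z) \<in> carrier H" if "z \<in> Y - {x}" for z
    using that x Y by (intro t_closed) (auto simp: transp_letters_def)
  from us(2) show ?case
  proof (elim disjE bexE)
    assume e: "list_prod H t ls = list_prod H t us"
    show ?thesis
    proof (cases "x \<in> pts l")
      case False
      then have "l \<in> transp_letters (Y - {x})" using l(1) by (auto simp: pts_transp)
      then show ?thesis using us(1) us_snoc e prod_ls by (intro exI [of _ "us @ [l]"]) simp
    next
      case True
      define z where "z = other x l"
      have z: "z \<in> Y - {x}" "l = (x, z) \<or> prod.swap l = (x, z)"
        using True l(1) unfolding z_def by (cases l; auto simp: pts_def other_def transp_letters_def)+
      then have "t l = t (x, z)" using t_swap [of l] l(1) in_X by auto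
      then show ?thesis using us(1) e prod_ls z(1) by auto
    qed
  next
    fix y assume y: "y \<in> Y - {x}" "list_prod H t ls = list_prod H t us \<otimes> t (x, y)"
    then have e: "list_prod H t (ls @ [l]) = list_prod H t us \<otimes> (t (x, y) \<otimes> t l)"
      using prod_ls cus xz l(2) by (simp add: m_assoc)
    from push_letter [OF Y l(1) x, of y] y(1) consider "t (x, y) \<otimes> t l = \<one>"
      | k z where "k \<in> transp_letters (Y - {x})" "z \<in> Y - {x}" "t (x, y) \<otimes> t l = t k \<otimes> t (x, z)"
      by blast
    then show ?thesis
    proof cases
      case 1
      then show ?thesis using e us(1) cus by auto
    next
      case 2
      have "list_prod H t (ls @ [l]) = list_prod H t (us @ [k]) \<otimes> t (x, z)"
        using e 2 us_snoc [OF 2(1)] cus xz [OF 2(2)] t_closed [of k] in_X [of k] by (simp add: m_assoc)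
      then show ?thesis using 2 us(1) by (intro exI [of _ "us @ [k]"]) auto
    qed
  qed
qed

end

section \<open>The relators in the group and in its quotients\<close>

lemma transp_letters_iff [simp]: "(x, y) \<in> transp_letters X \<longleftrightarrow> x \<in> X \<and> y \<in> X \<and> x \<noteq> y"
  by (simp add: transp_letters_def)

lemma distinct4: "card {x, y, z, w} = 4 \<Longrightarrow> x \<noteq> y \<and> x \<noteq> z \<and> x \<noteq> w \<and> y \<noteq> z \<and> y \<noteq> w \<and> z \<noteq> w"
  by (auto simp: card_insert_if split: if_splits)

lemma distinct3: "card {x, y, z} = 3 \<Longrightarrow> x \<noteq> y \<and> x \<noteq> z \<and> y \<noteq> z"
  by (auto simp: card_insert_if split: if_splits)

text \<open>The commutation and conjugation relators are brought into the form of a quotient of two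
  products, so that membership in a normal subgroup means equality of cosets, and membership in the
  kernel means equal action.\<close>

lemma transp_relators_cases:
  "c \<in> transp_relators X \<longleftrightarrow>
    (\<exists>x y. x \<in> X \<and> y \<in> X \<and> x \<noteq> y \<and> c = letter X (x, y) \<otimes>\<^bsub>BFS' X\<^esub> letter X (x, y)) \<or>
    (\<exists>x y z w. {x, y, z, w} \<subseteq> X \<and> card {x, y, z, w} = 4 \<and>
      c = (letter X (x, y) \<otimes>\<^bsub>BFS' X\<^esub> letter X (z, w)) \<otimes>\<^bsub>BFS' X\<^esub>
        inv\<^bsub>BFS' X\<^esub> (letter X (z, w) \<otimes>\<^bsub>BFS' X\<^esub> letter X (x, y))) \<or>
    (\<exists>x y z. {x, y, z} \<subseteq> X \<and> card {x, y, z} = 3 \<and>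
      c = (letter X (x, y) \<otimes>\<^bsub>BFS' X\<^esub> letter X (x, z)) \<otimes>\<^bsub>BFS' X\<^esub>
        inv\<^bsub>BFS' X\<^esub> (letter X (y, z) \<otimes>\<^bsub>BFS' X\<^esub> letter X (x, y)))"
proof -
  interpret group "BFS' X" by (rule group_BFS')
  have sq: "letter X (x, y) [^]\<^bsub>BFS' X\<^esub> (2::nat) = letter X (x, y) \<otimes>\<^bsub>BFS' X\<^esub> letter X (x, y)"
    if "x \<in> X" "y \<in> X" "x \<noteq> y" for x y
    using letter_carrier [of "(x, y)" X] that by (simp add: numeral_2_eq_2)
  have com: "letter X (x, y) \<otimes>\<^bsub>BFS' X\<^esub> letter X (z, w) \<otimes>\<^bsub>BFS' X\<^esub> inv\<^bsub>BFS' X\<^esub> (letter X (x, y))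
        \<otimes>\<^bsub>BFS' X\<^esub> inv\<^bsub>BFS' X\<^esub> (letter X (z, w)) =
      (letter X (x, y) \<otimes>\<^bsub>BFS' X\<^esub> letter X (z, w)) \<otimes>\<^bsub>BFS' X\<^esub>
        inv\<^bsub>BFS' X\<^esub> (letter X (z, w) \<otimes>\<^bsub>BFS' X\<^esub> letter X (x, y))"
    if "{x, y, z, w} \<subseteq> X" "card {x, y, z, w} = 4" for x y z w
    using letter_carrier [of "(x, y)" X] letter_carrier [of "(z, w)" X] that distinct4 [OF that(2)]
    by (simp add: inv_mult_group m_assoc)
  have con: "letter X (x, y) \<otimes>\<^bsub>BFS' X\<^esub> letter X (x, z) \<otimes>\<^bsub>BFS' X\<^esub> inv\<^bsub>BFS' X\<^esub> (letter X (x, y))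
        \<otimes>\<^bsub>BFS' X\<^esub> inv\<^bsub>BFS' X\<^esub> (letter X (y, z)) =
      (letter X (x, y) \<otimes>\<^bsub>BFS' X\<^esub> letter X (x, z)) \<otimes>\<^bsub>BFS' X\<^esub>
        inv\<^bsub>BFS' X\<^esub> (letter X (y, z) \<otimes>\<^bsub>BFS' X\<^esub> letter X (x, y))"
    if "{x, y, z} \<subseteq> X" "card {x, y, z} = 3" for x y z
    using letter_carrier [of "(x, y)" X] letter_carrier [of "(x, z)" X] letter_carrier [of "(y, z)" X]
      that distinct3 [OF that(2)]
    by (simp add: inv_mult_group m_assoc)
  show ?thesis
    unfolding transp_relators_def Let_def Un_iff mem_Collect_eq disj_assoc
    apply (intro arg_cong2 [where f = "(\<or>)"] ex_cong1)
    using sq com con by metis+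
qed

lemma transp_relators_carrier: "transp_relators X \<subseteq> carrier (BFS' X)"
proof
  interpret group "BFS' X" by (rule group_BFS')
  fix c assume "c \<in> transp_relators X"
  then show "c \<in> carrier (BFS' X)"
    unfolding transp_relators_cases
    by (elim disjE exE conjE) (auto dest!: distinct4 distinct3 intro!: m_closed inv_closed letter_carrier)
qed

lemma act_mult':
  assumes "c \<in> carrier (BFS' X)" "d \<in> carrier (BFS' X)" "x \<in> X"
  shows "act X (c \<otimes>\<^bsub>BFS' X\<^esub> d) x = act X d (act X c x)"
  using act_mult [OF carrier_BFS' [OF assms(1)] carrier_BFS' [OF assms(2)] assms(3)]
  by (simp add: mult_BFS')

lemma act_quotient:
  assumes "c \<in> carrier (BFS' X)" "d \<in> carrier (BFS' X)" "x \<in> X" "act X c x = act X d x"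
  shows "act X (c \<otimes>\<^bsub>BFS' X\<^esub> inv\<^bsub>BFS' X\<^esub> d) x = x"
  using act_mult' [OF assms(1) group.inv_closed [OF group_BFS' assms(2)] assms(3)] assms
    act_inv(1) [OF carrier_BFS' [OF assms(2)] assms(3)]
  by (simp add: inv_BFS')

lemma transp_relators_kernel: "transp_relators X \<subseteq> kernel (BFS' X) (BijGroup X) (perm X)"
proof
  interpret group "BFS' X" by (rule group_BFS')
  have two: "act X (letter X (a, b) \<otimes>\<^bsub>BFS' X\<^esub> letter X (a', b')) v = transpose (a', b') (transpose (a, b) v)"
    if "{a, b, a', b'} \<subseteq> X" "a \<noteq> b" "a' \<noteq> b'" "v \<in> X" for a b a' b' v
  proof -
    have "transpose (a, b) v \<in> X" using that by (auto simp: transpose_def other_def)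
    then show ?thesis
      using that by (simp add: act_mult' letter_carrier act_letter)
  qed
  fix c assume c: "c \<in> transp_relators X"
  then have "act X c v = v" if v: "v \<in> X" for v
    unfolding transp_relators_cases
  proof (elim disjE exE conjE)
    fix x y assume "x \<in> X" "y \<in> X" "x \<noteq> y" "c = letter X (x, y) \<otimes>\<^bsub>BFS' X\<^esub> letter X (x, y)"
    then show ?thesis using two [of x y x y] v by (auto simp: transpose_def other_def pts_def)
  next
    fix x y z w assume *: "{x, y, z, w} \<subseteq> X" "card {x, y, z, w} = 4"
      "c = (letter X (x, y) \<otimes>\<^bsub>BFS' X\<^esub> letter X (z, w)) \<otimes>\<^bsub>BFS' X\<^esub>
        inv\<^bsub>BFS' X\<^esub> (letter X (z, w) \<otimes>\<^bsub>BFS' X\<^esub> letter X (x, y))"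
    note d = distinct4 [OF *(2)]
    show ?thesis unfolding *(3)
      by (rule act_quotient) (use * d v two in \<open>auto simp: letter_carrier transpose_def other_def pts_def\<close>)
  next
    fix x y z assume *: "{x, y, z} \<subseteq> X" "card {x, y, z} = 3"
      "c = (letter X (x, y) \<otimes>\<^bsub>BFS' X\<^esub> letter X (x, z)) \<otimes>\<^bsub>BFS' X\<^esub>
        inv\<^bsub>BFS' X\<^esub> (letter X (y, z) \<otimes>\<^bsub>BFS' X\<^esub> letter X (x, y))"
    note d = distinct3 [OF *(2)]
    show ?thesis unfolding *(3)
      by (rule act_quotient) (use * d v two in \<open>auto simp: letter_carrier transpose_def other_def pts_def\<close>)
  qed
  then show "c \<in> kernel (BFS' X) (BijGroup X) (perm X)"
    using c transp_relators_carrier by (auto simp: perm_kernel)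
qed

lemma transposition_group_quotient:
  assumes N: "N \<lhd> BFS' X" and R: "transp_relators X \<subseteq> N"
  shows "transposition_group (BFS' X Mod N) X (\<lambda>l. N #>\<^bsub>BFS' X\<^esub> letter X l)"
proof -
  interpret N: normal N "BFS' X" by (rule N)
  interpret q: group_hom "BFS' X" "BFS' X Mod N" "\<lambda>a. N #>\<^bsub>BFS' X\<^esub> a"
    using N.factorgroup_is_group N.r_coset_hom_Mod N.is_group
    by (intro group_hom.intro group_hom_axioms.intro)
  have eqI: "N #>\<^bsub>BFS' X\<^esub> a = N #>\<^bsub>BFS' X\<^esub> b"
    if ab: "a \<in> carrier (BFS' X)" "b \<in> carrier (BFS' X)" "a \<otimes>\<^bsub>BFS' X\<^esub> inv\<^bsub>BFS' X\<^esub> b \<in> N" for a b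
  proof -
    have "a = a \<otimes>\<^bsub>BFS' X\<^esub> inv\<^bsub>BFS' X\<^esub> b \<otimes>\<^bsub>BFS' X\<^esub> b" using ab by (simp add: N.m_assoc)
    then have "a \<in> N #>\<^bsub>BFS' X\<^esub> b" using ab(3) unfolding r_coset_def by blast
    then show ?thesis using N.repr_independence [OF _ ab(2) N.subgroup_axioms] by simp
  qed
  have sq: "letter X l \<otimes>\<^bsub>BFS' X\<^esub> letter X l \<in> N" if l: "l \<in> transp_letters X" for l
  proof -
    obtain x y where "l = (x, y)" "x \<in> X" "y \<in> X" "x \<noteq> y" using l by (cases l) auto
    then have "letter X l \<otimes>\<^bsub>BFS' X\<^esub> letter X l \<in> transp_relators X"
      unfolding transp_relators_cases by blast
    then show ?thesis using R by blast
  qed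
  show ?thesis
  proof (intro transposition_group.intro transposition_group_axioms.intro q.H.is_group)
    fix l assume l: "l \<in> transp_letters X"
    note c = letter_carrier [OF l]
    show "N #>\<^bsub>BFS' X\<^esub> letter X l \<in> carrier (BFS' X Mod N)" using c by simp
    \<comment> \<open>A letter and its inverse differ modulo \<open>N\<close> by the square of the
      letter, which is a relator.\<close>
    show "N #>\<^bsub>BFS' X\<^esub> letter X (prod.swap l) = N #>\<^bsub>BFS' X\<^esub> letter X l"
      using eqI [OF c N.inv_closed [OF c]] sq [OF l] c by (simp add: inv_letter [OF l, symmetric])
    show "(N #>\<^bsub>BFS' X\<^esub> letter X l) \<otimes>\<^bsub>BFS' X Mod N\<^esub> (N #>\<^bsub>BFS' X\<^esub> letter X l) = \<one>\<^bsub>BFS' X Mod N\<^esub>"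
      unfolding q.hom_mult [OF c c, symmetric] q.hom_one [symmetric]
      by (rule eqI) (use c sq [OF l] in simp_all)
  next
    fix x y z w assume *: "{x, y, z, w} \<subseteq> X" "card {x, y, z, w} = 4"
    then have c: "letter X (x, y) \<in> carrier (BFS' X)" "letter X (z, w) \<in> carrier (BFS' X)"
      using distinct4 [OF *(2)] by (auto intro!: letter_carrier)
    have "(letter X (x, y) \<otimes>\<^bsub>BFS' X\<^esub> letter X (z, w)) \<otimes>\<^bsub>BFS' X\<^esub>
        inv\<^bsub>BFS' X\<^esub> (letter X (z, w) \<otimes>\<^bsub>BFS' X\<^esub> letter X (x, y)) \<in> N"
      using R * unfolding subset_iff transp_relators_cases by blast
    then show "(N #>\<^bsub>BFS' X\<^esub> letter X (x, y)) \<otimes>\<^bsub>BFS' X Mod N\<^esub> (N #>\<^bsub>BFS' X\<^esub> letter X (z, w)) =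
        (N #>\<^bsub>BFS' X\<^esub> letter X (z, w)) \<otimes>\<^bsub>BFS' X Mod N\<^esub> (N #>\<^bsub>BFS' X\<^esub> letter X (x, y))"
      unfolding q.hom_mult [OF c(1,2), symmetric] q.hom_mult [OF c(2,1), symmetric]
      by (intro eqI N.m_closed c)
  next
    fix x y z assume *: "{x, y, z} \<subseteq> X" "card {x, y, z} = 3"
    then have c: "letter X (x, y) \<in> carrier (BFS' X)" "letter X (x, z) \<in> carrier (BFS' X)"
      "letter X (y, z) \<in> carrier (BFS' X)"
      using distinct3 [OF *(2)] by (auto intro!: letter_carrier)
    have "(letter X (x, y) \<otimes>\<^bsub>BFS' X\<^esub> letter X (x, z)) \<otimes>\<^bsub>BFS' X\<^esub>
        inv\<^bsub>BFS' X\<^esub> (letter X (y, z) \<otimes>\<^bsub>BFS' X\<^esub> letter X (x, y)) \<in> N"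
      using R * unfolding subset_iff transp_relators_cases by blast
    then show "(N #>\<^bsub>BFS' X\<^esub> letter X (x, y)) \<otimes>\<^bsub>BFS' X Mod N\<^esub> (N #>\<^bsub>BFS' X\<^esub> letter X (x, z)) =
        (N #>\<^bsub>BFS' X\<^esub> letter X (y, z)) \<otimes>\<^bsub>BFS' X Mod N\<^esub> (N #>\<^bsub>BFS' X\<^esub> letter X (x, y))"
      unfolding q.hom_mult [OF c(1,2), symmetric] q.hom_mult [OF c(3,1), symmetric]
      by (intro eqI N.m_closed c)
  qed
qed

text \<open>The points of \<open>C\<close> are removed one at a time by
  \<open>isolate_point\<close>. A final letter joining \<open>x\<close> to \<open>y\<close> cannot
  remain: the other letters avoid \<open>x\<close>, so the product would send \<open>x\<close> to
  \<open>y\<close>, contrary to the hypothesis. The assumption that \<open>N\<close> lies in the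
  kernel makes the action constant on cosets, so that this can be read off modulo
  \<open>N\<close>.\<close>

lemma eliminate_points:
  assumes N: "N \<lhd> BFS' X" and R: "transp_relators X \<subseteq> N"
    and ker: "N \<subseteq> kernel (BFS' X) (BijGroup X) (perm X)"
    and C: "finite C" "C \<subseteq> X" and ls: "set ls \<subseteq> transp_letters X"
    and fix_C: "\<And>x. x \<in> C \<Longrightarrow> act X (list_prod (BFS' X) (letter X) ls) x = x"
  shows "\<exists>us. set us \<subseteq> transp_letters (X - C) \<and>
    N #>\<^bsub>BFS' X\<^esub> list_prod (BFS' X) (letter X) ls = N #>\<^bsub>BFS' X\<^esub> list_prod (BFS' X) (letter X) us"
proof -
  let ?P = "list_prod (BFS' X) (letter X)"
  interpret N: normal N "BFS' X" by (rule N)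
  interpret q: group_hom "BFS' X" "BFS' X Mod N" "\<lambda>a. N #>\<^bsub>BFS' X\<^esub> a"
    using N.factorgroup_is_group N.r_coset_hom_Mod N.is_group
    by (intro group_hom.intro group_hom_axioms.intro)
  interpret transposition_group "BFS' X Mod N" X "\<lambda>l. N #>\<^bsub>BFS' X\<^esub> letter X l"
    by (rule transposition_group_quotient [OF N R])
  have P_hom: "N #>\<^bsub>BFS' X\<^esub> ?P us = list_prod (BFS' X Mod N) (\<lambda>l. N #>\<^bsub>BFS' X\<^esub> letter X l) us"
    if "set us \<subseteq> transp_letters X" for us
    by (rule list_prod_hom [OF q.group_hom_axioms]) (use that letter_carrier in blast)
  \<comment> \<open>Equal cosets differ by an element of \<open>N\<close>, which acts
    trivially.\<close>
  have act_eq: "act X a v = act X b v"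
    if ab: "a \<in> carrier (BFS' X)" "b \<in> carrier (BFS' X)" "N #>\<^bsub>BFS' X\<^esub> a = N #>\<^bsub>BFS' X\<^esub> b" and v: "v \<in> X"
    for a b v
  proof -
    have "a \<in> N #>\<^bsub>BFS' X\<^esub> b" using N.rcos_self [OF ab(1) N.subgroup_axioms] ab(3) by simp
    then obtain n where n: "n \<in> N" "a = n \<otimes>\<^bsub>BFS' X\<^esub> b" by (auto simp: r_coset_def)
    have "n \<in> carrier (BFS' X)" "act X n v = v" using n(1) ker v by (auto simp: perm_kernel)
    then show ?thesis using act_mult' [OF _ ab(2) v, of n] n(2) by simp
  qed
  show ?thesis using C fix_C
  proof (induction C rule: finite_induct)
    case empty
    then show ?case using ls by auto
  next
    case (insert x C)
    let ?Y = "X - C"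
    obtain us where us: "set us \<subseteq> transp_letters ?Y" "N #>\<^bsub>BFS' X\<^esub> ?P ls = N #>\<^bsub>BFS' X\<^esub> ?P us"
      using insert by auto
    have x: "x \<in> ?Y" "x \<in> X" using insert by auto
    obtain vs where vs: "set vs \<subseteq> transp_letters (?Y - {x})"
      and alt: "N #>\<^bsub>BFS' X\<^esub> ?P us = N #>\<^bsub>BFS' X\<^esub> ?P vs \<or>
        (\<exists>y \<in> ?Y - {x}. N #>\<^bsub>BFS' X\<^esub> ?P us = (N #>\<^bsub>BFS' X\<^esub> ?P vs) \<otimes>\<^bsub>BFS' X Mod N\<^esub> (N #>\<^bsub>BFS' X\<^esub> letter X (x, y)))"
    proof -
      have sub: "set us \<subseteq> transp_letters X" using us(1) transp_letters_mono [of ?Y X] by blast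
      have sub': "set vs \<subseteq> transp_letters X" if "set vs \<subseteq> transp_letters (?Y - {x})" for vs
        using that transp_letters_mono [of "?Y - {x}" X] by blast
      show ?thesis
        using isolate_point [OF Diff_subset x(1) us(1)] P_hom [OF sub] P_hom [OF sub'] that by metis
    qed
    have vsX: "set vs \<subseteq> transp_letters X" using vs transp_letters_mono [of "?Y - {x}" X] by blast
    note cv = list_prod_letters_carrier [OF vsX] and cl = list_prod_letters_carrier [OF ls]
    from alt show ?case
    proof (elim disjE bexE)
      assume "N #>\<^bsub>BFS' X\<^esub> ?P us = N #>\<^bsub>BFS' X\<^esub> ?P vs"
      moreover have "?Y - {x} = X - insert x C" by auto
      ultimately show ?thesis using us(2) vs by auto
    next
      fix y assume y: "y \<in> ?Y - {x}"
        and "N #>\<^bsub>BFS' X\<^esub> ?P us = (N #>\<^bsub>BFS' X\<^esub> ?P vs) \<otimes>\<^bsub>BFS' X Mod N\<^esub> (N #>\<^bsub>BFS' X\<^esub> letter X (x, y))"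
      moreover have xy: "(x, y) \<in> transp_letters X" using x y by auto
      ultimately have "N #>\<^bsub>BFS' X\<^esub> ?P ls = N #>\<^bsub>BFS' X\<^esub> (?P vs \<otimes>\<^bsub>BFS' X\<^esub> letter X (x, y))"
        using us(2) cv letter_carrier [OF xy] by simp
      then have "act X (?P ls) x = act X (?P vs \<otimes>\<^bsub>BFS' X\<^esub> letter X (x, y)) x"
        using act_eq cl N.m_closed [OF cv letter_carrier [OF xy]] x(2) by blast
      also have "\<dots> = transpose (x, y) (act X (?P vs) x)"
        using act_mult' [OF cv letter_carrier [OF xy] x(2)] act_in [OF carrier_BFS' [OF cv] x(2)]
          act_letter [OF xy] by simp
      also have "act X (?P vs) x = x"
        using act_list_prod_fixed [of vs X "insert x C" x] vs x(2) by (simp add: Diff_insert [of X x C])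
      \<comment> \<open>The letters of \<open>vs\<close> leave \<open>x\<close> in place and the
        last letter carries it to \<open>y\<close>, which differs from \<open>x\<close>.\<close>
      finally have "act X (?P ls) x = y" by (simp add: transpose_def pts_def other_def)
      then show ?thesis using insert.prems(2) [of x] y by simp
    qed
  qed
qed

section \<open>The kernel as the closed normal closure of the relators\<close>

lemma perm_kernel_closed: "closedin (topS' X) (kernel (BFS' X) (BijGroup X) (perm X))"
  unfolding closedin_def topspace_topS'
proof
  show "kernel (BFS' X) (BijGroup X) (perm X) \<subseteq> carrier (BFS' X)" by (auto simp: perm_kernel)
  show "openin (topS' X) (carrier (BFS' X) - kernel (BFS' X) (BijGroup X) (perm X))"
    unfolding openin_topS'
  proof (intro conjI ballI Diff_subset)
    interpret group "BFS X" by (rule group_BFS)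
    fix u assume "u \<in> carrier (BFS' X) - kernel (BFS' X) (BijGroup X) (perm X)"
    then obtain x where u: "u \<in> carrier (BFS' X)" and x: "x \<in> X" "act X u x \<noteq> x"
      by (auto simp: perm_kernel)
    note uc = carrier_BFS' [OF u]
    \<comment> \<open>The quotient by \<open>u\<close> on the left is a condition at the image of
      \<open>x\<close> under \<open>u\<close>, not at \<open>x\<close>: fixing that image forces
      \<open>v\<close> to move \<open>x\<close> as \<open>u\<close> does.\<close>
    let ?C = "{act X u x}"
    have C: "?C \<subseteq> X" using act_in [OF uc x(1)] by simp
    have "act X v x \<noteq> x"
      if v: "v \<in> carrier (BFS' X)" "inv\<^bsub>BFS X\<^esub> u \<otimes>\<^bsub>BFS X\<^esub> v \<in> W_subgroup X ?C" for v
    proof -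
      have "act X (inv\<^bsub>BFS X\<^esub> u \<otimes>\<^bsub>BFS X\<^esub> v) (act X u x) = act X u x"
        using v(2) W_subgroup_iff [OF C] by blast
      then have "act X v x = act X u x"
        using act_mult [OF inv_closed [OF uc] carrier_BFS' [OF v(1)] act_in [OF uc x(1)]]
          act_inv(1) [OF uc x(1)] by simp
      then show ?thesis using x(2) by simp
    qed
    then show "\<exists>C. C \<subseteq> X \<and> finite C \<and> (\<forall>v\<in>carrier (BFS' X). inv\<^bsub>BFS X\<^esub> u \<otimes>\<^bsub>BFS X\<^esub> v \<in> W_subgroup X C \<longrightarrow>
        v \<in> carrier (BFS' X) - kernel (BFS' X) (BijGroup X) (perm X))"
      using C x(1) by (intro exI [of _ ?C]) (auto simp: perm_kernel)
  qed
qed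

text \<open>If \<open>c\<close> were outside the closed set \<open>N\<close>, some coset of a
  \<open>W_subgroup X C\<close> around \<open>c\<close> would miss \<open>N\<close>. Approximating
  \<open>c\<close> by a finite word and dividing by its remainder away from \<open>C\<close> yields
  an element of \<open>N\<close> in that very coset.\<close>

lemma perm_kernel_minimal:
  assumes N: "N \<lhd> BFS' X" "closedin (topS' X) N" "transp_relators X \<subseteq> N"
  shows "kernel (BFS' X) (BijGroup X) (perm X) \<subseteq> N"
proof
  let ?K = "kernel (BFS' X) (BijGroup X) (perm X)" and ?P = "list_prod (BFS' X) (letter X)"
  interpret G: group "BFS' X" by (rule group_BFS')
  interpret S: group "BFS X" by (rule group_BFS)
  interpret h: group_hom "BFS' X" "BijGroup X" "perm X" by (rule perm_hom)
  \<comment> \<open>\<open>eliminate_points\<close> needs a normal subgroup inside the kernel, and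
    \<open>N\<close> is not known to be one; the intersection still contains the relators.\<close>
  have NK: "N \<inter> ?K \<lhd> BFS' X" by (rule G.normal_subgroup_intersect [OF N(1) h.normal_kernel])
  fix c assume c: "c \<in> ?K"
  then have cc: "c \<in> carrier (BFS' X)" and c_fix: "\<And>x. x \<in> X \<Longrightarrow> act X c x = x"
    by (auto simp: perm_kernel)
  show "c \<in> N"
  proof (rule ccontr)
    assume "c \<notin> N"
    moreover have "openin (topS' X) (carrier (BFS' X) - N)"
      using N(2) by (simp add: closedin_def topspace_topS')
    ultimately obtain C where C: "C \<subseteq> X" "finite C" and
      C_N: "\<And>v. v \<in> carrier (BFS' X) \<Longrightarrow> inv\<^bsub>BFS X\<^esub> c \<otimes>\<^bsub>BFS X\<^esub> v \<in> W_subgroup X C \<Longrightarrow> v \<notin> N"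
      unfolding openin_topS' using cc by (metis DiffE DiffI)
    interpret W: subgroup "W_subgroup X C" "BFS X" by (rule W_subgroup_subgroup [OF C(1)])
    obtain ls where ls: "set ls \<subseteq> transp_letters X"
      and lsW: "inv\<^bsub>BFS X\<^esub> c \<otimes>\<^bsub>BFS X\<^esub> ?P ls \<in> W_subgroup X C"
      using W_subgroup_approximation [OF cc C(2,1)] by blast
    note cl = list_prod_letters_carrier [OF ls] and cS = carrier_BFS' [OF cc]
    \<comment> \<open>Both \<open>c\<close> and the quotient in \<open>W_subgroup X C\<close> fix
      \<open>C\<close> pointwise, hence so does the approximating word exactly.\<close>
    have "act X (?P ls) x = x" if "x \<in> C" for x
    proof -
      have x: "x \<in> X" using that C by blast
      have "act X (inv\<^bsub>BFS X\<^esub> c) x = x" using act_inv(1) [OF cS x] c_fix [OF x] by simp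
      moreover have "act X (inv\<^bsub>BFS X\<^esub> c \<otimes>\<^bsub>BFS X\<^esub> ?P ls) x = x"
        using lsW that W_subgroup_iff [OF C(1)] by blast
      ultimately show ?thesis
        using act_mult [OF S.inv_closed [OF cS] carrier_BFS' [OF cl] x] by simp
    qed
    then obtain us where us: "set us \<subseteq> transp_letters (X - C)"
      "(N \<inter> ?K) #>\<^bsub>BFS' X\<^esub> ?P ls = (N \<inter> ?K) #>\<^bsub>BFS' X\<^esub> ?P us"
      using eliminate_points [OF NK _ _ C(2,1) ls] N(3) transp_relators_kernel by blast
    have usX: "set us \<subseteq> transp_letters X" using us(1) transp_letters_mono [of "X - C" X] by blast
    note cu = list_prod_letters_carrier [OF usX]
    have "?P ls \<in> (N \<inter> ?K) #>\<^bsub>BFS' X\<^esub> ?P us"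
      using G.rcos_self [OF cl normal_imp_subgroup [OF NK]] us(2) by simp
    then obtain n where n: "n \<in> N" "n \<in> carrier (BFS' X)" "?P ls = n \<otimes>\<^bsub>BFS' X\<^esub> ?P us"
      by (auto simp: r_coset_def perm_kernel)
    \<comment> \<open>This element lies in \<open>N\<close> because the two products have the same
      coset. It stays in the coset of \<open>c\<close>, since \<open>?P us\<close> avoids
      \<open>C\<close> and therefore lies in \<open>W_subgroup X C\<close>.\<close>
    let ?v = "?P ls \<otimes>\<^bsub>BFS' X\<^esub> inv\<^bsub>BFS' X\<^esub> (?P us)"
    have "?v = n" using n(2,3) cu by (simp add: G.m_assoc)
    moreover have "inv\<^bsub>BFS X\<^esub> c \<otimes>\<^bsub>BFS X\<^esub> ?v = (inv\<^bsub>BFS X\<^esub> c \<otimes>\<^bsub>BFS X\<^esub> ?P ls) \<otimes>\<^bsub>BFS X\<^esub> inv\<^bsub>BFS X\<^esub> (?P us)"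
      using cS carrier_BFS' [OF cl] carrier_BFS' [OF cu] by (simp add: mult_BFS' inv_BFS' [OF cu] S.m_assoc)
    moreover have "\<dots> \<in> W_subgroup X C"
      by (intro W.m_closed lsW W.m_inv_closed list_prod_W_subgroup [OF us(1) C(1)])
    ultimately show False using C_N n(1,2) by metis
  qed
qed

theorem theorem3p5p2:
  fixes X :: "'x set"
  shows "generalized_presentation (transp_letters X) prod.swap (wordsS' X) (topS' X)
           (transp_relators X) (BijGroup X)"
  unfolding generalized_presentation_def
proof (intro conjI bexI)
  interpret h: group_hom "BFS' X" "BijGroup X" "perm X" by (rule perm_hom)
  show "free_involution (transp_letters X) prod.swap" by (rule free_involution_transp)
  show "admissible_words (transp_letters X) prod.swap (wordsS' X)" by (rule wordsS'_admissible)
  show "letter_word ` transp_letters X \<subseteq> wordsS' X" using letter_word_wordsS' by blast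
  show "admissible_topology (transp_letters X) prod.swap (wordsS' X) (topS' X)" by (rule topS'_admissible)
  show "transp_relators X \<subseteq> carrier (BFS' X)" by (rule transp_relators_carrier)
  show "perm X \<in> epi (BFS' X) (BijGroup X)"
    using h.homh perm_surj by (simp add: epi_def)
  show "kernel (BFS' X) (BijGroup X) (perm X) = closed_normal_closure (BFS' X) (topS' X) (transp_relators X)"
    unfolding closed_normal_closure_def
  proof
    show "kernel (BFS' X) (BijGroup X) (perm X) \<subseteq>
        \<Inter>{N. N \<lhd> BFS' X \<and> closedin (topS' X) N \<and> transp_relators X \<subseteq> N}"
      using perm_kernel_minimal by blast
    show "\<Inter>{N. N \<lhd> BFS' X \<and> closedin (topS' X) N \<and> transp_relators X \<subseteq> N} \<subseteq>
        kernel (BFS' X) (BijGroup X) (perm X)"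
      using h.normal_kernel perm_kernel_closed transp_relators_kernel by blast
  qed
qed

end
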